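(* Fix constants $C'_{\mathcal E},C_1,C_2,C_{\rm reg}>0$, an integer $m\ge1$ and spaces $\mathcal Z^0=\mathcal V$, $\mathcal Z^1=\mathcal H$, $\mathcal Z^j$, $j=2,\dots,m+1$, and let $C_{\rm osc},C_{\Pi_0}>0$. Then there exist $c,C>0$ such that for all operators $P$ such that - Assumption 1 holds for $P$ (with the fixed $C'_{\mathcal E},C_1,C_2$), - Assumption 2 holds for both $P$ and $P^*$ (with the fixed $C'_{\mathcal E},C_1,C_2,C_{\rm reg}$, $m$ and $\mathcal Z^j$), and - given $f\in\mathcal H^*$, the solution $u\in\mathcal H$ of $Pu=f$ exists and is unique, the following holds. If $$\gamma_{\rm dv}(P)+\gamma_{\rm dv}(P^* )+\big(\|I-\Pi_h\|_{\mathcal Z^{m+1}\to\mathcal H}\big)^2\big(1+\|(P^* )^{-1}\Pi_1^*\|_{\mathcal V^*\to\mathcal V}\big)\le c,\qquad(\star)$$ then, with $u\in\mathcal H$ the solution of $Pu=f$, the Galerkin approximation $u_h\in\mathcal H_h$ defined by $\langle P(u-u_h),v_h\rangle_{\mathcal H^*\times\mathcal H}=0$ for all $v_h\in\mathcal H_h$ exists, is unique, and satisfies $$\|u-u_h\|_{\mathcal H}\le C\Big(1+\|I-\Pi_h\|_{\mathcal Z^{m+1}\to\mathcal H}\big(1+\|(P^* )^{-1}\Pi_1^*\|_{\mathcal V^*\to\mathcal V}\big)\Big)\|(I-\Pi_h)u\|_{\mathcal H}.$$ In addition, if $f\in\mathcal V^*$ (nonzero) satisfies $\|\iota^{-1}f\|_{\mathcal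 Z^{m+1}}\le C_{\rm osc}\|f\|_{\mathcal H^*}$ and $(\star)$ holds, then $$\frac{\|u-u_h\|_{\mathcal H}}{\|u\|_{\mathcal H}}\le C\Big(1+\|I-\Pi_h\|_{\mathcal Z^{m+1}\to\mathcal H}\big(1+\|(P^* )^{-1}\Pi_1^*\|_{\mathcal V^*\to\mathcal V}\big)\Big)\|I-\Pi_h\|_{\mathcal Z^{m+1}\to\mathcal H}.$$ Furthermore, if $\Pi_0^*f=\widetilde\Pi_0^*f$ for some $\widetilde\Pi_0:\mathcal V\to\mathcal V$ satisfying $\Pi_0\widetilde\Pi_0=\widetilde\Pi_0$ and $\|\iota^{-1}\widetilde\Pi_0^*\iota\|_{\mathcal Z^{m-1}\to\mathcal Z^{m+1}}\le C_{\Pi_0}$, then the assumption $\|\iota^{-1}f\|_{\mathcal Z^{m+1}}\le C_{\rm osc}\|f\|_{\mathcal H^*}$ can be relaxed to $\|\iota^{-1}f\|_{\mathcal Z^{m-1}}\le C_{\rm osc}\|f\|_{\mathcal H^*}$.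
   Context: Hilbert spaces are complex. $\mathcal V^*$ denotes the anti-dual of $\mathcal V$, and $\langle\cdot,\cdot\rangle_{\mathcal V^*\times\mathcal V}$ the duality pairing, linear in the first and anti-linear in the second argument; adjoints are with respect to such pairings and $\operatorname{Re}A:=\frac12(A+A^* )$. **Assumption 1.** $\mathcal H\subset\mathcal V$ are Hilbert spaces, $\mathcal H$ dense in $\mathcal V$, with norms $|||\cdot|||_{\mathcal H},|||\cdot|||_{\mathcal V}$. Given $C_1,C_2,C'_{\mathcal E}>0$, $P:\mathcal H\to\mathcal H^*$ and $\mathcal E:\mathcal V\to\mathcal V^*$ are linear with $\|P\|_{\mathcal H\to\mathcal H^*}+\|\mathcal E\|_{\mathcal V\to\mathcal V^*}\le C_2$ and $\operatorname{Re}\langle\mathcal Ev,v\rangle\ge C'_{\mathcal E}|||v|||^2_{\mathcal V}$ for all $v\in\mathcal V$. In addition $P=\mathcal D-\mathcal E$, where $\operatorname{Ker}\mathcal D^*=\operatorname{Ker}\mathcal D$ and $\operatorname{Re}\langle\mathcal Dv,v\rangle\ge C_1|||v|||^2_{\mathcal H}-C_2|||v|||^2_{\mathcal V}$ for all $v\in\mathcal H$. **Norms.** $\|v\|_{\mathcal V}:=\sqrt{C_2}\,|||v|||_{\mathcal V}$ and $\|v\|^2_{\mathcal H}:=\operatorname{Re}\langle\mathcal Dv,v\rangle_{\mathcal H^*\times\mathcal H}+C_2|||v|||^2_{\mathcal V}$ (a norm induced by an inner product). $\mathcal V,\mathcal H$ and their anti-duals are equipped with these. **Projections.** $\iota:\mathcal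 V\to\mathcal V^*$ is the Riesz map $\langle\iota u,v\rangle=(u,v)_{\mathcal V}$. $\operatorname{Ker}\mathcal D$ is closed in $\mathcal V$; $\Pi_0^{\mathcal V}$ is the $\mathcal V$-orthogonal projection onto it. $\mathcal E^{00}:=\Pi_0^{\mathcal V}(\iota^{-1}\mathcal E)\Pi_0^{\mathcal V}$ is invertible on $\operatorname{Ker}\mathcal D$. Define $\Pi_0:=(\mathcal E^{00})^{-1}\Pi_0^{\mathcal V}\iota^{-1}\mathcal E$ and $\Pi_1:=I-\Pi_0$ (bounded on $\mathcal V$ and on $\mathcal H$). For $P^*=\mathcal D^*-\mathcal E^*$, the analogous projections are obtained by replacing $\mathcal E$ by $\mathcal E^*$; the $\Pi_0,\Pi_1$ in the claim are those of $P$. **Assumption 2** (with constants $C_{\rm reg},C_1,C_2,C'_{\mathcal E}$). $P$ satisfies Assumption 1. $\mathcal Z^0=\mathcal V$, $\mathcal Z^1=\mathcal H$, and $\mathcal Z^j\subset\mathcal Z^{j-1}$, $j=1,\dots,m+1$, are normed spaces with $\mathcal V^*$ dense in $(\mathcal Z^j)^*$ for $j\ge1$ (elements of $\mathcal V^*$ being restricted to $\mathcal Z^j$), such that (with a norm read as $+\infty$ for elements not in the space): (i) for $j=1,\dots,m+1$, $\|\Pi_0^{\mathcal V}\|_{\mathcal Z^j\to\mathcal Z^j}\le C_{\rm reg}$; (ii) with $\mathsf D$ equal to $\mathcal D$, $\mathcal D^*$ or $\operatorname{Re}\mathcal D$, for $j=2,\dots,m+1$ and all $u\in\mathcal H$,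 $\|\Pi_1u\|_{\mathcal Z^j}\le C_{\rm reg}\big(\|\Pi_1u\|_{\mathcal V}+\sup_{v\in\mathcal H,\|\iota v\|_{(\mathcal Z^{j-2})^*}=1}|\langle\mathsf D\Pi_1u,\Pi_1v\rangle_{\mathcal H^*\times\mathcal H}|\big)$, with $\Pi_1u\in\mathcal Z^j$ if the right-hand side is finite; (iii) with $\mathsf E$ equal to $\iota^{-1}\mathcal E$, $\iota^{-1}\mathcal E^*$ or $\iota^{-1}\operatorname{Re}\mathcal E$, for $j=1,\dots,m+1$, $\|\mathsf E\|_{\mathcal Z^j\to\mathcal Z^j}\le C_{\rm reg}$; (iv) with $\mathsf E$ equal to $\iota^{-1}\mathcal E$ or $\iota^{-1}\mathcal E^*$, for $j=1,\dots,m+1$ and all $u\in\mathcal V$, $\|\Pi_0^{\mathcal V}u\|_{\mathcal Z^j}\le C_{\rm reg}(\|\Pi_0^{\mathcal V}\mathsf E\Pi_0^{\mathcal V}u\|_{\mathcal Z^j}+\|\Pi_0^{\mathcal V}u\|_{\mathcal V})$. **Galerkin.** $\mathcal H_h\subset\mathcal H$ is a closed (finite-dimensional) subspace and $\Pi_h:\mathcal H\to\mathcal H_h$ is the orthogonal projection. **$\gamma_{\rm dv}$.** $\gamma_{\rm dv}(P):=\sup\{\|\Pi_0w_h\|_{\mathcal V}/\|w_h\|_{\mathcal H}\}$, the supremum over nonzero $w_h\in\mathcal H_h$ with $\langle\mathcal Ew_h,v_h\rangle_{\mathcal V^*\times\mathcal V}=0$ for all $v_h\in\mathcal H_h\cap\operatorname{Ker}\mathcal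 D$. $\gamma_{\rm dv}(P^* )$ is the same quantity with $\mathcal E$ replaced by $\mathcal E^*$ (also in the definition of $\Pi_0$). *)

theory Defs
  imports "HOL-Analysis.Analysis"
begin

text \<open>
  The large Hilbert space \<open>V\<close> is a whole type \<open>'v\<close>; \<open>H\<close>, \<open>Z j\<close>, \<open>Hh\<close> are subsets of it, each carrying
  its own norm, and the complex scalar multiplication \<open>scl\<close> is explicit.

  An anti-linear functional is a function \<open>'v \<Rightarrow> complex\<close> of which only the values on the relevant
  subspace matter, so that restricting a functional from \<open>V\<close> to a subspace leaves the function
  unchanged, and equality in the anti-dual of \<open>X\<close> means equality on \<open>X\<close>.
  An operator from \<open>X\<close> to its anti-dual is a curried function \<open>A\<close> with \<open>\<langle>A u, v\<rangle> = A u v\<close>.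

  Operator norms and dual norms take values in \<open>ennreal\<close>. The norm of a subspace \<open>X\<close>, extended by
  \<open>\<infinity>\<close> off \<open>X\<close>, is \<open>enorm_on X n\<close>.
\<close>

section \<open>Hilbert spaces, anti-duals, operator norms\<close>

definition hnorm :: "('v \<Rightarrow> 'v \<Rightarrow> complex) \<Rightarrow> 'v \<Rightarrow> real" where
  "hnorm ip v = sqrt (Re (ip v v))"

text \<open>Cut off outside \<open>X\<close>: \<^locale>\<open>Metric_space\<close> wants a nonnegative symmetric distance on the whole type.\<close>

definition dist_on :: "'v set \<Rightarrow> ('v::ab_group_add \<Rightarrow> real) \<Rightarrow> 'v \<Rightarrow> 'v \<Rightarrow> real" where
  "dist_on X n u v = (if u \<in> X \<and> v \<in> X then n (u - v) else 0)"

definition complex_hilbert_on ::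
  "(complex \<Rightarrow> 'v::ab_group_add \<Rightarrow> 'v) \<Rightarrow> 'v set \<Rightarrow> ('v \<Rightarrow> 'v \<Rightarrow> complex) \<Rightarrow> bool" where
  "complex_hilbert_on scl X ip \<longleftrightarrow>
     vector_space scl \<and> module.subspace scl X \<and>
     (\<forall>u\<in>X. \<forall>v\<in>X. \<forall>w\<in>X. ip (u + v) w = ip u w + ip v w) \<and>
     (\<forall>a. \<forall>u\<in>X. \<forall>w\<in>X. ip (scl a u) w = a * ip u w) \<and>
     (\<forall>u\<in>X. \<forall>v\<in>X. ip v u = cnj (ip u v)) \<and>
     (\<forall>u\<in>X. u \<noteq> 0 \<longrightarrow> Re (ip u u) > 0) \<and>
     Metric_space.mcomplete X (dist_on X (hnorm ip))"

definition normed_on ::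
  "(complex \<Rightarrow> 'v::ab_group_add \<Rightarrow> 'v) \<Rightarrow> 'v set \<Rightarrow> ('v \<Rightarrow> real) \<Rightarrow> bool" where
  "normed_on scl X n \<longleftrightarrow>
     module.subspace scl X \<and>
     (\<forall>u\<in>X. 0 \<le> n u \<and> (n u = 0 \<longleftrightarrow> u = 0)) \<and>
     (\<forall>a. \<forall>u\<in>X. n (scl a u) = cmod a * n u) \<and>
     (\<forall>u\<in>X. \<forall>v\<in>X. n (u + v) \<le> n u + n v)"

definition continuously_included :: "'v set \<Rightarrow> ('v \<Rightarrow> real) \<Rightarrow> 'v set \<Rightarrow> ('v \<Rightarrow> real) \<Rightarrow> bool" where
  "continuously_included X nX Y nY \<longleftrightarrow> X \<subseteq> Y \<and> (\<exists>K. \<forall>u\<in>X. nY u \<le> K * nX u)"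

definition enorm_on :: "'v set \<Rightarrow> ('v \<Rightarrow> real) \<Rightarrow> 'v \<Rightarrow> ennreal" where
  "enorm_on X n v = (if v \<in> X then ennreal (n v) else \<infinity>)"

definition opnorm :: "'a set \<Rightarrow> ('a \<Rightarrow> ennreal) \<Rightarrow> ('b \<Rightarrow> ennreal) \<Rightarrow> ('a \<Rightarrow> 'b) \<Rightarrow> ennreal" where
  "opnorm X nX nY A = (SUP x \<in> {x \<in> X. nX x \<noteq> 0}. nY (A x) / nX x)"

definition antidual ::
  "(complex \<Rightarrow> 'v::ab_group_add \<Rightarrow> 'v) \<Rightarrow> 'v set \<Rightarrow> ('v \<Rightarrow> real) \<Rightarrow> ('v \<Rightarrow> complex) set" where
  "antidual scl X n = {f.
     (\<forall>u\<in>X. \<forall>v\<in>X. f (u + v) = f u + f v) \<and>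
     (\<forall>a. \<forall>u\<in>X. f (scl a u) = cnj a * f u) \<and>
     (\<exists>K. \<forall>u\<in>X. cmod (f u) \<le> K * n u)}"

definition dual_norm :: "'v set \<Rightarrow> ('v \<Rightarrow> real) \<Rightarrow> ('v \<Rightarrow> complex) \<Rightarrow> ennreal" where
  "dual_norm X n f = (SUP v \<in> {v \<in> X. n v \<noteq> 0}. ennreal (cmod (f v) / n v))"

definition linear_to_antidual ::
  "(complex \<Rightarrow> 'v::ab_group_add \<Rightarrow> 'v) \<Rightarrow> 'v set \<Rightarrow> ('v \<Rightarrow> real) \<Rightarrow> ('v \<Rightarrow> 'v \<Rightarrow> complex) \<Rightarrow> bool" where
  "linear_to_antidual scl X n A \<longleftrightarrow>
     (\<forall>u\<in>X. A u \<in> antidual scl X n) \<and>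
     (\<forall>u\<in>X. \<forall>v\<in>X. \<forall>w\<in>X. A (u + v) w = A u w + A v w) \<and>
     (\<forall>a. \<forall>u\<in>X. \<forall>w\<in>X. A (scl a u) w = a * A u w)"

definition op_adj :: "('v \<Rightarrow> 'v \<Rightarrow> complex) \<Rightarrow> 'v \<Rightarrow> 'v \<Rightarrow> complex" where
  "op_adj A = (\<lambda>u v. cnj (A v u))"

definition op_Re :: "('v \<Rightarrow> 'v \<Rightarrow> complex) \<Rightarrow> 'v \<Rightarrow> 'v \<Rightarrow> complex" where
  "op_Re A = (\<lambda>u v. (A u v + op_adj A u v) / 2)"

definition op_ker :: "'v set \<Rightarrow> ('v \<Rightarrow> 'v \<Rightarrow> complex) \<Rightarrow> 'v set" where
  "op_ker X A = {u \<in> X. \<forall>v\<in>X. A u v = 0}"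

definition op_inv :: "'v set \<Rightarrow> ('v \<Rightarrow> 'v \<Rightarrow> complex) \<Rightarrow> ('v \<Rightarrow> complex) \<Rightarrow> 'v" where
  "op_inv X A g = (THE w. w \<in> X \<and> (\<forall>v\<in>X. A w v = g v))"

definition orth_proj :: "('v::ab_group_add \<Rightarrow> 'v \<Rightarrow> complex) \<Rightarrow> 'v set \<Rightarrow> 'v \<Rightarrow> 'v" where
  "orth_proj ip K u = (THE w. w \<in> K \<and> (\<forall>z\<in>K. ip (u - w) z = 0))"

section \<open>The abstract setting\<close>

text \<open>
  \<open>ipV\<close> and \<open>ipH\<close> induce the given norms (triple bars); the rescaled norms (double bars) are
  \<open>normV\<close> and \<open>normH\<close>, the latter depending on \<open>D\<close>. \<open>CE\<close> is the coercivity constant of \<open>E\<close>.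
\<close>

definition hilbert_pair ::
  "(complex \<Rightarrow> 'v::ab_group_add \<Rightarrow> 'v) \<Rightarrow> ('v \<Rightarrow> 'v \<Rightarrow> complex) \<Rightarrow> 'v set \<Rightarrow>
   ('v \<Rightarrow> 'v \<Rightarrow> complex) \<Rightarrow> bool" where
  "hilbert_pair scl ipV H ipH \<longleftrightarrow>
     complex_hilbert_on scl UNIV ipV \<and> complex_hilbert_on scl H ipH \<and>
     continuously_included H (hnorm ipH) UNIV (hnorm ipV) \<and>
     Metric_space.mtopology UNIV (dist_on UNIV (hnorm ipV)) closure_of H = UNIV"

definition assumption1 ::
  "(complex \<Rightarrow> 'v::ab_group_add \<Rightarrow> 'v) \<Rightarrow> ('v \<Rightarrow> 'v \<Rightarrow> complex) \<Rightarrow> 'v set \<Rightarrow>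
   ('v \<Rightarrow> 'v \<Rightarrow> complex) \<Rightarrow> real \<Rightarrow> real \<Rightarrow> real \<Rightarrow>
   ('v \<Rightarrow> 'v \<Rightarrow> complex) \<Rightarrow> ('v \<Rightarrow> 'v \<Rightarrow> complex) \<Rightarrow> ('v \<Rightarrow> 'v \<Rightarrow> complex) \<Rightarrow> bool" where
  "assumption1 scl ipV H ipH C1 C2 CE P D E \<longleftrightarrow>
     hilbert_pair scl ipV H ipH \<and> C1 > 0 \<and> C2 > 0 \<and> CE > 0 \<and>
     linear_to_antidual scl H (hnorm ipH) P \<and>
     linear_to_antidual scl UNIV (hnorm ipV) E \<and>
     opnorm H (enorm_on H (hnorm ipH)) (dual_norm H (hnorm ipH)) P +
       opnorm UNIV (enorm_on UNIV (hnorm ipV)) (dual_norm UNIV (hnorm ipV)) E \<le> ennreal C2 \<and>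
     (\<forall>v. Re (E v v) \<ge> CE * (hnorm ipV v)\<^sup>2) \<and>
     linear_to_antidual scl H (hnorm ipH) D \<and>
     (\<forall>u\<in>H. \<forall>v\<in>H. P u v = D u v - E u v) \<and>
     op_ker H (op_adj D) = op_ker H D \<and>
     (\<forall>v\<in>H. Re (D v v) \<ge> C1 * (hnorm ipH v)\<^sup>2 - C2 * (hnorm ipV v)\<^sup>2)"

definition innerV :: "real \<Rightarrow> ('v \<Rightarrow> 'v \<Rightarrow> complex) \<Rightarrow> 'v \<Rightarrow> 'v \<Rightarrow> complex" where
  "innerV C2 ipV u v = of_real C2 * ipV u v"

definition normV :: "real \<Rightarrow> ('v \<Rightarrow> 'v \<Rightarrow> complex) \<Rightarrow> 'v \<Rightarrow> real" where
  "normV C2 ipV v = sqrt C2 * hnorm ipV v"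

definition normH ::
  "real \<Rightarrow> ('v \<Rightarrow> 'v \<Rightarrow> complex) \<Rightarrow> ('v \<Rightarrow> 'v \<Rightarrow> complex) \<Rightarrow> 'v \<Rightarrow> real" where
  "normH C2 ipV D v = sqrt (Re (D v v) + C2 * (hnorm ipV v)\<^sup>2)"

text \<open>The inner product on \<open>H\<close> inducing \<open>normH\<close>.\<close>

definition innerH ::
  "real \<Rightarrow> ('v \<Rightarrow> 'v \<Rightarrow> complex) \<Rightarrow> ('v \<Rightarrow> 'v \<Rightarrow> complex) \<Rightarrow> 'v \<Rightarrow> 'v \<Rightarrow> complex" where
  "innerH C2 ipV D u v = op_Re D u v + of_real C2 * ipV u v"

definition riesz :: "real \<Rightarrow> ('v \<Rightarrow> 'v \<Rightarrow> complex) \<Rightarrow> 'v \<Rightarrow> ('v \<Rightarrow> complex)" where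
  "riesz C2 ipV u = (\<lambda>v. innerV C2 ipV u v)"

abbreviation riesz_inv :: "real \<Rightarrow> ('v \<Rightarrow> 'v \<Rightarrow> complex) \<Rightarrow> ('v \<Rightarrow> complex) \<Rightarrow> 'v" where
  "riesz_inv C2 ipV \<equiv> inv (riesz C2 ipV)"

definition Pi0V ::
  "real \<Rightarrow> ('v::ab_group_add \<Rightarrow> 'v \<Rightarrow> complex) \<Rightarrow> 'v set \<Rightarrow> ('v \<Rightarrow> 'v \<Rightarrow> complex) \<Rightarrow> 'v \<Rightarrow> 'v" where
  "Pi0V C2 ipV H D = orth_proj (innerV C2 ipV) (op_ker H D)"

definition E00 ::
  "real \<Rightarrow> ('v::ab_group_add \<Rightarrow> 'v \<Rightarrow> complex) \<Rightarrow> 'v set \<Rightarrow> ('v \<Rightarrow> 'v \<Rightarrow> complex) \<Rightarrow>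
   ('v \<Rightarrow> 'v \<Rightarrow> complex) \<Rightarrow> 'v \<Rightarrow> 'v" where
  "E00 C2 ipV H D E v = Pi0V C2 ipV H D (riesz_inv C2 ipV (E (Pi0V C2 ipV H D v)))"

definition Pi0 ::
  "real \<Rightarrow> ('v::ab_group_add \<Rightarrow> 'v \<Rightarrow> complex) \<Rightarrow> 'v set \<Rightarrow> ('v \<Rightarrow> 'v \<Rightarrow> complex) \<Rightarrow>
   ('v \<Rightarrow> 'v \<Rightarrow> complex) \<Rightarrow> 'v \<Rightarrow> 'v" where
  "Pi0 C2 ipV H D E v =
     the_inv_into (op_ker H D) (E00 C2 ipV H D E) (Pi0V C2 ipV H D (riesz_inv C2 ipV (E v)))"

definition Pi1 ::
  "real \<Rightarrow> ('v::ab_group_add \<Rightarrow> 'v \<Rightarrow> complex) \<Rightarrow> 'v set \<Rightarrow> ('v \<Rightarrow> 'v \<Rightarrow> complex) \<Rightarrow>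
   ('v \<Rightarrow> 'v \<Rightarrow> complex) \<Rightarrow> 'v \<Rightarrow> 'v" where
  "Pi1 C2 ipV H D E v = v - Pi0 C2 ipV H D E v"

section \<open>The regularity scale\<close>

text \<open>
  \<open>Z 0 = V\<close> and \<open>Z 1 = H\<close> carry the rescaled norms; \<open>nZ j\<close> is the norm of \<open>Z j\<close> for \<open>j \<ge> 2\<close> only.
\<close>

definition normZ ::
  "real \<Rightarrow> ('v \<Rightarrow> 'v \<Rightarrow> complex) \<Rightarrow> ('v \<Rightarrow> 'v \<Rightarrow> complex) \<Rightarrow> (nat \<Rightarrow> 'v \<Rightarrow> real) \<Rightarrow> nat \<Rightarrow> 'v \<Rightarrow> real" where
  "normZ C2 ipV D nZ j =
     (if j = 0 then normV C2 ipV else if j = 1 then normH C2 ipV D else nZ j)"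

definition enormZ ::
  "real \<Rightarrow> ('v \<Rightarrow> 'v \<Rightarrow> complex) \<Rightarrow> ('v \<Rightarrow> 'v \<Rightarrow> complex) \<Rightarrow> (nat \<Rightarrow> 'v set) \<Rightarrow>
   (nat \<Rightarrow> 'v \<Rightarrow> real) \<Rightarrow> nat \<Rightarrow> 'v \<Rightarrow> ennreal" where
  "enormZ C2 ipV D Z nZ j = enorm_on (Z j) (normZ C2 ipV D nZ j)"

definition opnormZ ::
  "real \<Rightarrow> ('v \<Rightarrow> 'v \<Rightarrow> complex) \<Rightarrow> ('v \<Rightarrow> 'v \<Rightarrow> complex) \<Rightarrow> (nat \<Rightarrow> 'v set) \<Rightarrow>
   (nat \<Rightarrow> 'v \<Rightarrow> real) \<Rightarrow> nat \<Rightarrow> nat \<Rightarrow> ('v \<Rightarrow> 'v) \<Rightarrow> ennreal" where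
  "opnormZ C2 ipV D Z nZ i j A =
     opnorm (Z i) (enormZ C2 ipV D Z nZ i) (enormZ C2 ipV D Z nZ j) A"

definition assumption2 ::
  "(complex \<Rightarrow> 'v::ab_group_add \<Rightarrow> 'v) \<Rightarrow> ('v \<Rightarrow> 'v \<Rightarrow> complex) \<Rightarrow> 'v set \<Rightarrow>
   ('v \<Rightarrow> 'v \<Rightarrow> complex) \<Rightarrow> real \<Rightarrow> real \<Rightarrow> real \<Rightarrow> real \<Rightarrow> nat \<Rightarrow> (nat \<Rightarrow> 'v set) \<Rightarrow>
   (nat \<Rightarrow> 'v \<Rightarrow> real) \<Rightarrow>
   ('v \<Rightarrow> 'v \<Rightarrow> complex) \<Rightarrow> ('v \<Rightarrow> 'v \<Rightarrow> complex) \<Rightarrow> ('v \<Rightarrow> 'v \<Rightarrow> complex) \<Rightarrow> bool" where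
  "assumption2 scl ipV H ipH Creg C1 C2 CE m Z nZ P D E \<longleftrightarrow>
     assumption1 scl ipV H ipH C1 C2 CE P D E \<and>
     Z 0 = UNIV \<and> Z 1 = H \<and>
     (\<forall>j\<in>{1..m+1}.
        normed_on scl (Z j) (normZ C2 ipV D nZ j) \<and>
        continuously_included (Z j) (normZ C2 ipV D nZ j) (Z (j-1)) (normZ C2 ipV D nZ (j-1)) \<and>
        antidual scl UNIV (normV C2 ipV) \<subseteq> antidual scl (Z j) (normZ C2 ipV D nZ j) \<and>
        (\<forall>f\<in>antidual scl (Z j) (normZ C2 ipV D nZ j). \<forall>\<epsilon>>0.
           \<exists>g\<in>antidual scl UNIV (normV C2 ipV).
             dual_norm (Z j) (normZ C2 ipV D nZ j) (\<lambda>v. f v - g v) < ennreal \<epsilon>)) \<and>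
     (\<forall>j\<in>{1..m+1}. opnormZ C2 ipV D Z nZ j j (Pi0V C2 ipV H D) \<le> ennreal Creg) \<and>
     (\<forall>D'\<in>{D, op_adj D, op_Re D}. \<forall>j\<in>{2..m+1}. \<forall>u\<in>H.
        enormZ C2 ipV D Z nZ j (Pi1 C2 ipV H D E u) \<le>
          ennreal Creg * (ennreal (normV C2 ipV (Pi1 C2 ipV H D E u)) +
            (SUP v \<in> {v \<in> H. dual_norm (Z (j-2)) (normZ C2 ipV D nZ (j-2)) (riesz C2 ipV v) = 1}.
               ennreal (cmod (D' (Pi1 C2 ipV H D E u) (Pi1 C2 ipV H D E v)))))) \<and>
     (\<forall>E'\<in>{E, op_adj E, op_Re E}. \<forall>j\<in>{1..m+1}.
        opnormZ C2 ipV D Z nZ j j (\<lambda>u. riesz_inv C2 ipV (E' u)) \<le> ennreal Creg) \<and>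
     (\<forall>E'\<in>{E, op_adj E}. \<forall>j\<in>{1..m+1}. \<forall>u.
        enormZ C2 ipV D Z nZ j (Pi0V C2 ipV H D u) \<le>
          ennreal Creg *
            (enormZ C2 ipV D Z nZ j
               (Pi0V C2 ipV H D (riesz_inv C2 ipV (E' (Pi0V C2 ipV H D u)))) +
             ennreal (normV C2 ipV (Pi0V C2 ipV H D u))))"

section \<open>Galerkin discretisation\<close>

definition Pi_h ::
  "real \<Rightarrow> ('v::ab_group_add \<Rightarrow> 'v \<Rightarrow> complex) \<Rightarrow> ('v \<Rightarrow> 'v \<Rightarrow> complex) \<Rightarrow> 'v set \<Rightarrow> 'v \<Rightarrow> 'v" where
  "Pi_h C2 ipV D Hh = orth_proj (innerH C2 ipV D) Hh"

definition gamma_dv ::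
  "real \<Rightarrow> ('v::ab_group_add \<Rightarrow> 'v \<Rightarrow> complex) \<Rightarrow> 'v set \<Rightarrow> ('v \<Rightarrow> 'v \<Rightarrow> complex) \<Rightarrow>
   ('v \<Rightarrow> 'v \<Rightarrow> complex) \<Rightarrow> 'v set \<Rightarrow> ennreal" where
  "gamma_dv C2 ipV H D E Hh =
     (SUP w \<in> {w \<in> Hh. w \<noteq> 0 \<and> (\<forall>v \<in> Hh \<inter> op_ker H D. E w v = 0)}.
        ennreal (normV C2 ipV (Pi0 C2 ipV H D E w) / normH C2 ipV D w))"

text \<open>The norm of \<open>I - \<Pi>\<^sub>h\<close> from \<open>Z (m+1)\<close> to \<open>H = Z 1\<close>.\<close>

definition approx_norm ::
  "real \<Rightarrow> ('v::ab_group_add \<Rightarrow> 'v \<Rightarrow> complex) \<Rightarrow> ('v \<Rightarrow> 'v \<Rightarrow> complex) \<Rightarrow> nat \<Rightarrow>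
   (nat \<Rightarrow> 'v set) \<Rightarrow> (nat \<Rightarrow> 'v \<Rightarrow> real) \<Rightarrow> 'v set \<Rightarrow> ennreal" where
  "approx_norm C2 ipV D m Z nZ Hh =
     opnormZ C2 ipV D Z nZ (m+1) 1 (\<lambda>v. v - Pi_h C2 ipV D Hh v)"

text \<open>
  The norm of \<open>(P\<^sup>*)\<^sup>-\<^sup>1 \<Pi>\<^sub>1\<^sup>*\<close> from the anti-dual of \<open>V\<close> to \<open>V\<close>, where \<open>\<Pi>\<^sub>1\<^sup>* g = g \<circ> \<Pi>\<^sub>1\<close>.
\<close>

definition adj_solution_norm ::
  "(complex \<Rightarrow> 'v::ab_group_add \<Rightarrow> 'v) \<Rightarrow> real \<Rightarrow> ('v \<Rightarrow> 'v \<Rightarrow> complex) \<Rightarrow> 'v set \<Rightarrow>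
   ('v \<Rightarrow> 'v \<Rightarrow> complex) \<Rightarrow> ('v \<Rightarrow> 'v \<Rightarrow> complex) \<Rightarrow> ('v \<Rightarrow> 'v \<Rightarrow> complex) \<Rightarrow> ennreal" where
  "adj_solution_norm scl C2 ipV H P D E =
     opnorm (antidual scl UNIV (normV C2 ipV)) (dual_norm UNIV (normV C2 ipV))
       (enorm_on UNIV (normV C2 ipV))
       (\<lambda>g. op_inv H (op_adj P) (g \<circ> Pi1 C2 ipV H D E))"

definition galerkin ::
  "('v::ab_group_add \<Rightarrow> 'v \<Rightarrow> complex) \<Rightarrow> 'v set \<Rightarrow> 'v \<Rightarrow> 'v \<Rightarrow> bool" where
  "galerkin P Hh u uh \<longleftrightarrow> uh \<in> Hh \<and> (\<forall>v\<in>Hh. P (u - uh) v = 0)"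

end

theory Submission
  imports Defs
begin

text \<open>
  On the kernel \<open>N\<close> of \<open>D\<close> the operator \<open>P = D - E\<close> is \<open>- E\<close>, which is negative; off the kernel it is
  bounded below only up to a multiple of the \<open>V\<close>-norm. Both defects are repaired. Flipping the sign of the
  kernel part of the test vector turns \<open>- E\<close> into a coercive term, and a
  nonnegative perturbation \<open>S\<close> of high smoothing order compensates the \<open>V\<close>-norm. A power of the resolvent
  \<open>B = (Re D + 1)\<^sup>-\<^sup>1\<close>, restricted to the orthogonal complement of the kernel, provides such an \<open>S\<close>; that it
  dominates the \<open>V\<close>-norm up to a small multiple of the \<open>H\<close>-norm is the lemma \<open>interpolation\<close>, obtained from
  Cauchy-Schwarz for the moments of \<open>B\<close>. The result is that \<open>Ps = P + S\<close> is
  stable on \<open>H\<close> and on every discrete space on which divergence-free vectors have a small projection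
  \<open>\<Pi>\<^sub>0\<close>, with one constant for all of them (lemma \<open>Ps_inf_sup\<close>).

  Consequently the Galerkin error \<open>e\<close> is bounded by the best approximation error plus the size of \<open>S e\<close>. As \<open>S\<close> maps
  into \<open>Z (m+1)\<close> (lemma \<open>Phi_reg\<close>), the dual problem with the datum \<open>S e\<close> has a solution
  with \<open>m + 1\<close> orders of regularity (lemma \<open>bootstrap\<close>), whose norm is at most the size of \<open>S e\<close> times a multiple of
  \<open>1 + \<parallel>(P\<^sup>*)\<^sup>-\<^sup>1 \<Pi>\<^sub>1\<^sup>*\<parallel>\<close>. Comparing it with its elliptic projection, the Galerkin projection for
  \<open>Ps\<close>, leaves two terms: the desired bound and a term with the
  factor \<open>\<parallel>I - \<Pi>\<^sub>h\<parallel>\<^sup>2 (1 + \<parallel>(P\<^sup>*)\<^sup>-\<^sup>1 \<Pi>\<^sub>1\<^sup>*\<parallel>)\<close>, which is absorbed (theorem \<open>galerkin_error\<close>).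

  The same estimate for \<open>P\<close> and for its adjoint shows that the Galerkin equations are uniquely solvable (theorem
  \<open>galerkin_well_posed\<close>). For data that are as oscillating as the solution, elliptic
  regularity bounds \<open>\<parallel>u\<parallel>\<close> in \<open>Z (m+1)\<close> by \<open>\<parallel>u\<parallel>\<^sub>H\<close> (theorem \<open>solution_regularity\<close>), and the best
  approximation error becomes \<open>\<parallel>I - \<Pi>\<^sub>h\<parallel> \<parallel>u\<parallel>\<^sub>H\<close>.

  All constants depend only on the parameters of the locale \<open>constants\<close>. That these parameters can be chosen for all operators simultaneously
  rests on the equivalence of the operator-dependent norm of \<open>H\<close> with the given one; see
  \<open>uniform_inclusions\<close>.
\<close>

section \<open>Hilbert spaces carried by subsets of a type\<close>

definition sesquilinear_on ::
  "(complex \<Rightarrow> 'v::ab_group_add \<Rightarrow> 'v) \<Rightarrow> 'v set \<Rightarrow> ('v \<Rightarrow> 'v \<Rightarrow> complex) \<Rightarrow> bool" where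
  "sesquilinear_on scl X A \<longleftrightarrow>
     (\<forall>u\<in>X. \<forall>v\<in>X. \<forall>w\<in>X. A (u + v) w = A u w + A v w \<and> A w (u + v) = A w u + A w v) \<and>
     (\<forall>c. \<forall>u\<in>X. \<forall>w\<in>X. A (scl c u) w = c * A u w \<and> A w (scl c u) = cnj c * A w u)"

text \<open>
  For \<open>c > 0\<close> this is the inf-sup condition with constant \<open>1 / c\<close>: the dual norm of \<open>A x\<close> over
  \<open>X\<close> is at least \<open>n x / c\<close>. Quantifying over the bounds \<open>d\<close> instead of taking a supremum keeps it in the reals
  and also covers \<open>X = {0}\<close>.
\<close>

definition inf_sup :: "'v set \<Rightarrow> ('v \<Rightarrow> real) \<Rightarrow> ('v \<Rightarrow> 'v \<Rightarrow> complex) \<Rightarrow> real \<Rightarrow> bool" where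
  "inf_sup X n A c \<longleftrightarrow>
     (\<forall>x\<in>X. \<forall>d\<ge>0. (\<forall>v\<in>X. cmod (A x v) \<le> d * n v) \<longrightarrow> n x \<le> c * d)"

lemma inf_supD:
  assumes "inf_sup X n A c" "x \<in> X" "0 \<le> d" "\<And>v. v \<in> X \<Longrightarrow> cmod (A x v) \<le> d * n v"
  shows "n x \<le> c * d"
  using assms unfolding inf_sup_def by blast

lemma sesquilinear_on_subset: "sesquilinear_on scl Y A \<Longrightarrow> X \<subseteq> Y \<Longrightarrow> sesquilinear_on scl X A"
  unfolding sesquilinear_on_def by (meson subsetD)

text \<open>
  Fixing the scalar field to the complex numbers gives access to conjugation in the rules for
  sesquilinear forms.
\<close>

locale complex_space = vector_space scl
  for scl :: "complex \<Rightarrow> 'v::ab_group_add \<Rightarrow> 'v"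
begin

lemma scl_minus_one: "scl (- 1) x = - x"
  using scale_minus_left[of 1 x] by simp

lemma sesq_add:
  assumes "sesquilinear_on scl X A" "u \<in> X" "v \<in> X" "w \<in> X"
  shows "A (u + v) w = A u w + A v w" "A w (u + v) = A w u + A w v"
  using assms unfolding sesquilinear_on_def by blast+

lemma sesq_scl:
  assumes "sesquilinear_on scl X A" "u \<in> X" "w \<in> X"
  shows "A (scl c u) w = c * A u w" "A w (scl c u) = cnj c * A w u"
  using assms unfolding sesquilinear_on_def by blast+

lemma sesq_uminus:
  assumes "sesquilinear_on scl X A" "u \<in> X" "w \<in> X"
  shows "A (- u) w = - A u w" "A w (- u) = - A w u"
  using sesq_scl[OF assms, of "-1"] by (simp_all add: scl_minus_one)

lemma sesq_diff:
  assumes "sesquilinear_on scl X A" "subspace X" "u \<in> X" "v \<in> X" "w \<in> X"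
  shows "A (u - v) w = A u w - A v w" "A w (u - v) = A w u - A w v"
  using sesq_add[OF assms(1,3) subspace_neg[OF assms(2,4)] assms(5)]
    sesq_uminus[OF assms(1,4,5)] by simp_all

lemma sesq_zero:
  assumes "sesquilinear_on scl X A" "subspace X" "w \<in> X"
  shows "A 0 w = 0" "A w 0 = 0"
  using sesq_scl[OF assms(1) subspace_0[OF assms(2)] assms(3), of 0] by simp_all

lemma sesquilinear_onI:
  assumes "\<And>u v w. u \<in> X \<Longrightarrow> v \<in> X \<Longrightarrow> w \<in> X \<Longrightarrow> A (u + v) w = A u w + A v w"
    and "\<And>u v w. u \<in> X \<Longrightarrow> v \<in> X \<Longrightarrow> w \<in> X \<Longrightarrow> A w (u + v) = A w u + A w v"
    and "\<And>c u w. u \<in> X \<Longrightarrow> w \<in> X \<Longrightarrow> A (scl c u) w = c * A u w"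
    and "\<And>c u w. u \<in> X \<Longrightarrow> w \<in> X \<Longrightarrow> A w (scl c u) = cnj c * A w u"
  shows "sesquilinear_on scl X A"
  using assms unfolding sesquilinear_on_def by blast

lemma sesquilinear_op_adj:
  assumes "sesquilinear_on scl X A"
  shows "sesquilinear_on scl X (op_adj A)"
  using assms unfolding sesquilinear_on_def op_adj_def by simp

end

locale inner_space = complex_space scl
  for scl :: "complex \<Rightarrow> 'v::ab_group_add \<Rightarrow> 'v" +
  fixes X :: "'v set" and ip :: "'v \<Rightarrow> 'v \<Rightarrow> complex"
  assumes subspaceX: "subspace X"
    and sesq: "sesquilinear_on scl X ip"
    and herm: "u \<in> X \<Longrightarrow> v \<in> X \<Longrightarrow> ip v u = cnj (ip u v)"
    and pos: "u \<in> X \<Longrightarrow> u \<noteq> 0 \<Longrightarrow> 0 < Re (ip u u)"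
begin

lemmas X_add = subspace_add[OF subspaceX]
  and X_diff = subspace_diff[OF subspaceX]
  and X_scl = subspace_scale[OF subspaceX]
  and X_neg = subspace_neg[OF subspaceX]
  and X_0 = subspace_0[OF subspaceX]
  and ip_add = sesq_add[OF sesq]
  and ip_diff = sesq_diff[OF sesq subspaceX]
  and ip_scl = sesq_scl[OF sesq]
  and ip_zero = sesq_zero[OF sesq subspaceX]

abbreviation nrm :: "'v \<Rightarrow> real" where "nrm \<equiv> hnorm ip"

lemma ip_self_ge_0: "u \<in> X \<Longrightarrow> 0 \<le> Re (ip u u)"
  using pos[of u] ip_zero(1)[OF X_0] by (cases "u = 0") auto

lemma nrm_sq: "u \<in> X \<Longrightarrow> (nrm u)\<^sup>2 = Re (ip u u)"
  by (simp add: hnorm_def ip_self_ge_0)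

lemma ip_self: "u \<in> X \<Longrightarrow> ip u u = of_real ((nrm u)\<^sup>2)"
  using arg_cong[OF herm[of u u], of Im] by (simp add: nrm_sq complex_eq_iff)

lemma nrm_ge_0: "u \<in> X \<Longrightarrow> 0 \<le> nrm u"
  by (simp add: hnorm_def ip_self_ge_0)

lemma nrm_eq_0: "u \<in> X \<Longrightarrow> nrm u = 0 \<longleftrightarrow> u = 0"
  using pos[of u] ip_zero(1)[OF X_0] by (cases "u = 0") (auto simp: hnorm_def)

lemma nrm_zero: "nrm 0 = 0"
  using nrm_eq_0[OF X_0] by simp

lemma nrm_scl: "u \<in> X \<Longrightarrow> nrm (scl c u) = cmod c * nrm u"
proof -
  assume u: "u \<in> X"
  have "ip (scl c u) (scl c u) = (c * cnj c) * ip u u"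
    using u by (simp add: ip_scl X_scl)
  also have "c * cnj c = of_real ((cmod c)\<^sup>2)" by (rule complex_norm_square[symmetric])
  finally have "(nrm (scl c u))\<^sup>2 = (cmod c * nrm u)\<^sup>2"
    using u by (simp add: nrm_sq X_scl power_mult_distrib)
  then show ?thesis using u by (simp add: nrm_ge_0 X_scl power2_eq_iff_nonneg)
qed

lemma nrm_uminus: "u \<in> X \<Longrightarrow> nrm (- u) = nrm u"
  using nrm_scl[of u "-1"] by (simp add: scl_minus_one)

lemma nrm_minus_commute: "u \<in> X \<Longrightarrow> v \<in> X \<Longrightarrow> nrm (u - v) = nrm (v - u)"
  using nrm_uminus[OF X_diff[of u v]] by simp

lemma nrm_add_sq:
  assumes "u \<in> X" "v \<in> X"
  shows "(nrm (u + v))\<^sup>2 = (nrm u)\<^sup>2 + 2 * Re (ip u v) + (nrm v)\<^sup>2"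
  using assms by (simp add: nrm_sq X_add ip_add herm[of u v])

lemma nrm_diff_sq:
  assumes "u \<in> X" "v \<in> X"
  shows "(nrm (u - v))\<^sup>2 = (nrm u)\<^sup>2 - 2 * Re (ip u v) + (nrm v)\<^sup>2"
  using assms by (simp add: nrm_sq X_diff ip_diff herm[of u v])

lemma cauchy_schwarz:
  assumes "u \<in> X" "v \<in> X"
  shows "cmod (ip u v) \<le> nrm u * nrm v"
proof (cases "v = 0")
  case True
  then show ?thesis using assms by (simp add: ip_zero nrm_zero)
next
  case False
  define q where "q = (nrm v)\<^sup>2"
  have q: "q > 0" using False assms by (simp add: q_def nrm_eq_0)
  define c where "c = ip u v / of_real q"
  have cq: "c * of_real q = ip u v" using q by (simp add: c_def)
  have "0 \<le> (nrm (u - scl c v))\<^sup>2" by simp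
  also have "\<dots> = (nrm u)\<^sup>2 - 2 * Re (cnj c * ip u v) + (cmod c)\<^sup>2 * q"
    using assms by (simp add: nrm_diff_sq X_scl nrm_scl ip_scl power_mult_distrib q_def)
  also have "cnj c * ip u v = of_real ((cmod c)\<^sup>2 * q)"
    unfolding cq[symmetric] of_real_mult complex_norm_square by (simp only: ac_simps)
  also have "(cmod c)\<^sup>2 * q = (cmod (ip u v))\<^sup>2 / q"
    using q by (simp add: c_def norm_divide power2_eq_square)
  finally have "(cmod (ip u v))\<^sup>2 / q \<le> (nrm u)\<^sup>2" by simp
  then have "(cmod (ip u v))\<^sup>2 \<le> (nrm u * nrm v)\<^sup>2"
    using q by (simp add: divide_le_eq power_mult_distrib q_def)
  then show ?thesis
    by (rule power2_le_imp_le) (use assms in \<open>simp add: nrm_ge_0\<close>)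
qed

lemma nrm_triangle:
  assumes "u \<in> X" "v \<in> X"
  shows "nrm (u + v) \<le> nrm u + nrm v"
proof -
  have "Re (ip u v) \<le> nrm u * nrm v"
    using cauchy_schwarz[OF assms] complex_Re_le_cmod order_trans by blast
  then have "(nrm (u + v))\<^sup>2 \<le> (nrm u + nrm v)\<^sup>2"
    using assms by (simp add: nrm_add_sq power2_sum)
  then show ?thesis by (rule power2_le_imp_le) (use assms in \<open>simp add: nrm_ge_0\<close>)
qed

lemma nrm_triangle_diff:
  assumes "u \<in> X" "v \<in> X"
  shows "nrm (u - v) \<le> nrm u + nrm v"
  using nrm_triangle[OF assms(1) X_neg[OF assms(2)]] assms by (simp add: nrm_uminus)

lemma nrm_triangle_sub:
  assumes "u \<in> X" "v \<in> X"
  shows "nrm u \<le> nrm (u - v) + nrm v"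
  using nrm_triangle[OF X_diff[OF assms] assms(2)] by simp

text \<open>
  Testing the real parts with \<open>scl \<i> v\<close> as well recovers the imaginary parts.
\<close>

lemma ip_Re_eqI:
  assumes f: "\<And>c v. v \<in> X \<Longrightarrow> f (scl c v) = cnj c * f v" and "u \<in> X"
    and re: "\<And>v. v \<in> X \<Longrightarrow> Re (ip u v) = Re (f v)" and "v \<in> X"
  shows "ip u v = f v"
proof (rule complex_eqI)
  show "Re (ip u v) = Re (f v)" using assms by blast
  show "Im (ip u v) = Im (f v)"
    using re[OF X_scl[OF \<open>v \<in> X\<close>, of \<i>]] assms by (simp add: ip_scl f)
qed

lemma eq_if_ip_eq:
  assumes "u \<in> X" "w \<in> X" "\<And>v. v \<in> X \<Longrightarrow> ip u v = ip w v"
  shows "u = w"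
proof -
  have "ip (u - w) (u - w) = 0"
    using assms X_diff by (simp add: ip_diff)
  then have "nrm (u - w) = 0" by (simp add: hnorm_def)
  then show ?thesis using nrm_eq_0[OF X_diff[OF assms(1,2)]] by simp
qed

lemma nrm_tendsto:
  assumes "\<And>n. s n \<in> X" "l \<in> X" "(\<lambda>n. nrm (s n - l)) \<longlonglongrightarrow> 0"
  shows "(\<lambda>n. nrm (s n)) \<longlonglongrightarrow> nrm l"
proof -
  have "(\<lambda>n. nrm (s n) - nrm l) \<longlonglongrightarrow> 0"
  proof (rule Lim_null_comparison[OF _ assms(3)], rule always_eventually, rule allI)
    fix n
    show "norm (nrm (s n) - nrm l) \<le> nrm (s n - l)"
      using nrm_triangle_sub[of "s n" l] nrm_triangle_sub[of l "s n"] nrm_minus_commute[of l "s n"] assms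
      by (simp add: abs_le_iff)
  qed
  then show ?thesis by (simp add: LIM_zero_iff)
qed

lemma form_tendsto:
  assumes "\<And>n. s n \<in> X" "l \<in> X" "(\<lambda>n. nrm (s n - l)) \<longlonglongrightarrow> 0"
    and diff: "\<And>n. f (s n - l) = f (s n) - f l"
    and bound: "\<And>v. v \<in> X \<Longrightarrow> cmod (f v) \<le> K * nrm v"
  shows "(\<lambda>n. f (s n)) \<longlonglongrightarrow> f l"
proof -
  have "(\<lambda>n. f (s n) - f l) \<longlonglongrightarrow> 0"
  proof (rule Lim_null_comparison)
    show "\<forall>\<^sub>F n in sequentially. norm (f (s n) - f l) \<le> K * nrm (s n - l)"
      using bound[OF X_diff[OF assms(1,2)]] by (simp add: diff)
    show "(\<lambda>n. K * nrm (s n - l)) \<longlonglongrightarrow> 0"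
      using tendsto_mult_right_zero[OF assms(3)] by (simp add: mult.commute)
  qed
  then show ?thesis by (simp add: LIM_zero_iff)
qed

lemma antidualD:
  assumes "f \<in> antidual scl X nrm"
  obtains K where "K \<ge> 0" "\<And>u. u \<in> X \<Longrightarrow> cmod (f u) \<le> K * nrm u"
    "\<And>u v. u \<in> X \<Longrightarrow> v \<in> X \<Longrightarrow> f (u + v) = f u + f v"
    "\<And>u v. u \<in> X \<Longrightarrow> v \<in> X \<Longrightarrow> f (u - v) = f u - f v"
    "\<And>c v. v \<in> X \<Longrightarrow> f (scl c v) = cnj c * f v"
proof -
  from assms obtain K where K: "\<And>u. u \<in> X \<Longrightarrow> cmod (f u) \<le> K * nrm u"
    and add: "\<And>u v. u \<in> X \<Longrightarrow> v \<in> X \<Longrightarrow> f (u + v) = f u + f v"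
    and sc: "\<And>c v. v \<in> X \<Longrightarrow> f (scl c v) = cnj c * f v"
    unfolding antidual_def by blast
  have "cmod (f u) \<le> \<bar>K\<bar> * nrm u" if "u \<in> X" for u
    using K[OF that] nrm_ge_0[OF that] by (meson abs_ge_self mult_right_mono order_trans)
  moreover have "f (u - v) = f u - f v" if "u \<in> X" "v \<in> X" for u v
    using add[OF that(1) X_neg[OF that(2)]] sc[OF that(2), of "-1"] by (simp add: scl_minus_one)
  ultimately show ?thesis using that[of "\<bar>K\<bar>"] add sc by auto
qed

lemma antidualI:
  assumes "\<And>u v. u \<in> X \<Longrightarrow> v \<in> X \<Longrightarrow> f (u + v) = f u + f v"
    and "\<And>c v. v \<in> X \<Longrightarrow> f (scl c v) = cnj c * f v"
    and "\<And>u. u \<in> X \<Longrightarrow> cmod (f u) \<le> K * nrm u"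
  shows "f \<in> antidual scl X nrm"
  using assms unfolding antidual_def by blast

end

locale hilbert_space = inner_space scl X ip
  for scl :: "complex \<Rightarrow> 'v::ab_group_add \<Rightarrow> 'v" and X ip +
  assumes complete:
    "(\<And>n. s n \<in> X) \<Longrightarrow> (\<And>\<epsilon>. \<epsilon> > 0 \<Longrightarrow> \<exists>N. \<forall>m\<ge>N. \<forall>n\<ge>N. hnorm ip (s m - s n) < \<epsilon>) \<Longrightarrow>
     \<exists>l\<in>X. (\<lambda>n. hnorm ip (s n - l)) \<longlonglongrightarrow> 0"
begin

text \<open>
  The representer is the minimiser of \<open>\<parallel>v\<parallel>\<^sup>2 - 2 Re (f v)\<close>: minimising sequences are Cauchy by the
  parallelogram law. Orthogonal projections are obtained from this theorem afterwards, by applying it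
  on the subspace.
\<close>

theorem riesz_representation:
  assumes f: "f \<in> antidual scl X nrm"
  shows "\<exists>u\<in>X. \<forall>v\<in>X. ip u v = f v"
proof -
  from antidualD[OF f] obtain K where K0: "K \<ge> 0" and K: "\<And>u. u \<in> X \<Longrightarrow> cmod (f u) \<le> K * nrm u"
    and fadd: "\<And>u v. u \<in> X \<Longrightarrow> v \<in> X \<Longrightarrow> f (u + v) = f u + f v"
    and fdiff: "\<And>u v. u \<in> X \<Longrightarrow> v \<in> X \<Longrightarrow> f (u - v) = f u - f v"
    and fscl: "\<And>c v. v \<in> X \<Longrightarrow> f (scl c v) = cnj c * f v"
    by metis
  define J where "J v = (nrm v)\<^sup>2 - 2 * Re (f v)" for v
  define I where "I = Inf (J ` X)"
  have bdd: "bdd_below (J ` X)"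
  proof (rule bdd_belowI2[where m = "- K\<^sup>2"])
    fix v assume v: "v \<in> X"
    have "Re (f v) \<le> K * nrm v" using K[OF v] complex_Re_le_cmod order_trans by blast
    moreover have "0 \<le> (nrm v - K)\<^sup>2" by simp
    ultimately show "- K\<^sup>2 \<le> J v" unfolding J_def by (simp add: power2_diff algebra_simps)
  qed
  have I_le: "I \<le> J v" if "v \<in> X" for v
    unfolding I_def using bdd that by (simp add: cINF_lower)
  have "\<exists>v\<in>X. J v < I + 1 / (real n + 1)" for n
  proof -
    have "I < I + 1 / (real n + 1)" by simp
    then show ?thesis
      unfolding I_def using cInf_less_iff[of "J ` X"] bdd X_0 by blast
  qed
  then obtain s where s: "\<And>n. s n \<in> X" and Js: "\<And>n. J (s n) < I + 1 / (real n + 1)" by metis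
  have close: "(nrm (s m - s n))\<^sup>2 \<le> 2 / (real m + 1) + 2 / (real n + 1)" for m n
  proof -
    define h where "h = scl (1/2) (s m + s n)"
    have h: "h \<in> X" unfolding h_def using s X_add X_scl by blast
    have "nrm (s m + s n) = 2 * nrm h"
      unfolding h_def using nrm_scl[OF X_add[OF s s]] by (simp add: norm_divide)
    then have "(nrm (s m + s n))\<^sup>2 = 4 * (nrm h)\<^sup>2" by (simp add: power_mult_distrib)
    moreover have "2 * Re (f h) = Re (f (s m)) + Re (f (s n))"
      unfolding h_def using s by (simp add: fscl X_add fadd)
    moreover have "I \<le> J h" using I_le h by blast
    moreover have "J (s m) < I + 1 / (real m + 1)" "J (s n) < I + 1 / (real n + 1)" using Js by auto
    moreover have "(nrm (s m - s n))\<^sup>2 + (nrm (s m + s n))\<^sup>2 = 2 * (nrm (s m))\<^sup>2 + 2 * (nrm (s n))\<^sup>2"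
      using s by (simp add: nrm_add_sq nrm_diff_sq)
    ultimately show ?thesis unfolding J_def by (simp add: algebra_simps)
  qed
  have "\<exists>N. \<forall>m\<ge>N. \<forall>n\<ge>N. nrm (s m - s n) < \<epsilon>" if "\<epsilon> > 0" for \<epsilon>
  proof -
    obtain N where N: "4 / \<epsilon>\<^sup>2 < real N" using reals_Archimedean2 by blast
    have Npos: "0 < real N + 1" by linarith
    have "nrm (s m - s n) < \<epsilon>" if "m \<ge> N" "n \<ge> N" for m n
    proof -
      have "2 / (real m + 1) \<le> 2 / (real N + 1)" "2 / (real n + 1) \<le> 2 / (real N + 1)"
        using that by (auto intro!: divide_left_mono)
      then have "(nrm (s m - s n))\<^sup>2 \<le> 4 / (real N + 1)" using close[of m n] by simp
      also have "\<dots> < \<epsilon>\<^sup>2"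
      proof -
        have "4 < real N * \<epsilon>\<^sup>2" using N \<open>\<epsilon> > 0\<close> by (simp add: divide_less_eq)
        also have "\<dots> \<le> (real N + 1) * \<epsilon>\<^sup>2" by (simp add: algebra_simps)
        finally show ?thesis using Npos by (simp add: divide_less_eq mult.commute)
      qed
      finally show ?thesis by (rule power2_less_imp_less) (use \<open>\<epsilon> > 0\<close> in simp)
    qed
    then show ?thesis by blast
  qed
  then obtain u where u: "u \<in> X" and lim: "(\<lambda>n. nrm (s n - u)) \<longlonglongrightarrow> 0"
    using complete[of s] s by blast
  have "(\<lambda>n. J (s n)) \<longlonglongrightarrow> J u"
    unfolding J_def
    by (intro tendsto_diff tendsto_power tendsto_mult_left tendsto_Re nrm_tendsto form_tendsto[where K = K])
      (use s u lim K fdiff in auto)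
  moreover have "(\<lambda>n. I + 1 / (real n + 1)) \<longlonglongrightarrow> I + 0"
    by (intro tendsto_add tendsto_const) (use LIMSEQ_inverse_real_of_nat in \<open>simp add: inverse_eq_divide add.commute\<close>)
  ultimately have "J u \<le> I + 0"
    by (rule LIMSEQ_le) (use Js in \<open>auto intro: less_imp_le\<close>)
  then have Ju: "J u \<le> J v" if "v \<in> X" for v using I_le[OF that] by simp
  have re: "Re (ip u v) = Re (f v)" if v: "v \<in> X" for v
  proof (rule ccontr)
    \<comment> \<open>The derivative of \<open>J\<close> at the minimiser \<open>u\<close> in direction \<open>v\<close> vanishes: otherwise a small
      step \<open>t\<close> of the right sign decreases \<open>J\<close>.\<close>
    define r where "r = Re (ip u v) - Re (f v)"
    assume "Re (ip u v) \<noteq> Re (f v)"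
    then have r: "r \<noteq> 0" by (simp add: r_def)
    define q where "q = (nrm v)\<^sup>2 + 1"
    have q: "q > 0" by (simp add: q_def add_nonneg_pos)
    define t where "t = - r / q"
    have tv: "scl (of_real t) v \<in> X" using v X_scl by blast
    have "J (u + scl (of_real t) v) = J u + t\<^sup>2 * (nrm v)\<^sup>2 + 2 * t * r"
      unfolding J_def r_def using u v tv
      by (simp add: nrm_add_sq nrm_scl ip_scl fadd fscl power_mult_distrib algebra_simps)
    moreover have "J u \<le> J (u + scl (of_real t) v)" using Ju X_add[OF u tv] by blast
    ultimately have "0 \<le> t\<^sup>2 * (nrm v)\<^sup>2 + 2 * t * r" by simp
    also have "\<dots> \<le> t\<^sup>2 * q + 2 * t * r" by (simp add: q_def algebra_simps)
    also have "\<dots> = - (r\<^sup>2 / q)" using q by (simp add: t_def power2_eq_square field_simps)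
    also have "\<dots> < 0" using r q by simp
    finally show False by simp
  qed
  have "ip u v = f v" if "v \<in> X" for v
    by (rule ip_Re_eqI[of f]) (use fscl u re that in auto)
  then show ?thesis using u by blast
qed

lemma closed_subspace_hilbert:
  assumes "subspace Y" "Y \<subseteq> X"
    and closed: "\<And>s l. (\<And>n. s n \<in> Y) \<Longrightarrow> l \<in> X \<Longrightarrow> (\<lambda>n. nrm (s n - l)) \<longlonglongrightarrow> 0 \<Longrightarrow> l \<in> Y"
  shows "hilbert_space scl Y ip"
proof (unfold_locales)
  show "subspace Y" by fact
  show "sesquilinear_on scl Y ip" using sesq assms(2) sesquilinear_on_subset by blast
  show "ip v u = cnj (ip u v)" if "u \<in> Y" "v \<in> Y" for u v using herm that assms(2) by blast
  show "0 < Re (ip u u)" if "u \<in> Y" "u \<noteq> 0" for u using pos that assms(2) by blast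
  show "\<exists>l\<in>Y. (\<lambda>n. nrm (s n - l)) \<longlonglongrightarrow> 0"
    if "\<And>n. s n \<in> Y" "\<And>\<epsilon>. \<epsilon> > 0 \<Longrightarrow> \<exists>N. \<forall>m\<ge>N. \<forall>n\<ge>N. nrm (s m - s n) < \<epsilon>" for s
    using complete[of s] closed[of s] that assms(2) by blast
qed

end

text \<open>
  The projection of \<open>u\<close> is the Riesz representer of \<open>ip u\<close> on \<open>Y\<close>, and it exists because \<open>Y\<close> is complete.
\<close>

lemma (in inner_space) orth_proj_ex1:
  assumes "hilbert_space scl Y ip" "Y \<subseteq> X" "u \<in> X"
  shows "\<exists>!w. w \<in> Y \<and> (\<forall>z\<in>Y. ip (u - w) z = 0)"
proof -
  interpret Y: hilbert_space scl Y ip by fact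
  have "ip u \<in> antidual scl Y nrm"
    by (rule Y.antidualI[where K = "nrm u"])
      (use assms cauchy_schwarz in \<open>auto simp: ip_add ip_scl subset_iff\<close>)
  then obtain w where w: "w \<in> Y" "\<And>v. v \<in> Y \<Longrightarrow> ip w v = ip u v"
    using Y.riesz_representation by blast
  have *: "ip (u - w') z = ip u z - ip w' z" if "w' \<in> Y" "z \<in> Y" for w' z
    using that assms by (simp add: ip_diff subset_iff)
  show ?thesis
  proof (rule ex1I[of _ w])
    show "w \<in> Y \<and> (\<forall>z\<in>Y. ip (u - w) z = 0)" using w by (simp add: *)
    show "w' = w" if "w' \<in> Y \<and> (\<forall>z\<in>Y. ip (u - w') z = 0)" for w'
      by (rule Y.eq_if_ip_eq) (use that w * in auto)
  qed
qed

lemma (in inner_space) orth_proj: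
  assumes "hilbert_space scl Y ip" "Y \<subseteq> X" "u \<in> X"
  shows "orth_proj ip Y u \<in> Y" "\<And>z. z \<in> Y \<Longrightarrow> ip (u - orth_proj ip Y u) z = 0"
  using theI'[OF orth_proj_ex1[OF assms]] unfolding orth_proj_def by blast+

lemma (in inner_space) orth_proj_eqI:
  assumes "hilbert_space scl Y ip" "Y \<subseteq> X" "u \<in> X" "w \<in> Y" "\<And>z. z \<in> Y \<Longrightarrow> ip (u - w) z = 0"
  shows "orth_proj ip Y u = w"
  using the1_equality[OF orth_proj_ex1[OF assms(1-3)]] assms(4,5) unfolding orth_proj_def by blast

context hilbert_space
begin

text \<open>
  The Banach-Necas-Babuska theorem. The inf-sup condition makes the set \<open>R\<close> of Riesz representers of the
  functionals \<open>A x\<close> closed, and a vector orthogonal to \<open>R\<close> is annihilated by all of them, so it vanishes.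
\<close>

theorem inf_sup_solvable:
  assumes A: "sesquilinear_on scl X A"
    and bound: "\<And>u v. u \<in> X \<Longrightarrow> v \<in> X \<Longrightarrow> cmod (A u v) \<le> K * nrm u * nrm v"
    and infsup: "inf_sup X nrm A c"
    and inj: "\<And>v. v \<in> X \<Longrightarrow> (\<And>u. u \<in> X \<Longrightarrow> A u v = 0) \<Longrightarrow> v = 0"
    and f: "f \<in> antidual scl X nrm"
  shows "\<exists>u\<in>X. \<forall>v\<in>X. A u v = f v"
proof -
  define R where "R = {r \<in> X. \<exists>x\<in>X. \<forall>v\<in>X. A x v = ip r v}"
  note A_add = sesq_add[OF A] and A_scl = sesq_scl[OF A] and A_diff = sesq_diff[OF A subspaceX]
  have R_sub: "subspace R"
  proof (rule subspaceI)
    show "0 \<in> R" unfolding R_def by (simp add: X_0 sesq_zero[OF A subspaceX] ip_zero) (rule bexI[OF _ X_0], simp add: sesq_zero[OF A subspaceX])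
    show "x + y \<in> R" if "x \<in> R" "y \<in> R" for x y
    proof -
      from that obtain x' y' where "x \<in> X" "y \<in> X" "x' \<in> X" "y' \<in> X"
        "\<forall>v\<in>X. A x' v = ip x v" "\<forall>v\<in>X. A y' v = ip y v" unfolding R_def by blast
      then have "x + y \<in> X" "x' + y' \<in> X" "\<forall>v\<in>X. A (x' + y') v = ip (x + y) v"
        by (auto simp: X_add A_add ip_add)
      then show ?thesis unfolding R_def by blast
    qed
    show "scl c x \<in> R" if "x \<in> R" for c x
    proof -
      from that obtain x' where "x \<in> X" "x' \<in> X" "\<forall>v\<in>X. A x' v = ip x v" unfolding R_def by blast
      then have "scl c x \<in> X" "scl c x' \<in> X" "\<forall>v\<in>X. A (scl c x') v = ip (scl c x) v"
        by (auto simp: X_scl A_scl ip_scl)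
      then show ?thesis unfolding R_def by blast
    qed
  qed
  have repr: "\<exists>r\<in>R. \<forall>v\<in>X. A x v = ip r v" if x: "x \<in> X" for x
  proof -
    have "A x \<in> antidual scl X nrm"
      by (rule antidualI[where K = "K * nrm x"]) (use x bound in \<open>auto simp: A_add A_scl\<close>)
    from riesz_representation[OF this] obtain r where "r \<in> X" "\<forall>v\<in>X. ip r v = A x v" by blast
    then show ?thesis using x unfolding R_def by (intro bexI[of _ r]) auto
  qed
  interpret R: hilbert_space scl R ip
  proof (rule closed_subspace_hilbert[OF R_sub])
    show "R \<subseteq> X" unfolding R_def by blast
    fix s l assume s: "\<And>n. s n \<in> R" and l: "l \<in> X" and lim: "(\<lambda>n. nrm (s n - l)) \<longlonglongrightarrow> 0"
    then have "\<forall>n. \<exists>x. x \<in> X \<and> (\<forall>v\<in>X. A x v = ip (s n) v)" unfolding R_def by blast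
    then obtain x where x: "\<And>n. x n \<in> X" "\<And>n v. v \<in> X \<Longrightarrow> A (x n) v = ip (s n) v" by metis
    have sX: "s n \<in> X" for n using s unfolding R_def by blast
    have stab: "nrm (x m - x n) \<le> c * nrm (s m - s n)" for m n
    proof -
      have "cmod (A (x m - x n) v) \<le> nrm (s m - s n) * nrm v" if "v \<in> X" for v
        using cauchy_schwarz[OF X_diff[OF sX sX] that, of m n] x that sX by (simp add: A_diff ip_diff)
      then show ?thesis by (intro inf_supD[OF infsup] X_diff x nrm_ge_0 sX)
    qed
    have "\<exists>N. \<forall>m\<ge>N. \<forall>n\<ge>N. nrm (x m - x n) < \<epsilon>" if "\<epsilon> > 0" for \<epsilon>
    proof -
      define \<delta> where "\<delta> = \<epsilon> / (2 * (\<bar>c\<bar> + 1))"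
      have \<delta>: "\<delta> > 0" using that by (simp add: \<delta>_def)
      from lim \<delta> have "\<forall>\<^sub>F n in sequentially. nrm (s n - l) < \<delta>"
        by (rule order_tendstoD(2))
      then obtain N where N: "\<And>n. n \<ge> N \<Longrightarrow> nrm (s n - l) < \<delta>" by (auto simp: eventually_sequentially)
      have "nrm (x m - x n) < \<epsilon>" if "m \<ge> N" "n \<ge> N" for m n
      proof -
        have "nrm (s m - s n) \<le> nrm (s m - l) + nrm (s n - l)"
          using nrm_triangle_diff[OF X_diff[OF sX[of m] l] X_diff[OF sX[of n] l]] by simp
        also have "\<dots> < 2 * \<delta>" using N[OF that(1)] N[OF that(2)] by simp
        finally have lt: "nrm (s m - s n) < 2 * \<delta>" .
        have "nrm (x m - x n) \<le> c * nrm (s m - s n)" by (rule stab)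
        also have "\<dots> \<le> (\<bar>c\<bar> + 1) * nrm (s m - s n)"
          using nrm_ge_0[OF X_diff[OF sX sX]] by (intro mult_right_mono) auto
        also have "\<dots> < (\<bar>c\<bar> + 1) * (2 * \<delta>)" by (rule mult_strict_left_mono[OF lt]) simp
        also have "\<dots> = \<epsilon>" by (simp add: \<delta>_def field_simps)
        finally show ?thesis .
      qed
      then show ?thesis by blast
    qed
    then obtain y where y: "y \<in> X" "(\<lambda>n. nrm (x n - y)) \<longlonglongrightarrow> 0" using complete[of x] x by blast
    have "A y v = ip l v" if v: "v \<in> X" for v
    proof (rule LIMSEQ_unique)
      show "(\<lambda>n. A (x n) v) \<longlonglongrightarrow> A y v"
        by (rule form_tendsto[of x y "\<lambda>u. A u v" "K * nrm v"])
          (use x y v bound in \<open>auto simp: A_diff algebra_simps\<close>)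
      have "(\<lambda>n. ip (s n) v) \<longlonglongrightarrow> ip l v"
        by (rule form_tendsto[of s l "\<lambda>u. ip u v" "nrm v"])
          (use sX l lim v cauchy_schwarz in \<open>auto simp: ip_diff mult.commute\<close>)
      then show "(\<lambda>n. A (x n) v) \<longlonglongrightarrow> ip l v" using x v by simp
    qed
    then show "l \<in> R" unfolding R_def using l y by blast
  qed
  have RX: "R \<subseteq> X" unfolding R_def by blast
  obtain r where r: "r \<in> X" "\<And>v. v \<in> X \<Longrightarrow> ip r v = f v" using riesz_representation[OF f] by blast
  define r' where "r' = orth_proj ip R r"
  note pr = orth_proj[OF R.hilbert_space_axioms RX r(1), folded r'_def]
  have "r' \<in> X" using pr RX by blast
  have "A u (r - r') = 0" if u: "u \<in> X" for u
  proof -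
    obtain q where q: "q \<in> R" "\<And>v. v \<in> X \<Longrightarrow> A u v = ip q v" using repr[OF u] by blast
    have "A u (r - r') = ip q (r - r')" by (rule q(2)[OF X_diff[OF r(1) \<open>r' \<in> X\<close>]])
    also have "\<dots> = cnj (ip (r - r') q)"
      by (rule herm[OF X_diff[OF r(1) \<open>r' \<in> X\<close>] subsetD[OF RX q(1)]])
    also have "ip (r - r') q = 0" by (rule pr(2)[OF q(1)])
    finally show ?thesis by simp
  qed
  then have "r - r' = 0" using inj[OF X_diff[OF r(1) \<open>r' \<in> X\<close>]] by blast
  then have "r \<in> R" using pr by simp
  then obtain x where "x \<in> X" "\<forall>v\<in>X. A x v = ip r v" unfolding R_def by blast
  then show ?thesis using r(2) by (intro bexI[of _ x]) simp_all
qed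

text \<open>
  The uniform boundedness principle, by a gliding hump argument.
\<close>

lemma weakly_bounded_imp_bounded:
  assumes F: "F \<subseteq> X" and wb: "\<And>r. r \<in> X \<Longrightarrow> \<exists>b. \<forall>v\<in>F. cmod (ip r v) \<le> b"
  shows "\<exists>b. \<forall>v\<in>F. nrm v \<le> b"
proof (rule ccontr)
  assume "\<not> ?thesis"
  then have "\<forall>n. \<exists>v. v \<in> F \<and> 4 ^ n < nrm v" by (meson not_le)
  then obtain v where v: "\<And>n. v n \<in> F" and big: "\<And>n::nat. 4 ^ n < nrm (v n)" by metis
  have vX: "v n \<in> X" for n using v F by blast
  have vpos: "0 < nrm (v n)" for n using big[of n] by (rule less_trans[rotated]) simp
  \<comment> \<open>Gliding hump: step \<open>n\<close> moves the current point by \<open>\<plusminus>3\<^sup>-\<^sup>n\<close> along \<open>v n\<close>, with the sign that makes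
    the pairing with \<open>v n\<close> large; the remaining steps are too short to destroy that.\<close>
  define st where "st n = scl (of_real ((1/3) ^ n / nrm (v n))) (v n)" for n
  have stX: "st n \<in> X" for n unfolding st_def using vX X_scl by blast
  have st_norm: "nrm (st n) = (1/3) ^ n" for n
    unfolding st_def using vpos[of n] nrm_scl[OF vX] by (simp add: norm_mult norm_divide norm_power)
  have st_ip: "ip (st n) (v n) = of_real ((1/3)^n * nrm (v n))" for n
  proof -
    have "ip (st n) (v n) = of_real ((1/3) ^ n / nrm (v n)) * of_real ((nrm (v n))\<^sup>2)"
      unfolding st_def using vX by (simp only: ip_scl ip_self)
    also have "\<dots> = of_real ((1/3)^n / nrm (v n) * (nrm (v n))\<^sup>2)" by (rule of_real_mult[symmetric])
    also have "(1/3)^n / nrm (v n) * (nrm (v n))\<^sup>2 = (1/3)^n * nrm (v n)"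
      using vpos[of n] by (simp add: power2_eq_square)
    finally show ?thesis .
  qed
  define x where "x = rec_nat 0 (\<lambda>n y. if (1/3)^n * nrm (v n) \<le> cmod (ip (y + st n) (v n)) then y + st n else y - st n)"
  have x0: "x 0 = 0" unfolding x_def by simp
  have xS: "x (Suc n) = (if (1/3)^n * nrm (v n) \<le> cmod (ip (x n + st n) (v n)) then x n + st n else x n - st n)" for n
    unfolding x_def by simp
  have xX: "x n \<in> X" for n
    by (induction n) (auto simp: x0 X_0 xS X_add X_diff stX)
  have hump: "(1/3)^n * nrm (v n) \<le> cmod (ip (x (Suc n)) (v n))" for n
  proof (cases "(1/3)^n * nrm (v n) \<le> cmod (ip (x n + st n) (v n))")
    case True
    then show ?thesis by (simp add: xS)
  next
    case False
    have "ip (x n + st n) (v n) - ip (x n - st n) (v n) = 2 * ip (st n) (v n)"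
      using xX stX vX by (simp add: ip_add ip_diff)
    then have "2 * ((1/3)^n * nrm (v n)) \<le> cmod (ip (x n + st n) (v n)) + cmod (ip (x n - st n) (v n))"
      using norm_triangle_ineq4[of "ip (x n + st n) (v n)" "ip (x n - st n) (v n)"] vpos[of n]
      by (simp add: st_ip norm_mult norm_power norm_divide)
    then show ?thesis using False by (simp add: xS)
  qed
  have xstep: "nrm (x (Suc n) - x n) = (1/3)^n" for n
    using stX[of n] st_norm[of n] by (simp add: xS nrm_uminus)
  have tail: "nrm (x (n + k) - x n) \<le> (3/2) * (1/3)^n * (1 - (1/3)^k)" for n k
  proof (induction k)
    case 0 then show ?case by (simp add: nrm_zero)
  next
    case (Suc k)
    have "nrm (x (n + Suc k) - x n) \<le> nrm (x (Suc (n+k)) - x (n+k)) + nrm (x (n+k) - x n)"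
      using nrm_triangle[OF X_diff[OF xX xX] X_diff[OF xX xX], of "Suc (n+k)" "n+k" "n+k" n] by simp
    also have "\<dots> \<le> (1/3)^(n+k) + (3/2) * (1/3)^n * (1 - (1/3)^k)" using Suc xstep by simp
    also have "\<dots> = (3/2) * (1/3)^n * (1 - (1/3)^Suc k)"
      by (simp only: power_add power_Suc) (simp add: right_diff_distrib)
    finally show ?case .
  qed
  have tail': "nrm (x k - x n) \<le> (3/2) * (1/3)^n" if "k \<ge> n" for k n
  proof -
    have "nrm (x k - x n) \<le> (3/2) * (1/3)^n * (1 - (1/3)^(k-n))" using tail[of n "k-n"] that by simp
    also have "\<dots> \<le> (3/2) * (1/3)^n * 1" by (intro mult_left_mono) auto
    finally show ?thesis by simp
  qed
  have "\<exists>N. \<forall>m\<ge>N. \<forall>n\<ge>N. nrm (x m - x n) < \<epsilon>" if "\<epsilon> > 0" for \<epsilon>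
  proof -
    obtain N where N: "(1/3)^N < \<epsilon> / 3" using real_arch_pow_inv[of "\<epsilon>/3" "1/3"] \<open>\<epsilon> > 0\<close> by auto
    have "nrm (x m - x n) < \<epsilon>" if "m \<ge> N" "n \<ge> N" for m n
      using nrm_triangle_diff[OF X_diff[OF xX xX] X_diff[OF xX xX], of m N n N] tail'[OF that(1)] tail'[OF that(2)] N
      by simp
    then show ?thesis by blast
  qed
  then obtain l where l: "l \<in> X" "(\<lambda>n. nrm (x n - l)) \<longlonglongrightarrow> 0" using complete[of x] xX by blast
  have dist: "nrm (l - x (Suc n)) \<le> (1/2) * (1/3)^n" for n
  proof -
    have "nrm (l - x (Suc n)) \<le> nrm (x k - l) + (1/2) * (1/3)^n" if "k \<ge> Suc n" for k
      using nrm_triangle[OF X_diff[OF l(1) xX] X_diff[OF xX xX], of k k "Suc n"] tail'[OF that]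
        nrm_minus_commute[OF l(1) xX[of k]] by simp
    moreover have "(\<lambda>k. nrm (x k - l) + (1/2) * (1/3)^n) \<longlonglongrightarrow> 0 + (1/2) * (1/3)^n"
      by (intro tendsto_add l tendsto_const)
    ultimately have "nrm (l - x (Suc n)) \<le> 0 + (1/2) * (1/3)^n"
      by (intro LIMSEQ_le_const[rotated, OF exI[of _ "Suc n"]]) auto
    then show ?thesis by simp
  qed
  obtain b where b: "\<And>w. w \<in> F \<Longrightarrow> cmod (ip l w) \<le> b" using wb[OF l(1)] by blast
  have low: "(1/2) * (4/3)^n \<le> b" for n
  proof -
    have d: "nrm (l - x (Suc n)) * nrm (v n) \<le> (1/2) * (1/3)^n * nrm (v n)"
      by (rule mult_right_mono[OF dist]) (simp add: less_imp_le[OF vpos])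
    have "(1/2) * (4/3::real)^n = (1/2) * ((1/3)^n * 4^n)" by (simp add: power_divide)
    also have "\<dots> \<le> (1/2) * ((1/3)^n * nrm (v n))" using big[of n] by simp
    also have "\<dots> = (1/3)^n * nrm (v n) - (1/2) * (1/3)^n * nrm (v n)" by (simp add: field_simps)
    also have "\<dots> \<le> cmod (ip (x (Suc n)) (v n)) - nrm (l - x (Suc n)) * nrm (v n)"
      using hump[of n] d by linarith
    also have "\<dots> \<le> cmod (ip (x (Suc n)) (v n)) - cmod (ip (l - x (Suc n)) (v n))"
      using cauchy_schwarz[OF X_diff[OF l(1) xX] vX] by simp
    also have "\<dots> \<le> cmod (ip l (v n))"
      using norm_triangle_ineq2[of "ip (x (Suc n)) (v n)" "- ip (l - x (Suc n)) (v n)"] l(1) xX vX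
      by (simp add: ip_diff norm_minus_commute)
    also have "\<dots> \<le> b" using b v by blast
    finally show ?thesis .
  qed
  obtain n where "2 * b < (4/3::real)^n" using real_arch_pow[of "4/3::real" "2*b"] by force
  then show False using low[of n] by simp
qed

text \<open>
  Solvability for every right-hand side comes with no bound on the solution; the uniform boundedness
  principle supplies one. If \<open>A u v\<close> is at most \<open>\<parallel>u\<parallel>\<close> for all \<open>u\<close>, then \<open>ip r v\<close> is at most the norm
  of the solution \<open>u\<close> for the datum \<open>r\<close>, so the set of all such \<open>v\<close> is weakly bounded.
\<close>

lemma surjective_imp_adjoint_inf_sup:
  assumes A: "sesquilinear_on scl X A"
    and surj: "\<And>f. f \<in> antidual scl X nrm \<Longrightarrow> \<exists>u\<in>X. \<forall>v\<in>X. A u v = f v"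
  shows "\<exists>c\<ge>0. inf_sup X nrm (op_adj A) c"
proof -
  define F where "F = {v \<in> X. \<forall>u\<in>X. cmod (A u v) \<le> nrm u}"
  have "\<exists>b. \<forall>v\<in>F. nrm v \<le> b"
  proof (rule weakly_bounded_imp_bounded)
    show "F \<subseteq> X" unfolding F_def by blast
    fix r assume r: "r \<in> X"
    have "ip r \<in> antidual scl X nrm"
      by (rule antidualI[where K = "nrm r"]) (use r cauchy_schwarz in \<open>auto simp: ip_add ip_scl\<close>)
    from surj[OF this] obtain u where u: "u \<in> X" "\<And>v. v \<in> X \<Longrightarrow> A u v = ip r v" by blast
    have "\<forall>v\<in>F. cmod (ip r v) \<le> nrm u"
    proof
      fix v assume "v \<in> F"
      then have "v \<in> X" "cmod (A u v) \<le> nrm u" using u(1) unfolding F_def by blast+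
      then show "cmod (ip r v) \<le> nrm u" by (simp only: u(2))
    qed
    then show "\<exists>b. \<forall>v\<in>F. cmod (ip r v) \<le> b" by blast
  qed
  then obtain b where b: "\<And>v. v \<in> F \<Longrightarrow> nrm v \<le> b" by blast
  have "0 \<in> F" unfolding F_def by (simp add: X_0 sesq_zero[OF A subspaceX] nrm_ge_0)
  then have b0: "0 \<le> b" using b[of 0] by (simp add: nrm_zero)
  have "inf_sup X nrm (op_adj A) b"
    unfolding inf_sup_def
  proof (intro ballI allI impI)
    fix x d assume x: "x \<in> X" and d: "0 \<le> d" "\<forall>u\<in>X. cmod (op_adj A x u) \<le> d * nrm u"
    show "nrm x \<le> b * d"
    proof (rule field_le_epsilon)
      fix e :: real assume e: "e > 0"
      define \<delta> where "\<delta> = d + e / (b + 1)"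
      have eb: "0 < e / (b + 1)" using e b0 by simp
      have \<delta>: "\<delta> > 0" "d \<le> \<delta>" using eb d(1) unfolding \<delta>_def by linarith+
      define y where "y = scl (of_real (1/\<delta>)) x"
      have "cmod (A u y) \<le> nrm u" if u: "u \<in> X" for u
      proof -
        have "cmod (A u x) \<le> d * nrm u" using d(2) u unfolding op_adj_def by simp
        also have "\<dots> \<le> \<delta> * nrm u" using \<delta> nrm_ge_0[OF u] by (simp add: mult_right_mono)
        finally have "cmod (A u x) / \<delta> \<le> nrm u" using \<delta>(1) by (simp add: divide_le_eq mult.commute)
        moreover have "cmod (A u y) = cmod (A u x) / \<delta>"
          unfolding y_def sesq_scl(2)[OF A x u] using \<delta>(1) by (simp add: norm_mult norm_divide)
        ultimately show ?thesis by simp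
      qed
      then have "y \<in> F" unfolding F_def y_def using x X_scl by blast
      then have "nrm y \<le> b" by (rule b)
      moreover have "nrm y = nrm x / \<delta>"
        unfolding y_def nrm_scl[OF x] using \<delta>(1) by (simp add: norm_divide)
      ultimately have "nrm x \<le> b * \<delta>" using \<delta>(1) by (simp add: divide_le_eq)
      also have "\<dots> = b * d + (b / (b + 1)) * e" unfolding \<delta>_def by (simp add: algebra_simps)
      also have "\<dots> \<le> b * d + 1 * e"
        by (intro add_left_mono mult_right_mono) (use b0 e in auto)
      finally show "nrm x \<le> b * d + e" by simp
    qed
  qed
  then show ?thesis using b0 by blast
qed

text \<open>
  A form and its adjoint have the same stability constant, because solving the adjoint problem with datum
  \<open>x\<close> produces a test vector for \<open>x\<close>.
\<close>

lemma inf_sup_adjoint: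
  assumes infsup: "inf_sup X nrm (op_adj A) c" and "c \<ge> 0"
    and surj: "\<And>r. r \<in> X \<Longrightarrow> \<exists>w\<in>X. \<forall>u\<in>X. op_adj A w u = ip r u"
  shows "inf_sup X nrm A c"
  unfolding inf_sup_def
proof (intro ballI allI impI)
  fix x d assume x: "x \<in> X" and d: "0 \<le> d" "\<forall>v\<in>X. cmod (A x v) \<le> d * nrm v"
  obtain w where w: "w \<in> X" "\<And>u. u \<in> X \<Longrightarrow> op_adj A w u = ip x u" using surj[OF x] by blast
  have "nrm w \<le> c * nrm x"
  proof -
    have "\<forall>u\<in>X. cmod (op_adj A w u) \<le> nrm x * nrm u" using w x cauchy_schwarz by simp
    then show ?thesis using infsup w(1) nrm_ge_0[OF x] unfolding inf_sup_def by blast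
  qed
  moreover have "(nrm x)\<^sup>2 \<le> d * nrm w"
  proof -
    have "(nrm x)\<^sup>2 = cmod (ip x x)" using x nrm_ge_0 by (simp add: ip_self norm_power)
    also have "\<dots> = cmod (A x w)" using arg_cong[OF w(2)[OF x], of cmod] unfolding op_adj_def by simp
    finally show ?thesis using d w by simp
  qed
  ultimately have "nrm x * nrm x \<le> (c * d) * nrm x"
    using mult_left_mono[of "nrm w" "c * nrm x" d] d by (simp add: power2_eq_square algebra_simps)
  then show "nrm x \<le> c * d"
    using \<open>c \<ge> 0\<close> d(1) nrm_ge_0[OF x] by (cases "nrm x = 0") (auto simp: mult_le_cancel_right)
qed

end

section \<open>Smoothing by the resolvent of the real part\<close>

text \<open>
  The theorem asks for constants that serve all operators at once. Every constant in the
  estimates is therefore defined from these parameters alone: \<open>K\<close> bounds the embedding of \<open>H\<close> in \<open>V\<close>,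
  \<open>\<alpha>\<close> is the coercivity constant of \<open>E\<close>, \<open>Cd\<close> bounds \<open>D\<close>, \<open>Creg\<close> is the regularity constant and \<open>L\<close>
  bounds the inclusions between consecutive spaces of the scale.
\<close>

locale constants =
  fixes K \<alpha> Cd Creg L :: real and m :: nat
  assumes K: "1 \<le> K" and \<alpha>: "0 < \<alpha>" "\<alpha> \<le> 1" and Cd: "0 \<le> Cd" and Creg: "1 \<le> Creg"
    and L: "1 \<le> L" and m: "1 \<le> m"
begin

text \<open>
  The thresholds that the interpolation inequality produces: a vector whose \<open>V\<close>-norm is at least
  \<open>eps 0\<close> times its \<open>H\<close>-norm keeps this property with \<open>eps k\<close> after \<open>k\<close> smoothing steps, and its \<open>V\<close>-norm
  is then still at least \<open>del k\<close> times the initial one.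
\<close>

primrec eps :: "nat \<Rightarrow> real" where
  "eps 0 = \<alpha> / 8"
| "eps (Suc k) = (eps k)\<^sup>2 / K"

primrec del :: "nat \<Rightarrow> real" where
  "del 0 = 1"
| "del (Suc k) = (eps k)\<^sup>2 * del k"

lemma eps_pos: "0 < eps k"
  using K \<alpha> by (induction k) auto

lemma del_pos: "0 < del k"
proof (induction k)
  case (Suc k)
  then show ?case using eps_pos[of k] by simp
qed simp

text \<open>
  The weight of the smoothing perturbation, large enough for the coercivity of the perturbed form on
  divergence-free vectors.
\<close>

definition "lam = 16 / (\<alpha>\<^sup>2 * (del (m+1))\<^sup>2)"

lemma lam_pos: "0 < lam"
  using \<alpha> del_pos[of "m+1"] by (simp add: lam_def del: del.simps)

end

text \<open>
  \<open>N\<close> stands for the kernel of \<open>D\<close> and \<open>a\<close> for the form \<open>Re D + ip\<close> that induces the norm of \<open>H\<close>.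
  Neither changes when \<open>P\<close> is replaced by its adjoint, so all operators built from them are
  shared by the primal and the dual problem.
\<close>

locale gelfand = constants K \<alpha> Cd Creg L m
    + V: hilbert_space scl UNIV ip + H: hilbert_space scl H a + N: hilbert_space scl N ip
  for K \<alpha> Cd Creg L :: real and m :: nat and scl :: "complex \<Rightarrow> 'v::ab_group_add \<Rightarrow> 'v"
    and ip :: "'v \<Rightarrow> 'v \<Rightarrow> complex" and H N :: "'v set" and a :: "'v \<Rightarrow> 'v \<Rightarrow> complex" +
  assumes N_sub: "N \<subseteq> H"
    and embed: "v \<in> H \<Longrightarrow> hnorm ip v \<le> K * hnorm a v"
    and a_N: "z \<in> N \<Longrightarrow> v \<in> H \<Longrightarrow> a z v = ip z v"
begin

abbreviation nV :: "'v \<Rightarrow> real" where "nV \<equiv> hnorm ip"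
abbreviation nH :: "'v \<Rightarrow> real" where "nH \<equiv> hnorm a"

lemma K_pos: "0 < K" using K by simp
lemma nV_ge_0 [simp]: "0 \<le> nV v" by (rule V.nrm_ge_0) simp

lemmas ip_simps = V.ip_add[OF UNIV_I UNIV_I UNIV_I] V.ip_diff[OF UNIV_I UNIV_I UNIV_I]
  V.ip_scl[OF UNIV_I UNIV_I] V.ip_zero[OF UNIV_I]

lemma V_cs: "cmod (ip u v) \<le> nV u * nV v"
  by (rule V.cauchy_schwarz) auto

lemma nH_N: "z \<in> N \<Longrightarrow> nH z = nV z"
  using a_N[of z z] N_sub by (auto simp: hnorm_def)

lemma a_N': "z \<in> N \<Longrightarrow> v \<in> H \<Longrightarrow> a v z = ip v z"
proof -
  assume z: "z \<in> N" and v: "v \<in> H"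
  have "a v z = cnj (a z v)" using N_sub z v by (intro H.herm) auto
  also have "\<dots> = cnj (ip z v)" using z v by (simp only: a_N)
  also have "\<dots> = ip v z" by (rule V.herm[symmetric]) auto
  finally show ?thesis .
qed

definition perp :: "'v \<Rightarrow> bool" where "perp x \<longleftrightarrow> (\<forall>z\<in>N. ip x z = 0)"

definition proj0 :: "'v \<Rightarrow> 'v" where "proj0 = orth_proj ip N"

definition Q :: "'v \<Rightarrow> 'v" where "Q v = v - proj0 v"

lemma proj0_N: "proj0 v \<in> N"
  unfolding proj0_def by (rule V.orth_proj[OF N.hilbert_space_axioms]) auto

lemma proj0_H: "proj0 v \<in> H" using proj0_N N_sub by blast

lemma Q_perp: "perp (Q v)"
  unfolding perp_def Q_def proj0_def
  by (intro ballI V.orth_proj(2)[OF N.hilbert_space_axioms]) auto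

lemma proj0_eqI: "w \<in> N \<Longrightarrow> perp (v - w) \<Longrightarrow> proj0 v = w"
  unfolding proj0_def perp_def by (rule V.orth_proj_eqI[OF N.hilbert_space_axioms]) auto

lemma proj0_perp: "perp x \<Longrightarrow> proj0 x = 0"
  using N.X_0 by (intro proj0_eqI) auto

lemma Q_perp_id: "perp x \<Longrightarrow> Q x = x"
  by (simp add: Q_def proj0_perp)

lemma proj0_N_id: "z \<in> N \<Longrightarrow> proj0 z = z"
  by (rule proj0_eqI) (simp_all add: perp_def ip_simps)

lemma Q_N: "z \<in> N \<Longrightarrow> Q z = 0"
  by (simp add: Q_def proj0_N_id)

lemma proj0_add: "proj0 (u + v) = proj0 u + proj0 v"
proof (rule proj0_eqI)
  show "proj0 u + proj0 v \<in> N" by (rule N.X_add[OF proj0_N proj0_N])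
  have "u + v - (proj0 u + proj0 v) = Q u + Q v" by (simp add: Q_def)
  then show "perp (u + v - (proj0 u + proj0 v))"
    using Q_perp unfolding perp_def by (simp add: ip_simps)
qed

lemma proj0_scl: "proj0 (scl c u) = scl c (proj0 u)"
proof (rule proj0_eqI)
  show "scl c (proj0 u) \<in> N" by (rule N.X_scl[OF proj0_N])
  have "scl c u - scl c (proj0 u) = scl c (Q u)"
    by (simp add: Q_def V.scale_right_diff_distrib)
  then show "perp (scl c u - scl c (proj0 u))"
    using Q_perp unfolding perp_def by (simp add: ip_simps)
qed

lemma Q_add: "Q (u + v) = Q u + Q v" by (simp add: Q_def proj0_add)
lemma Q_scl: "Q (scl c u) = scl c (Q u)"
  by (simp add: Q_def proj0_scl V.scale_right_diff_distrib)

lemma Q_H: "v \<in> H \<Longrightarrow> Q v \<in> H"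
  unfolding Q_def by (rule H.X_diff[OF _ proj0_H])

lemma nV_Q_sq: "(nV v)\<^sup>2 = (nV (Q v))\<^sup>2 + (nV (proj0 v))\<^sup>2"
proof -
  have "v = Q v + proj0 v" by (simp add: Q_def)
  then have "(nV v)\<^sup>2 = (nV (Q v + proj0 v))\<^sup>2" by simp
  also have "\<dots> = (nV (Q v))\<^sup>2 + (nV (proj0 v))\<^sup>2"
    using Q_perp[of v] proj0_N[of v] by (subst V.nrm_add_sq) (auto simp: perp_def)
  finally show ?thesis .
qed

lemma nH_Q_sq: "v \<in> H \<Longrightarrow> (nH v)\<^sup>2 = (nH (Q v))\<^sup>2 + (nV (proj0 v))\<^sup>2"
proof -
  assume v: "v \<in> H"
  have "v = Q v + proj0 v" by (simp add: Q_def)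
  then have "(nH v)\<^sup>2 = (nH (Q v + proj0 v))\<^sup>2" by simp
  also have "\<dots> = (nH (Q v))\<^sup>2 + 2 * Re (a (Q v) (proj0 v)) + (nH (proj0 v))\<^sup>2"
    using v by (intro H.nrm_add_sq Q_H proj0_H)
  also have "a (Q v) (proj0 v) = 0"
    using a_N'[OF proj0_N Q_H[OF v]] Q_perp[of v] proj0_N[of v] unfolding perp_def by simp
  finally show ?thesis by (simp add: nH_N proj0_N)
qed

lemma nV_Q_le: "nV (Q v) \<le> nV v"
  by (rule power2_le_imp_le) (simp_all add: nV_Q_sq[of v])

lemma nH_Q_le: "v \<in> H \<Longrightarrow> nH (Q v) \<le> nH v"
  by (rule power2_le_imp_le) (simp_all add: nH_Q_sq[of v] H.nrm_ge_0)

text \<open>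
  \<open>B\<close> is the inverse of the operator \<open>Re D + 1\<close>; it takes the role of a functional calculus for
  \<open>Re D\<close>.
\<close>

definition B :: "'v \<Rightarrow> 'v" where "B x = (SOME y. y \<in> H \<and> (\<forall>v\<in>H. a y v = ip x v))"

lemma ip_antidual_H: "ip x \<in> antidual scl H nH"
proof (rule H.antidualI[where K = "nV x * K"])
  fix u assume u: "u \<in> H"
  have "cmod (ip x u) \<le> nV x * nV u" by (rule V_cs)
  also have "\<dots> \<le> nV x * (K * nH u)" by (rule mult_left_mono[OF embed[OF u]]) simp
  finally show "cmod (ip x u) \<le> nV x * K * nH u" by (simp add: mult.assoc)
qed (simp_all add: ip_simps)

lemma B_ex: "\<exists>y. y \<in> H \<and> (\<forall>v\<in>H. a y v = ip x v)"
  using H.riesz_representation[OF ip_antidual_H[of x]] by blast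

lemma B_H: "B x \<in> H" and a_B: "v \<in> H \<Longrightarrow> a (B x) v = ip x v"
  using someI_ex[OF B_ex[of x]] unfolding B_def by blast+

lemma B_eqI: "y \<in> H \<Longrightarrow> (\<And>v. v \<in> H \<Longrightarrow> a y v = ip x v) \<Longrightarrow> B x = y"
  by (rule H.eq_if_ip_eq[OF B_H]) (simp_all only: a_B)

lemma B_add: "B (u + v) = B u + B v"
  by (rule B_eqI) (simp_all add: H.X_add B_H H.ip_add a_B ip_simps)

lemma B_scl: "B (scl c u) = scl c (B u)"
  by (rule B_eqI) (simp_all add: H.X_scl B_H H.ip_scl a_B ip_simps)

lemma nH_B: "nH (B x) \<le> K * nV x"
proof -
  have "(nH (B x))\<^sup>2 = Re (ip x (B x))" using a_B[OF B_H, of x x] by (simp add: H.nrm_sq[OF B_H])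
  also have "\<dots> \<le> nV x * nV (B x)" using V_cs[of x "B x"] complex_Re_le_cmod[of "ip x (B x)"] by linarith
  also have "\<dots> \<le> nV x * (K * nH (B x))" by (rule mult_left_mono[OF embed[OF B_H]]) simp
  finally have "nH (B x) * nH (B x) \<le> (K * nV x) * nH (B x)" by (simp add: power2_eq_square algebra_simps)
  then show ?thesis using H.nrm_ge_0[OF B_H[of x]] K_pos
    by (cases "nH (B x) = 0") (auto simp: mult_le_cancel_right)
qed

lemma nV_B: "nV (B x) \<le> K\<^sup>2 * nV x"
proof -
  have "nV (B x) \<le> K * nH (B x)" by (rule embed[OF B_H])
  also have "\<dots> \<le> K * (K * nV x)" by (rule mult_left_mono[OF nH_B]) (use K in simp)
  finally show ?thesis by (simp add: power2_eq_square)
qed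

lemma B_self_adjoint: "ip (B x) y = ip x (B y)"
proof -
  have "ip x (B y) = a (B x) (B y)" by (rule a_B[OF B_H, symmetric])
  also have "\<dots> = cnj (a (B y) (B x))" by (rule H.herm[OF B_H B_H])
  also have "\<dots> = cnj (ip y (B x))" by (simp only: a_B[OF B_H])
  also have "\<dots> = ip (B x) y" by (rule V.herm[symmetric]) auto
  finally show ?thesis by simp
qed

lemma B_perp: "perp x \<Longrightarrow> perp (B x)"
proof (unfold perp_def, intro ballI)
  fix z assume x: "\<forall>z\<in>N. ip x z = 0" and z: "z \<in> N"
  have "ip (B x) z = a (B x) z" by (rule a_N'[OF z B_H, symmetric])
  also have "\<dots> = ip x z" using z N_sub by (intro a_B) auto
  finally show "ip (B x) z = 0" using x z by simp
qed

lemma Bn_perp: "perp x \<Longrightarrow> perp ((B ^^ k) x)"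
  by (induction k) (auto intro: B_perp)

lemma Bn_add: "(B ^^ k) (u + v) = (B ^^ k) u + (B ^^ k) v"
  by (induction k) (auto simp: B_add)

lemma Bn_scl: "(B ^^ k) (scl c u) = scl c ((B ^^ k) u)"
  by (induction k) (auto simp: B_scl)

lemma Bn_H: "u \<in> H \<Longrightarrow> (B ^^ k) u \<in> H"
  by (induction k) (auto simp: B_H)

lemma Bn_self_adjoint: "ip ((B ^^ k) x) y = ip x ((B ^^ k) y)"
  by (induction k arbitrary: x y) (simp_all add: B_self_adjoint funpow_swap1)

lemma nV_Bn: "nV ((B ^^ k) x) \<le> K ^ (2 * k) * nV x"
proof (induction k)
  case (Suc k)
  have "nV (B ((B ^^ k) x)) \<le> K\<^sup>2 * nV ((B ^^ k) x)" by (rule nV_B)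
  also have "\<dots> \<le> K\<^sup>2 * (K ^ (2 * k) * nV x)" by (rule mult_left_mono[OF Suc]) simp
  finally show ?case by (simp add: power2_eq_square algebra_simps)
qed simp

text \<open>
  Both bounds come from Cauchy-Schwarz for consecutive moments of \<open>B\<close>, namely
  \<open>\<parallel>y\<parallel>\<^sub>V\<^sup>2 = a (B y) y\<close> and \<open>\<parallel>B y\<parallel>\<^sub>H\<^sup>2 = ip y (B y)\<close>.
\<close>

lemma interpolation_step:
  assumes y: "y \<in> H" and e: "0 < e" "e * nH y \<le> nV y"
  shows "e\<^sup>2 * nV y \<le> nV (B y)" "e\<^sup>2 / K * nH (B y) \<le> nV (B y)"
proof -
  have 1: "(nV y)\<^sup>2 \<le> nH (B y) * nH y"
  proof -
    have "(nV y)\<^sup>2 = Re (a (B y) y)" by (simp add: V.nrm_sq a_B[OF y])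
    also have "\<dots> \<le> nH (B y) * nH y"
      using H.cauchy_schwarz[OF B_H y, of y] complex_Re_le_cmod[of "a (B y) y"] by linarith
    finally show ?thesis .
  qed
  have 2: "(nH (B y))\<^sup>2 \<le> nV y * nV (B y)"
  proof -
    have "(nH (B y))\<^sup>2 = Re (ip y (B y))" by (simp add: H.nrm_sq[OF B_H] a_B[OF B_H])
    also have "\<dots> \<le> nV y * nV (B y)" using V_cs[of y "B y"] complex_Re_le_cmod[of "ip y (B y)"] by linarith
    finally show ?thesis .
  qed
  show 3: "e\<^sup>2 * nV y \<le> nV (B y)"
  proof (cases "nV y = 0")
    case False
    then have p: "0 < nV y" using nV_ge_0[of y] by linarith
    have ey: "(e * nH y)\<^sup>2 \<le> (nV y)\<^sup>2" using e H.nrm_ge_0[OF y] by (intro power_mono) auto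
    have "e\<^sup>2 * ((nV y)\<^sup>2)\<^sup>2 \<le> e\<^sup>2 * (nH (B y) * nH y)\<^sup>2"
      using 1 by (intro mult_left_mono power_mono) auto
    also have "\<dots> = (nH (B y))\<^sup>2 * (e * nH y)\<^sup>2" by (simp add: power_mult_distrib)
    also have "\<dots> \<le> (nV y * nV (B y)) * (nV y)\<^sup>2" using 2 ey by (intro mult_mono) auto
    finally have "(e\<^sup>2 * nV y) * (nV y ^ 3) \<le> nV (B y) * (nV y ^ 3)"
      by (simp add: power2_eq_square power3_eq_cube algebra_simps)
    then show ?thesis using p by simp
  qed simp
  have "e\<^sup>2 / K * nH (B y) \<le> e\<^sup>2 / K * (K * nV y)" using K by (intro mult_left_mono nH_B) auto
  also have "\<dots> = e\<^sup>2 * nV y" using K by simp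
  finally show "e\<^sup>2 / K * nH (B y) \<le> nV (B y)" using 3 by linarith
qed

text \<open>
  Either the \<open>V\<close>-norm of \<open>x\<close> is small compared to its \<open>H\<close>-norm, or \<open>x\<close> lives at low
  frequencies of \<open>Re D\<close>, where \<open>B\<close> shrinks it by a bounded factor only. Iterating the one-step
  inequality replaces the spectral theorem.
\<close>

lemma interpolation:
  assumes x: "x \<in> H"
  shows "(nV x)\<^sup>2 \<le> (\<alpha> / 8)\<^sup>2 * (nH x)\<^sup>2 + (nV ((B ^^ k) x))\<^sup>2 / (del k)\<^sup>2"
proof (cases "eps 0 * nH x \<le> nV x")
  case True
  have "eps k * nH ((B ^^ k) x) \<le> nV ((B ^^ k) x) \<and> del k * nV x \<le> nV ((B ^^ k) x)"
  proof (induction k)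
    case 0
    then show ?case using True by simp
  next
    case (Suc k)
    let ?y = "(B ^^ k) x"
    note st = interpolation_step[OF Bn_H[OF x] eps_pos conjunct1[OF Suc]]
    have "del (Suc k) * nV x = (eps k)\<^sup>2 * (del k * nV x)" by simp
    also have "\<dots> \<le> (eps k)\<^sup>2 * nV ?y" using Suc by (intro mult_left_mono) auto
    finally show ?case using st by simp
  qed
  then have "(del k * nV x)\<^sup>2 \<le> (nV ((B ^^ k) x))\<^sup>2" using del_pos[of k] by (intro power_mono) auto
  then have "(nV x)\<^sup>2 \<le> (nV ((B ^^ k) x))\<^sup>2 / (del k)\<^sup>2"
    using del_pos[of k] by (simp add: le_divide_eq power_mult_distrib mult.commute)
  moreover have "0 \<le> (\<alpha> / 8)\<^sup>2 * (nH x)\<^sup>2" by simp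
  ultimately show ?thesis by linarith
next
  case False
  then have "(nV x)\<^sup>2 \<le> (eps 0 * nH x)\<^sup>2" by (intro power_mono) auto
  then have "(nV x)\<^sup>2 \<le> (\<alpha> / 8)\<^sup>2 * (nH x)\<^sup>2" by (simp only: eps.simps power_mult_distrib)
  moreover have "0 \<le> (nV ((B ^^ k) x))\<^sup>2 / (del k)\<^sup>2" by simp
  ultimately show ?thesis by linarith
qed

text \<open>
  The smoothing perturbation is \<open>S = lam R\<^sup>* R\<close>, and \<open>Phi u\<close> is the representer of \<open>S u\<close>. Splitting the
  powers of \<open>B\<close> into two halves makes the form \<open>S v v\<close> a multiple of \<open>\<parallel>R v\<parallel>\<^sub>V\<^sup>2\<close>, while the other half still maps \<open>R v\<close>
  into all spaces of the scale.
\<close>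

definition R :: "'v \<Rightarrow> 'v" where "R v = (B ^^ (m+1)) (Q v)"

definition S :: "'v \<Rightarrow> 'v \<Rightarrow> complex" where "S u v = of_real lam * ip (R u) (R v)"

definition Phi :: "'v \<Rightarrow> 'v" where "Phi v = scl (of_real lam) ((B ^^ (m+1)) (R v))"

lemma R_add: "R (u + v) = R u + R v" by (simp only: R_def Q_add Bn_add)
lemma R_scl: "R (scl c u) = scl c (R u)" by (simp only: R_def Q_scl Bn_scl)
lemma R_N: "z \<in> N \<Longrightarrow> R z = 0"
  using R_scl[of 0 z] Bn_scl[of "m+1" 0 0] by (simp add: R_def Q_N)
lemma R_perp: "perp (R v)" unfolding R_def by (intro Bn_perp Q_perp)
lemma Phi_perp: "perp (Phi v)"
  using Bn_perp[OF R_perp, of "m+1" v] unfolding Phi_def perp_def by (simp add: ip_simps)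

lemma perp_ip_Q: "perp x \<Longrightarrow> ip x (Q v) = ip x v"
  using proj0_N[of v] unfolding perp_def Q_def by (simp add: ip_simps)

lemma S_Phi: "S u v = ip (Phi u) v"
proof -
  have "ip (R u) (R v) = ip ((B ^^ (m+1)) (R u)) (Q v)"
    by (simp only: R_def[of v] Bn_self_adjoint)
  also have "\<dots> = ip ((B ^^ (m+1)) (R u)) v" by (rule perp_ip_Q[OF Bn_perp[OF R_perp]])
  finally show ?thesis unfolding S_def Phi_def by (simp only: ip_simps)
qed

lemma S_sesq: "sesquilinear_on scl UNIV S"
  by (rule V.sesquilinear_onI) (simp_all add: S_def R_add R_scl ip_simps algebra_simps)

lemma S_herm: "S v u = cnj (S u v)"
  unfolding S_def using V.herm[of "R u" "R v"] by simp

lemma nV_R: "nV (R v) \<le> K ^ (2 * (m+1)) * nV v"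
proof -
  have "nV (R v) \<le> K ^ (2 * (m+1)) * nV (Q v)" unfolding R_def by (rule nV_Bn)
  also have "\<dots> \<le> K ^ (2 * (m+1)) * nV v" using K by (intro mult_left_mono nV_Q_le) auto
  finally show ?thesis .
qed

lemma S_bound: "cmod (S u v) \<le> lam * K ^ (4 * (m+1)) * nV u * nV v"
proof -
  have "cmod (S u v) = lam * cmod (ip (R u) (R v))" using lam_pos by (simp add: S_def norm_mult)
  also have "\<dots> \<le> lam * (nV (R u) * nV (R v))" using lam_pos V_cs by (intro mult_left_mono) auto
  also have "\<dots> \<le> lam * ((K ^ (2 * (m+1)) * nV u) * (K ^ (2 * (m+1)) * nV v))"
    using lam_pos K by (intro mult_left_mono mult_mono nV_R) auto
  also have "\<dots> = lam * K ^ (2 * (m+1) + 2 * (m+1)) * nV u * nV v"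
    by (simp only: power_add) (simp add: algebra_simps)
  also have "2 * (m+1) + 2 * (m+1) = 4 * (m+1)" by simp
  finally show ?thesis .
qed

lemma S_self: "S v v = of_real (lam * (nV (R v))\<^sup>2)"
  unfolding S_def by (subst V.ip_self) simp_all

lemma S_N: "z \<in> N \<Longrightarrow> S z v = 0" "z \<in> N \<Longrightarrow> S v z = 0"
  by (simp_all add: S_def R_N ip_simps)

end

section \<open>Stability of the smoothed form\<close>

context constants
begin

text \<open>
  \<open>theta\<close> is the weight of the kernel part in the test vector of the inf-sup condition.
\<close>

definition "theta = (K\<^sup>2 + 1) / \<alpha>"
definition "Cstab = 8 * (1 + theta)"
definition "CP = Cd + K\<^sup>2"
definition "CPs = CP + lam * K ^ (4 * (m+1)) * K\<^sup>2"

lemma theta_ge_0: "0 \<le> theta" using \<alpha> by (simp add: theta_def)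
lemma Cstab_ge_0: "0 \<le> Cstab" using theta_ge_0 by (simp add: Cstab_def)
lemma CP_ge_0: "0 \<le> CP" using Cd by (simp add: CP_def)
lemma CPs_ge_0: "0 \<le> CPs" using CP_ge_0 lam_pos K by (simp add: CPs_def)

end

text \<open>
  The vector \<open>p\<close> is \<open>\<Pi>\<^sub>0 w\<close>. For \<open>w\<close> that is divergence-free with respect to \<open>X\<close> it need not vanish,
  but its size is controlled; the bound \<open>1/4\<close> is what the coercivity estimate can absorb.
\<close>

definition div_stable ::
  "('v \<Rightarrow> real) \<Rightarrow> ('v \<Rightarrow> real) \<Rightarrow> 'v set \<Rightarrow> ('v \<Rightarrow> 'v \<Rightarrow> complex) \<Rightarrow> 'v set \<Rightarrow> bool" where
  "div_stable nV nH N E X \<longleftrightarrow>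
     (\<forall>w\<in>X. (\<forall>k\<in>X \<inter> N. E w k = 0) \<longrightarrow>
        (\<forall>p\<in>N. (\<forall>z\<in>N. E p z = E w z) \<longrightarrow> nV p \<le> 1/4 * nH w))"

lemma op_adj_op_adj [simp]: "op_adj (op_adj A) = A"
  by (simp add: op_adj_def)

text \<open>
  The variational problem with norms scaled such that \<open>E\<close> has norm at most \<open>1\<close>. The assumptions are
  invariant under passage to adjoints.
\<close>

locale problem = gelfand K \<alpha> Cd Creg L m scl ip H N a
  for K \<alpha> Cd Creg L :: real and m :: nat and scl :: "complex \<Rightarrow> 'v::ab_group_add \<Rightarrow> 'v"
    and ip :: "'v \<Rightarrow> 'v \<Rightarrow> complex" and H N :: "'v set" and a :: "'v \<Rightarrow> 'v \<Rightarrow> complex" +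
  fixes D E :: "'v \<Rightarrow> 'v \<Rightarrow> complex"
  assumes D_sesq: "sesquilinear_on scl H D"
    and D_bound: "u \<in> H \<Longrightarrow> v \<in> H \<Longrightarrow> cmod (D u v) \<le> Cd * hnorm a u * hnorm a v"
    and E_sesq: "sesquilinear_on scl UNIV E"
    and E_bound: "cmod (E u v) \<le> hnorm ip u * hnorm ip v"
    and E_coercive: "\<alpha> * (hnorm ip v)\<^sup>2 \<le> Re (E v v)"
    and a_D: "u \<in> H \<Longrightarrow> v \<in> H \<Longrightarrow> a u v = (D u v + cnj (D v u)) / 2 + ip u v"
    and D_N: "z \<in> N \<Longrightarrow> v \<in> H \<Longrightarrow> D z v = 0" "z \<in> N \<Longrightarrow> v \<in> H \<Longrightarrow> D v z = 0"
begin

lemma adjoint_problem: "problem K \<alpha> Cd Creg L m scl ip H N a (op_adj D) (op_adj E)"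
proof unfold_locales
  show "sesquilinear_on scl H (op_adj D)" by (rule V.sesquilinear_op_adj[OF D_sesq])
  show "sesquilinear_on scl UNIV (op_adj E)" by (rule V.sesquilinear_op_adj[OF E_sesq])
  show "cmod (op_adj D u v) \<le> Cd * nH u * nH v" if "u \<in> H" "v \<in> H" for u v
    using D_bound[OF that(2,1)] by (simp add: op_adj_def mult.commute mult.left_commute)
  show "cmod (op_adj E u v) \<le> nV u * nV v" for u v
    using E_bound[of v u] by (simp add: op_adj_def mult.commute)
  show "\<alpha> * (nV v)\<^sup>2 \<le> Re (op_adj E v v)" for v using E_coercive[of v] by (simp add: op_adj_def)
  show "a u v = (op_adj D u v + cnj (op_adj D v u)) / 2 + ip u v" if "u \<in> H" "v \<in> H" for u v
    unfolding a_D[OF that] by (simp add: op_adj_def)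
qed (simp_all add: op_adj_def D_N)

lemmas E_simps = V.sesq_add[OF E_sesq UNIV_I UNIV_I UNIV_I]
  V.sesq_diff[OF E_sesq V.subspaceX UNIV_I UNIV_I UNIV_I] V.sesq_scl[OF E_sesq UNIV_I UNIV_I]
  V.sesq_zero[OF E_sesq V.subspaceX UNIV_I]

definition P :: "'v \<Rightarrow> 'v \<Rightarrow> complex" where "P u v = D u v - E u v"
definition Ps :: "'v \<Rightarrow> 'v \<Rightarrow> complex" where "Ps u v = P u v + S u v"

lemma P_sesq: "sesquilinear_on scl H P"
  by (rule V.sesquilinear_onI)
    (simp_all add: P_def V.sesq_add[OF D_sesq] V.sesq_scl[OF D_sesq] E_simps algebra_simps)

lemma Ps_sesq: "sesquilinear_on scl H Ps"
  by (rule V.sesquilinear_onI)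
    (simp_all add: Ps_def V.sesq_add[OF P_sesq] V.sesq_scl[OF P_sesq]
      V.sesq_add[OF S_sesq] V.sesq_scl[OF S_sesq] algebra_simps)

lemma nV_mult_le: "u \<in> H \<Longrightarrow> v \<in> H \<Longrightarrow> nV u * nV v \<le> K\<^sup>2 * nH u * nH v"
proof -
  assume u: "u \<in> H" and v: "v \<in> H"
  have "nV u * nV v \<le> (K * nH u) * (K * nH v)"
    using embed[OF u] embed[OF v] K H.nrm_ge_0[OF u] by (intro mult_mono) auto
  then show ?thesis by (simp add: power2_eq_square algebra_simps)
qed

lemma P_bound: "u \<in> H \<Longrightarrow> v \<in> H \<Longrightarrow> cmod (P u v) \<le> CP * nH u * nH v"
proof -
  assume u: "u \<in> H" and v: "v \<in> H"
  have "cmod (P u v) \<le> cmod (D u v) + cmod (E u v)" unfolding P_def by (rule norm_triangle_ineq4)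
  also have "\<dots> \<le> Cd * nH u * nH v + K\<^sup>2 * nH u * nH v"
    using D_bound[OF u v] E_bound[of u v] nV_mult_le[OF u v] by linarith
  finally show ?thesis by (simp add: CP_def algebra_simps)
qed

lemma Ps_bound: "u \<in> H \<Longrightarrow> v \<in> H \<Longrightarrow> cmod (Ps u v) \<le> CPs * nH u * nH v"
proof -
  assume u: "u \<in> H" and v: "v \<in> H"
  have "cmod (Ps u v) \<le> cmod (P u v) + cmod (S u v)" unfolding Ps_def by (rule norm_triangle_ineq)
  also have "cmod (S u v) \<le> lam * K ^ (4 * (m+1)) * (nV u * nV v)"
    using S_bound[of u v] by (simp only: mult.assoc)
  also have "\<dots> \<le> lam * K ^ (4 * (m+1)) * (K\<^sup>2 * nH u * nH v)"
    using lam_pos K by (intro mult_left_mono nV_mult_le u v) auto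
  finally have "cmod (Ps u v) \<le> cmod (P u v) + lam * K ^ (4 * (m+1)) * (K\<^sup>2 * nH u * nH v)" by simp
  then show ?thesis using P_bound[OF u v] by (simp add: CPs_def algebra_simps)
qed

text \<open>
  The oblique \<open>E\<close>-projection onto any complete subspace exists by coercivity. With \<open>Y = N\<close> it is \<open>\<Pi>\<^sub>0\<close>, with
  the kernel vectors in the discrete space it is the discrete counterpart of \<open>\<Pi>\<^sub>0\<close>.
\<close>

lemma E_solvable_on:
  assumes Y: "hilbert_space scl Y ip"
  shows "\<exists>w\<in>Y. \<forall>z\<in>Y. E w z = E v z"
proof -
  interpret Y: hilbert_space scl Y ip by fact
  show ?thesis
  proof (rule Y.inf_sup_solvable[where K = 1 and c = "1 / \<alpha>"])
    show "sesquilinear_on scl Y E" by (rule sesquilinear_on_subset[OF E_sesq]) simp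
    show "cmod (E u w) \<le> 1 * nV u * nV w" for u w using E_bound by simp
    show "inf_sup Y nV E (1 / \<alpha>)"
      unfolding inf_sup_def
    proof (intro ballI allI impI)
      fix x d assume x: "x \<in> Y" and d: "0 \<le> (d::real)" "\<forall>v\<in>Y. cmod (E x v) \<le> d * nV v"
      have "\<alpha> * (nV x)\<^sup>2 \<le> cmod (E x x)" using E_coercive[of x] complex_Re_le_cmod[of "E x x"] by linarith
      also have "\<dots> \<le> d * nV x" using d(2) x by blast
      finally have "(\<alpha> * nV x) * nV x \<le> d * nV x" by (simp add: power2_eq_square mult.assoc)
      then have "\<alpha> * nV x \<le> d"
        using nV_ge_0[of x] d(1) by (cases "nV x = 0") (auto simp: mult_le_cancel_right)
      then show "nV x \<le> 1 / \<alpha> * d" using \<alpha> by (simp add: le_divide_eq mult.commute)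
    qed
    fix y assume "y \<in> Y" "\<And>u. u \<in> Y \<Longrightarrow> E u y = 0"
    then have "\<alpha> * (nV y)\<^sup>2 \<le> 0" using E_coercive[of y] by simp
    then have "nV y = 0" using \<alpha> by (simp add: mult_le_0_iff)
    then show "y = 0" using V.nrm_eq_0[of y] by simp
  next
    show "E v \<in> antidual scl Y nV"
      by (rule Y.antidualI[where K = "nV v"]) (simp_all add: E_simps E_bound)
  qed
qed

definition pi0 :: "'v \<Rightarrow> 'v" where "pi0 v = (SOME w. w \<in> N \<and> (\<forall>z\<in>N. E w z = E v z))"
definition pi1 :: "'v \<Rightarrow> 'v" where "pi1 v = v - pi0 v"

lemma pi0_N: "pi0 v \<in> N" and E_pi0: "z \<in> N \<Longrightarrow> E (pi0 v) z = E v z"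
  using someI_ex[of "\<lambda>w. w \<in> N \<and> (\<forall>z\<in>N. E w z = E v z)"] E_solvable_on[OF N.hilbert_space_axioms, of v]
  unfolding pi0_def by blast+

lemma E_N_eqI: "w \<in> N \<Longrightarrow> w' \<in> N \<Longrightarrow> (\<And>z. z \<in> N \<Longrightarrow> E w z = E w' z) \<Longrightarrow> w = w'"
proof -
  assume w: "w \<in> N" "w' \<in> N" and eq: "\<And>z. z \<in> N \<Longrightarrow> E w z = E w' z"
  have "E (w - w') (w - w') = 0"
    using eq[OF N.X_diff[OF w]] V.sesq_diff(1)[OF E_sesq V.subspaceX UNIV_I UNIV_I UNIV_I, of w w' "w - w'"]
    by simp
  then have "\<alpha> * (nV (w - w'))\<^sup>2 \<le> 0" using E_coercive[of "w - w'"] by simp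
  then have "nV (w - w') = 0" using \<alpha> by (simp add: mult_le_0_iff)
  then show ?thesis using V.nrm_eq_0[of "w - w'"] by simp
qed

lemma pi0_eqI: "w \<in> N \<Longrightarrow> (\<And>z. z \<in> N \<Longrightarrow> E w z = E v z) \<Longrightarrow> pi0 v = w"
  by (rule E_N_eqI[OF pi0_N]) (simp_all only: E_pi0)

lemma pi0_eq_0: "(\<And>z. z \<in> N \<Longrightarrow> E v z = 0) \<Longrightarrow> pi0 v = 0"
  by (rule pi0_eqI) (simp_all add: N.X_0 E_simps)

lemma pi0_H: "pi0 v \<in> H" using pi0_N N_sub by blast

lemma pi1_H: "v \<in> H \<Longrightarrow> pi1 v \<in> H" unfolding pi1_def by (rule H.X_diff[OF _ pi0_H])

lemma nV_pi0: "nV (pi0 v) \<le> nV v / \<alpha>"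
proof -
  have "\<alpha> * (nV (pi0 v))\<^sup>2 \<le> Re (E (pi0 v) (pi0 v))" by (rule E_coercive)
  also have "\<dots> \<le> cmod (E v (pi0 v))" by (simp add: E_pi0[OF pi0_N] complex_Re_le_cmod)
  also have "\<dots> \<le> nV v * nV (pi0 v)" by (rule E_bound)
  finally have "(\<alpha> * nV (pi0 v)) * nV (pi0 v) \<le> nV v * nV (pi0 v)"
    by (simp add: power2_eq_square mult.assoc)
  then have "\<alpha> * nV (pi0 v) \<le> nV v"
    using nV_ge_0[of "pi0 v"] by (cases "nV (pi0 v) = 0") (auto simp: mult_le_cancel_right)
  then show ?thesis using \<alpha> by (simp add: le_divide_eq mult.commute)
qed

lemma nV_pi1: "nV (pi1 v) \<le> 2 / \<alpha> * nV v"
proof -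
  have "nV (pi1 v) \<le> nV v + nV (pi0 v)" unfolding pi1_def by (rule V.nrm_triangle_diff) auto
  also have "\<dots> \<le> nV v / \<alpha> + nV v / \<alpha>"
  proof -
    have "nV v * \<alpha> \<le> nV v * 1" using \<alpha> by (intro mult_left_mono) auto
    then have "nV v \<le> nV v / \<alpha>" using \<alpha> by (simp add: le_divide_eq)
    then show ?thesis using nV_pi0[of v] by linarith
  qed
  finally show ?thesis by simp
qed

text \<open>
  \<open>\<Pi>\<^sub>1\<close> annihilates \<open>N\<close>, so it can be estimated by the part orthogonal to the kernel alone.
\<close>

lemma pi1_Q: "pi1 (Q v) = pi1 v"
proof -
  have "pi0 v = proj0 v + pi0 (Q v)"
  proof (rule pi0_eqI)
    show "proj0 v + pi0 (Q v) \<in> N" by (rule N.X_add[OF proj0_N pi0_N])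
    show "E (proj0 v + pi0 (Q v)) z = E v z" if "z \<in> N" for z
      using that by (simp add: E_simps E_pi0) (simp add: Q_def E_simps)
  qed
  then show ?thesis by (simp add: pi1_def Q_def)
qed

lemma nV_pi1_Q: "nV (pi1 v) \<le> 2 / \<alpha> * nV (Q v)"
  using nV_pi1[of "Q v"] by (simp add: pi1_Q)

lemma P_N: "z \<in> N \<Longrightarrow> v \<in> H \<Longrightarrow> P z v = - E z v" "z \<in> N \<Longrightarrow> v \<in> H \<Longrightarrow> P v z = - E v z"
  by (simp_all add: P_def D_N)

lemma Ps_N: "z \<in> N \<Longrightarrow> v \<in> H \<Longrightarrow> Ps z v = - E z v" "z \<in> N \<Longrightarrow> v \<in> H \<Longrightarrow> Ps v z = - E v z"
  by (simp_all add: Ps_def P_N S_N)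

lemma nH_sq: "v \<in> H \<Longrightarrow> (nH v)\<^sup>2 = Re (D v v) + (nV v)\<^sup>2"
  by (simp add: H.nrm_sq a_D V.nrm_sq)

lemma Re_P: "v \<in> H \<Longrightarrow> (nH v)\<^sup>2 \<le> Re (P v v) + 2 * (nV v)\<^sup>2"
  using nH_sq[of v] E_bound[of v v] complex_Re_le_cmod[of "E v v"]
  by (simp add: P_def power2_eq_square)

text \<open>
  The limits in \<open>X\<close> for the \<open>H\<close>-norm and in \<open>N\<close> for the \<open>V\<close>-norm coincide because the former norm
  dominates the latter.
\<close>

lemma intersection_hilbert:
  assumes X: "hilbert_space scl X a" and XH: "X \<subseteq> H"
  shows "hilbert_space scl (X \<inter> N) ip"
proof -
  interpret X: hilbert_space scl X a by fact
  show ?thesis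
  proof unfold_locales
    show "V.subspace (X \<inter> N)" by (rule V.subspace_inter[OF X.subspaceX N.subspaceX])
    show "sesquilinear_on scl (X \<inter> N) ip" by (rule sesquilinear_on_subset[OF V.sesq]) simp
    show "ip v u = cnj (ip u v)" for u v by (rule V.herm) auto
    show "0 < Re (ip u u)" if "u \<noteq> 0" for u using that by (intro V.pos) auto
    fix s assume s: "\<And>n::nat. s n \<in> X \<inter> N"
      and cau: "\<And>\<epsilon>. \<epsilon> > 0 \<Longrightarrow> \<exists>M. \<forall>m\<ge>M. \<forall>n\<ge>M. nV (s m - s n) < \<epsilon>"
    have sN: "s n \<in> N" and sX: "s n \<in> X" for n using s[of n] by auto
    from N.complete[of s, OF sN cau] obtain l where l: "l \<in> N" "(\<lambda>n. nV (s n - l)) \<longlonglongrightarrow> 0" by blast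
    have eq: "nH (s i - s j) = nV (s i - s j)" for i j by (rule nH_N[OF N.X_diff[OF sN sN]])
    have "\<exists>M. \<forall>m\<ge>M. \<forall>n\<ge>M. nH (s m - s n) < \<epsilon>" if "\<epsilon> > 0" for \<epsilon>
      using cau[OF that] by (simp only: eq)
    from X.complete[of s, OF sX this] obtain k where k: "k \<in> X" "(\<lambda>n. nH (s n - k)) \<longlonglongrightarrow> 0" by blast
    have kH: "k \<in> H" and sH: "s n \<in> H" for n using k(1) XH sX by auto
    have "(\<lambda>n. K * nH (s n - k) + nV (s n - l)) \<longlonglongrightarrow> K * 0 + 0"
      by (intro tendsto_add tendsto_mult_left k(2) l(2))
    moreover have "nV (l - k) \<le> K * nH (s n - k) + nV (s n - l)" for n
      using V.nrm_triangle_diff[of "s n - k" "s n - l"] embed[OF H.X_diff[OF sH kH], of n] by simp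
    ultimately have "nV (l - k) \<le> K * 0 + 0"
      by (intro LIMSEQ_le_const) auto
    then have "nV (l - k) = 0" using nV_ge_0[of "l - k"] by linarith
    then have "l = k" using V.nrm_eq_0[of "l - k"] by simp
    then show "\<exists>l\<in>X \<inter> N. (\<lambda>n. nV (s n - l)) \<longlonglongrightarrow> 0" using l k by blast
  qed
qed

text \<open>
  In \<open>Re (P w w) \<ge> \<parallel>w\<parallel>\<^sub>H\<^sup>2 - 2 \<parallel>w\<parallel>\<^sub>V\<^sup>2\<close> the last term splits into \<open>\<Pi>\<^sub>0 w\<close>, small by assumption, and
  \<open>\<Pi>\<^sub>1 w\<close>, which by interpolation is a small multiple of \<open>\<parallel>w\<parallel>\<^sub>H\<close> up to what \<open>S w w\<close> compensates.
\<close>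

lemma Ps_coercive:
  assumes w: "w \<in> H" and div: "nV (pi0 w) \<le> 1/4 * nH w"
  shows "1/2 * (nH w)\<^sup>2 \<le> Re (Ps w w)"
proof -
  have "nV w \<le> nV (pi0 w) + nV (pi1 w)"
    using V.nrm_triangle[of "pi0 w" "pi1 w"] by (simp add: pi1_def)
  also have "\<dots> \<le> 1/4 * nH w + 2 / \<alpha> * nV (Q w)" using div nV_pi1_Q[of w] by linarith
  finally have "(nV w)\<^sup>2 \<le> (1/4 * nH w + 2 / \<alpha> * nV (Q w))\<^sup>2" by (intro power_mono) auto
  also have "\<dots> \<le> 2 * (1/4 * nH w)\<^sup>2 + 2 * (2 / \<alpha> * nV (Q w))\<^sup>2"
    using zero_le_power2[of "1/4 * nH w - 2 / \<alpha> * nV (Q w)"] by (simp add: power2_sum power2_diff)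
  also have "\<dots> = (nH w)\<^sup>2 / 8 + 8 / \<alpha>\<^sup>2 * (nV (Q w))\<^sup>2"
    by (simp add: power_mult_distrib power_divide)
  finally have 1: "2 * (nV w)\<^sup>2 \<le> (nH w)\<^sup>2 / 4 + 16 / \<alpha>\<^sup>2 * (nV (Q w))\<^sup>2" by simp
  have "(nV (Q w))\<^sup>2 \<le> (\<alpha> / 8)\<^sup>2 * (nH (Q w))\<^sup>2 + (nV (R w))\<^sup>2 / (del (m+1))\<^sup>2"
    unfolding R_def by (rule interpolation[OF Q_H[OF w]])
  also have "\<dots> \<le> (\<alpha> / 8)\<^sup>2 * (nH w)\<^sup>2 + (nV (R w))\<^sup>2 / (del (m+1))\<^sup>2"
    using nH_Q_le[OF w] H.nrm_ge_0[OF Q_H[OF w]] by (intro add_right_mono mult_left_mono power_mono) auto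
  \<comment> \<open>The threshold \<open>\<alpha> / 8\<close> makes the first term a quarter of \<open>\<parallel>w\<parallel>\<^sub>H\<^sup>2\<close>, and \<open>lam\<close> is the factor that
    then remains in the second one.\<close>
  finally have "16 / \<alpha>\<^sup>2 * (nV (Q w))\<^sup>2 \<le>
      16 / \<alpha>\<^sup>2 * ((\<alpha> / 8)\<^sup>2 * (nH w)\<^sup>2 + (nV (R w))\<^sup>2 / (del (m+1))\<^sup>2)"
    by (intro mult_left_mono) auto
  also have "\<dots> = (nH w)\<^sup>2 / 4 + lam * (nV (R w))\<^sup>2"
  proof -
    have "16 / \<alpha>\<^sup>2 * ((\<alpha> / 8)\<^sup>2 * (nH w)\<^sup>2) = (nH w)\<^sup>2 / 4" using \<alpha> by (simp add: power_divide)
    moreover have "16 / \<alpha>\<^sup>2 * ((nV (R w))\<^sup>2 / (del (m+1))\<^sup>2) = lam * (nV (R w))\<^sup>2"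
      unfolding lam_def by simp
    ultimately show ?thesis by (simp only: distrib_left)
  qed
  finally have "2 * (nV w)\<^sup>2 \<le> (nH w)\<^sup>2 / 2 + Re (S w w)" using 1 by (simp add: S_self)
  then show ?thesis using Re_P[OF w] by (simp add: Ps_def)
qed

text \<open>
  On the kernel the form is \<open>- E\<close> and has the wrong sign, so coercivity fails; but \<open>x\<close> splits into a kernel
  part \<open>k\<close> and a divergence-free part \<open>w\<close>, and flipping the sign of \<open>k\<close> in the test vector
  cures this. The mixed term \<open>Ps w k\<close> vanishes, and the other one is absorbed by a large weight
  \<open>theta\<close>.
\<close>

lemma Ps_inf_sup:
  assumes X: "hilbert_space scl X a" and XH: "X \<subseteq> H" and div: "div_stable nV nH N E X"
  shows "inf_sup X nH Ps Cstab"
  unfolding inf_sup_def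
proof (intro ballI allI impI)
  fix x d assume x: "x \<in> X" and d: "0 \<le> (d::real)" "\<forall>v\<in>X. cmod (Ps x v) \<le> d * nH v"
  interpret X: hilbert_space scl X a by fact
  obtain k where k: "k \<in> X \<inter> N" and Ek: "\<And>z. z \<in> X \<inter> N \<Longrightarrow> E k z = E x z"
    using E_solvable_on[OF intersection_hilbert[OF X XH], of x] by blast
  define w where "w = x - k"
  define v where "v = w - scl (of_real theta) k"
  have kX: "k \<in> X" "k \<in> N" using k by auto
  have wX: "w \<in> X" unfolding w_def by (rule X.X_diff[OF x kX(1)])
  have vX: "v \<in> X" unfolding v_def by (rule X.X_diff[OF wX X.X_scl[OF kX(1)]])
  have H: "k \<in> H" "w \<in> H" "x \<in> H" using kX wX x XH by auto
  have nn: "0 \<le> nH w" "0 \<le> nV k" by (simp_all add: H.nrm_ge_0 H)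
  have Ew: "E w z = 0" if "z \<in> X \<inter> N" for z
    using Ek[OF that] by (simp add: w_def E_simps)
  have "nV (pi0 w) \<le> 1/4 * nH w"
    using div wX Ew pi0_N E_pi0 unfolding div_stable_def by blast
  then have co: "1/2 * (nH w)\<^sup>2 \<le> Re (Ps w w)" by (rule Ps_coercive[OF H(2)])
  have "Ps x v = Ps (w + k) (w - scl (of_real theta) k)" by (simp add: w_def v_def)
  also have "\<dots> = Ps w w - of_real theta * Ps w k + Ps k w - of_real theta * Ps k k"
    using H by (simp add: V.sesq_add[OF Ps_sesq] V.sesq_diff[OF Ps_sesq H.subspaceX]
        V.sesq_scl[OF Ps_sesq] H.X_scl H.X_diff H.X_add algebra_simps)
  also have "\<dots> = Ps w w - E k w + of_real theta * E k k"
    using H kX by (simp add: Ps_N Ew[OF k])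
  finally have "Re (Ps x v) = Re (Ps w w) - Re (E k w) + theta * Re (E k k)" by simp
  moreover have "Re (E k w) \<le> 1/4 * (nH w)\<^sup>2 + K\<^sup>2 * (nV k)\<^sup>2"
  proof -
    have "Re (E k w) \<le> nV k * nV w" using E_bound[of k w] complex_Re_le_cmod[of "E k w"] by linarith
    also have "\<dots> \<le> nV k * (K * nH w)" by (rule mult_left_mono[OF embed[OF H(2)]]) simp
    also have "\<dots> \<le> 1/4 * (nH w)\<^sup>2 + K\<^sup>2 * (nV k)\<^sup>2"
      using zero_le_power2[of "1/2 * nH w - K * nV k"]
      by (simp add: power2_diff power_mult_distrib power_divide algebra_simps)
    finally show ?thesis .
  qed
  moreover have "(K\<^sup>2 + 1) * (nV k)\<^sup>2 \<le> theta * Re (E k k)"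
  proof -
    have "(K\<^sup>2 + 1) * (nV k)\<^sup>2 = theta * (\<alpha> * (nV k)\<^sup>2)" using \<alpha> by (simp add: theta_def)
    also have "\<dots> \<le> theta * Re (E k k)" by (rule mult_left_mono[OF E_coercive theta_ge_0])
    finally show ?thesis .
  qed
  ultimately have "1/4 * (nH w)\<^sup>2 + (nV k)\<^sup>2 \<le> Re (Ps x v)"
    using co by (simp add: distrib_right)
  also have "\<dots> \<le> cmod (Ps x v)" by (rule complex_Re_le_cmod)
  also have "\<dots> \<le> d * nH v" using d(2) vX by blast
  also have "\<dots> \<le> d * ((1 + theta) * (nH w + nV k))"
  proof (rule mult_left_mono[OF _ d(1)])
    have "nH v \<le> nH w + theta * nV k"
      using H.nrm_triangle_diff[OF H(2) H.X_scl[OF H(1)], of "of_real theta"] theta_ge_0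
      unfolding v_def by (simp add: H.nrm_scl[OF H(1)] nH_N[OF kX(2)])
    also have "\<dots> \<le> (1 + theta) * (nH w + nV k)"
      using nn theta_ge_0 by (simp add: algebra_simps)
    finally show "nH v \<le> (1 + theta) * (nH w + nV k)" .
  qed
  finally have main: "1/4 * (nH w)\<^sup>2 + (nV k)\<^sup>2 \<le> d * ((1 + theta) * (nH w + nV k))" .
  define t where "t = nH w + nV k"
  have "t\<^sup>2 \<le> 2 * (nH w)\<^sup>2 + 2 * (nV k)\<^sup>2"
    using zero_le_power2[of "nH w - nV k"] unfolding t_def by (simp add: power2_sum power2_diff)
  also have "\<dots> \<le> 8 * (1/4 * (nH w)\<^sup>2 + (nV k)\<^sup>2)" by simp
  also have "\<dots> \<le> 8 * (d * ((1 + theta) * t))" unfolding t_def by (rule mult_left_mono[OF main]) simp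
  finally have "t * t \<le> (Cstab * d) * t" by (simp add: power2_eq_square Cstab_def algebra_simps)
  moreover have "0 \<le> t" using nn by (simp add: t_def)
  ultimately have "t \<le> Cstab * d"
    using d(1) Cstab_ge_0 by (cases "t = 0") (auto simp: mult_le_cancel_right)
  moreover have "nH x \<le> t"
    using H.nrm_triangle[OF H(2) H(1)] by (simp add: w_def t_def nH_N[OF kX(2)])
  ultimately show "nH x \<le> Cstab * d" by linarith
qed

text \<open>
  Divergence-free vectors of \<open>H\<close> satisfy \<open>\<Pi>\<^sub>0 w = 0\<close>. So \<open>H\<close> itself is a stable discretisation, and the solvability of the continuous problem for \<open>Ps\<close> is a
  special case of that of the discrete ones.
\<close>

lemma div_stable_H: "div_stable nV nH N E H"
  unfolding div_stable_def
proof (intro ballI impI)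
  fix w p assume w: "w \<in> H" "\<forall>k\<in>H \<inter> N. E w k = 0" and p: "p \<in> N" "\<forall>z\<in>N. E p z = E w z"
  have "p = 0" using p w(2) N_sub by (intro E_N_eqI N.X_0) (auto simp: E_simps)
  then show "nV p \<le> 1/4 * nH w" using H.nrm_ge_0[OF w(1)] V.nrm_zero by simp
qed

lemma adjoint_Ps: "problem.Ps K \<alpha> m ip H N a (op_adj D) (op_adj E) = op_adj Ps"
proof -
  interpret adj: problem K \<alpha> Cd Creg L m scl ip H N a "op_adj D" "op_adj E" by (rule adjoint_problem)
  have "adj.Ps u v = op_adj Ps u v" for u v
    unfolding adj.Ps_def Ps_def adj.P_def P_def using S_herm[of u v] by (simp add: op_adj_def)
  then show ?thesis by blast
qed

lemma adjoint_P: "problem.P (op_adj D) (op_adj E) = op_adj P"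
proof -
  interpret adj: problem K \<alpha> Cd Creg L m scl ip H N a "op_adj D" "op_adj E" by (rule adjoint_problem)
  have "adj.P u v = op_adj P u v" for u v
    unfolding adj.P_def P_def by (simp add: op_adj_def)
  then show ?thesis by blast
qed

lemma adjoint_Ps_inf_sup:
  assumes "hilbert_space scl X a" "X \<subseteq> H" "div_stable nV nH N (op_adj E) X"
  shows "inf_sup X nH (op_adj Ps) Cstab"
proof -
  interpret adj: problem K \<alpha> Cd Creg L m scl ip H N a "op_adj D" "op_adj E" by (rule adjoint_problem)
  show ?thesis using adj.Ps_inf_sup[OF assms] by (simp only: adjoint_Ps)
qed

lemma Ps_solvable:
  assumes X: "hilbert_space scl X a" and XH: "X \<subseteq> H" and div: "div_stable nV nH N E X"
    and div': "div_stable nV nH N (op_adj E) X" and f: "f \<in> antidual scl X nH"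
  shows "\<exists>u\<in>X. \<forall>v\<in>X. Ps u v = f v"
proof -
  interpret X: hilbert_space scl X a by fact
  show ?thesis
  proof (rule X.inf_sup_solvable[OF _ _ Ps_inf_sup[OF X XH div] _ f, where K = CPs])
    show "sesquilinear_on scl X Ps" by (rule sesquilinear_on_subset[OF Ps_sesq XH])
    show "cmod (Ps u v) \<le> CPs * nH u * nH v" if "u \<in> X" "v \<in> X" for u v
      using that XH by (intro Ps_bound) auto
    fix v assume v: "v \<in> X" "\<And>u. u \<in> X \<Longrightarrow> Ps u v = 0"
    have "nH v \<le> Cstab * 0"
      using v by (intro inf_supD[OF adjoint_Ps_inf_sup[OF X XH div']]) (simp_all add: op_adj_def)
    then have "nH v = 0" using X.nrm_ge_0[OF v(1)] by simp
    then show "v = 0" using X.nrm_eq_0[OF v(1)] by simp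
  qed
qed

end

section \<open>Regularity and the duality argument\<close>

context constants
begin

text \<open>
  Elliptic regularity gains two orders at a time, so the constants for smoothing (\<open>rho\<close>) and for
  the regularity of solutions (\<open>sig\<close>) recur with step two, starting from \<open>Z 0 = V\<close> and
  \<open>Z 1 = H\<close>.
\<close>

fun rho :: "nat \<Rightarrow> real" where
  "rho 0 = K ^ (2 * (m+1))"
| "rho (Suc 0) = K * K ^ (2 * (m+1))"
| "rho (Suc (Suc j)) = (1 + Creg) * (Creg * (2 / \<alpha> * K ^ (2 * (m+1)) + 2 * rho j))"

fun sig :: "nat \<Rightarrow> real" where
  "sig 0 = K"
| "sig (Suc 0) = 1"
| "sig (Suc (Suc j)) = 1 + Creg * (2 / \<alpha> * K + 1 + Creg * sig j)"

lemma rho_ge_0: "0 \<le> rho j"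
  using K \<alpha> Creg by (induction j rule: rho.induct) auto

lemma sig_ge_0: "0 \<le> sig j"
  using K \<alpha> Creg by (induction j rule: sig.induct) auto

definition "rbar = (\<Sum>j\<le>m+1. rho j)"

lemma rho_le: "j \<le> m + 1 \<Longrightarrow> rho j \<le> rbar"
  unfolding rbar_def by (rule member_le_sum) (auto simp: rho_ge_0)

lemma rbar_ge_0: "0 \<le> rbar"
  unfolding rbar_def by (intro sum_nonneg rho_ge_0)

text \<open>
  The constants of the duality argument: \<open>cphi\<close> for the smoothed error, \<open>cy\<close> for the auxiliary primal
  solution, \<open>cw\<close> for the dual solution and its elliptic projection, \<open>c1\<close> and \<open>c2\<close> for the two terms of
  the resulting inequality.
\<close>

definition "cphi = lam * rbar"
definition "cy = cphi + (cphi * K ^ (2 * (m+1)) * K + 1) * (Cstab * (K * cphi))"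
definition "cw = (1 + Cstab * CPs) * (sig (m+1) * (2 * cphi))"
definition "c1 = CPs * cw"
definition "c2 = CPs * (sig (m+1) * cy) * cw"
definition "Cerr = 1 + Cstab * CPs + Cstab * (K * cphi) * (2 * c1 / lam)"

lemma cphi_ge_0: "0 \<le> cphi" using lam_pos rbar_ge_0 by (simp add: cphi_def)
lemma cy_ge_0: "0 \<le> cy" using cphi_ge_0 K Cstab_ge_0 by (simp add: cy_def)
lemma cw_ge_0: "0 \<le> cw" using cphi_ge_0 CPs_ge_0 Cstab_ge_0 sig_ge_0 by (simp add: cw_def)
lemma c1_ge_0: "0 \<le> c1" using cw_ge_0 CPs_ge_0 by (simp add: c1_def)
lemma c2_ge_0: "0 \<le> c2" using cw_ge_0 CPs_ge_0 cy_ge_0 sig_ge_0 by (simp add: c2_def)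
lemma Cerr_ge_1: "1 \<le> Cerr"
  using Cstab_ge_0 CPs_ge_0 K cphi_ge_0 c1_ge_0 lam_pos by (simp add: Cerr_def)

end

text \<open>
  The regularity assumptions in the form in which they are used: the supremum over
  test vectors of unit dual norm is replaced by a representer \<open>F\<close>, and \<open>p\<close> is \<open>\<Pi>\<^sub>0 u\<close>.
\<close>

locale regular = problem K \<alpha> Cd Creg L m scl ip H N a D E
  for K \<alpha> Cd Creg L :: real and m :: nat and scl :: "complex \<Rightarrow> 'v::ab_group_add \<Rightarrow> 'v"
    and ip :: "'v \<Rightarrow> 'v \<Rightarrow> complex" and H N :: "'v set" and a :: "'v \<Rightarrow> 'v \<Rightarrow> complex"
    and D E :: "'v \<Rightarrow> 'v \<Rightarrow> complex" +
  fixes Z :: "nat \<Rightarrow> 'v set" and n :: "nat \<Rightarrow> 'v \<Rightarrow> real"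
  assumes Z0: "Z 0 = UNIV" "n 0 = hnorm ip" and Z1: "Z 1 = H" "n 1 = hnorm a"
    and Z_sub: "j \<le> m + 1 \<Longrightarrow> V.subspace (Z j)"
    and n_ge_0: "j \<le> m + 1 \<Longrightarrow> x \<in> Z j \<Longrightarrow> 0 \<le> n j x"
    and n_add: "j \<le> m + 1 \<Longrightarrow> x \<in> Z j \<Longrightarrow> y \<in> Z j \<Longrightarrow> n j (x + y) \<le> n j x + n j y"
    and n_scl: "j \<le> m + 1 \<Longrightarrow> x \<in> Z j \<Longrightarrow> n j (scl c x) = cmod c * n j x"
    and reg_proj: "1 \<le> j \<Longrightarrow> j \<le> m + 1 \<Longrightarrow> x \<in> Z j \<Longrightarrow>
      orth_proj ip N x \<in> Z j \<and> n j (orth_proj ip N x) \<le> Creg * n j x"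
    and reg_D: "j + 2 \<le> m + 1 \<Longrightarrow> u \<in> H \<Longrightarrow> F \<in> Z j \<Longrightarrow> (\<And>v. v \<in> H \<Longrightarrow> D u v = ip F v) \<Longrightarrow>
      p \<in> N \<Longrightarrow> (\<And>z. z \<in> N \<Longrightarrow> E p z = E u z) \<Longrightarrow>
      u - p \<in> Z (j + 2) \<and> n (j + 2) (u - p) \<le> Creg * (hnorm ip (u - p) + n j F)"
    and reg_Re: "j + 2 \<le> m + 1 \<Longrightarrow> u \<in> H \<Longrightarrow> F \<in> Z j \<Longrightarrow>
      (\<And>v. v \<in> H \<Longrightarrow> (D u v + cnj (D v u)) / 2 = ip F v) \<Longrightarrow>
      p \<in> N \<Longrightarrow> (\<And>z. z \<in> N \<Longrightarrow> E p z = E u z) \<Longrightarrow>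
      u - p \<in> Z (j + 2) \<and> n (j + 2) (u - p) \<le> Creg * (hnorm ip (u - p) + n j F)"
    and reg_E: "1 \<le> j \<Longrightarrow> j \<le> m + 1 \<Longrightarrow> u \<in> Z j \<Longrightarrow> (\<And>v. E u v = ip G v) \<Longrightarrow>
      G \<in> Z j \<and> n j G \<le> Creg * n j u"
    and reg_N: "1 \<le> j \<Longrightarrow> j \<le> m + 1 \<Longrightarrow> z \<in> N \<Longrightarrow> F \<in> Z j \<Longrightarrow>
      (\<And>z'. z' \<in> N \<Longrightarrow> E z z' = ip F z') \<Longrightarrow>
      z \<in> Z j \<and> n j z \<le> Creg * (Creg * n j F + hnorm ip z)"
    and incl: "j \<le> m \<Longrightarrow> x \<in> Z (j + 1) \<Longrightarrow> x \<in> Z j \<and> n j x \<le> L * n (j + 1) x"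
begin

lemma n_zero: "j \<le> m + 1 \<Longrightarrow> n j 0 = 0"
  using n_scl[of j 0 0] V.subspace_0[OF Z_sub] by simp

lemma n_diff: "j \<le> m + 1 \<Longrightarrow> x \<in> Z j \<Longrightarrow> y \<in> Z j \<Longrightarrow> n j (x - y) \<le> n j x + n j y"
  using n_add[of j x "- y"] n_scl[of j y "-1"] V.subspace_neg[OF Z_sub, of j y]
  by (simp add: V.scl_minus_one)

lemma ip_repr: "\<exists>G. \<forall>v. E u v = ip G v"
proof -
  have "E u \<in> antidual scl UNIV nV"
    by (rule V.antidualI[where K = "nV u"]) (simp_all add: E_simps E_bound)
  from V.riesz_representation[OF this] obtain G where G: "\<forall>v\<in>UNIV. ip G v = E u v" by blast
  show ?thesis by (rule exI[of _ G]) (simp add: G)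
qed

lemma E_repr_reg:
  assumes "j \<le> m + 1" "u \<in> Z j" "\<And>v. E u v = ip G v"
  shows "G \<in> Z j \<and> n j G \<le> Creg * n j u"
proof (cases "j = 0")
  case True
  have "(nV G)\<^sup>2 = Re (E u G)" by (simp add: V.nrm_sq assms(3))
  also have "\<dots> \<le> nV u * nV G" using E_bound[of u G] complex_Re_le_cmod[of "E u G"] by linarith
  finally have "nV G * nV G \<le> nV u * nV G" by (simp add: power2_eq_square)
  then have "nV G \<le> nV u" using nV_ge_0[of G] nV_ge_0[of u]
    by (cases "nV G = 0") (auto simp: mult_le_cancel_right)
  also have "\<dots> \<le> Creg * nV u" using mult_right_mono[OF Creg, of "nV u"] by simp
  finally show ?thesis using True by (simp add: Z0)
next
  case False
  then show ?thesis using assms by (intro reg_E) auto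
qed

text \<open>
  From \<open>Re D (B x) = x - B x\<close> elliptic regularity for \<open>Re D\<close> yields two orders of regularity, first for
  the \<open>\<Pi>\<^sub>1\<close>-part of \<open>B x\<close>; as \<open>B x\<close> is orthogonal to the kernel, it is the orthogonal projection of this
  part onto the complement of the kernel, and the projection preserves the scale.
\<close>

lemma Bn_reg:
  assumes "perp x" "j \<le> k" "k \<le> m + 1"
  shows "(B ^^ k) x \<in> Z j \<and> n j ((B ^^ k) x) \<le> rho j * nV x"
  using assms(2,3)
proof (induction j arbitrary: k rule: rho.induct)
  have KK: "nV ((B ^^ k) x) \<le> K ^ (2 * (m+1)) * nV x" if "k \<le> m + 1" for k
  proof -
    have "nV ((B ^^ k) x) \<le> K ^ (2 * k) * nV x" by (rule nV_Bn)
    also have "\<dots> \<le> K ^ (2 * (m+1)) * nV x"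
      using that K by (intro mult_right_mono power_increasing) auto
    finally show ?thesis .
  qed
  {
    case 1
    then show ?case using KK[of k] by (simp add: Z0)
  next
    case 2
    then obtain k' where k': "k = Suc k'" by (cases k) auto
    have "nH (B ((B ^^ k') x)) \<le> K * nV ((B ^^ k') x)" by (rule nH_B)
    also have "\<dots> \<le> K * (K ^ (2 * (m+1)) * nV x)"
      using 2 k' K by (intro mult_left_mono KK) auto
    finally show ?case using B_H Z1 by (simp add: k' mult.assoc)
  next
    case (3 j)
    then obtain k' where k': "k = Suc k'" by (cases k) auto
    define y where "y = (B ^^ k) x"
    define F where "F = (B ^^ k') x - y"
    have yB: "y = B ((B ^^ k') x)" by (simp add: y_def k')
    have yH: "y \<in> H" unfolding yB by (rule B_H)
    have jm: "j \<le> m + 1" "j + 2 \<le> m + 1" using 3 by auto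
    have I1: "(B ^^ k') x \<in> Z j \<and> n j ((B ^^ k') x) \<le> rho j * nV x"
      by (rule 3) (use 3 k' in auto)
    have I2: "y \<in> Z j \<and> n j y \<le> rho j * nV x" unfolding y_def
      by (rule 3) (use 3 k' in auto)
    have F: "F \<in> Z j" "n j F \<le> 2 * rho j * nV x"
      using n_diff[OF jm(1) conjunct1[OF I1] conjunct1[OF I2]] V.subspace_diff[OF Z_sub[OF jm(1)]] I1 I2
      unfolding F_def by auto
    have "(D y v + cnj (D v y)) / 2 = ip F v" if v: "v \<in> H" for v
    proof -
      have "(D y v + cnj (D v y)) / 2 = a y v - ip y v" by (simp add: a_D[OF yH v])
      also have "a y v = ip ((B ^^ k') x) v" unfolding yB by (rule a_B[OF v])
      finally show ?thesis by (simp add: F_def ip_simps)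
    qed
    from reg_Re[OF jm(2) yH F(1) this pi0_N E_pi0]
    have r: "pi1 y \<in> Z (j+2)" "n (j+2) (pi1 y) \<le> Creg * (nV (pi1 y) + n j F)"
      by (auto simp: pi1_def)
    have "nV (pi1 y) \<le> 2 / \<alpha> * (K ^ (2 * (m+1)) * nV x)"
    proof -
      have "nV (pi1 y) \<le> 2 / \<alpha> * nV y" by (rule nV_pi1)
      also have "\<dots> \<le> 2 / \<alpha> * (K ^ (2 * (m+1)) * nV x)"
        unfolding y_def using \<alpha> 3 by (intro mult_left_mono KK) auto
      finally show ?thesis .
    qed
    then have "n (j+2) (pi1 y) \<le> Creg * (2 / \<alpha> * (K ^ (2 * (m+1)) * nV x) + 2 * rho j * nV x)"
      using r(2) F(2) Creg mult_left_mono[of "nV (pi1 y) + n j F" _ Creg] by (meson add_mono order_trans zero_le_one)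
    moreover have "y = pi1 y - orth_proj ip N (pi1 y)"
    proof -
      have "Q y = y" unfolding y_def by (rule Q_perp_id[OF Bn_perp[OF assms(1)]])
      moreover have "Q (pi1 y) + Q (pi0 y) = Q y" by (simp add: Q_add[symmetric] pi1_def)
      ultimately have "Q (pi1 y) = y" by (simp add: Q_N[OF pi0_N])
      then show ?thesis by (simp add: Q_def proj0_def)
    qed
    moreover have "orth_proj ip N (pi1 y) \<in> Z (j+2) \<and> n (j+2) (orth_proj ip N (pi1 y)) \<le> Creg * n (j+2) (pi1 y)"
      by (rule reg_proj) (use jm r in auto)
    ultimately have "y \<in> Z (j+2)" "n (j+2) y \<le> (1 + Creg) * (Creg * (2 / \<alpha> * (K ^ (2 * (m+1)) * nV x) + 2 * rho j * nV x))"
    proof -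
      assume b: "n (j+2) (pi1 y) \<le> Creg * (2 / \<alpha> * (K ^ (2 * (m+1)) * nV x) + 2 * rho j * nV x)"
        and e: "y = pi1 y - orth_proj ip N (pi1 y)"
        and p: "orth_proj ip N (pi1 y) \<in> Z (j+2) \<and> n (j+2) (orth_proj ip N (pi1 y)) \<le> Creg * n (j+2) (pi1 y)"
      have "pi1 y - orth_proj ip N (pi1 y) \<in> Z (j+2)"
        by (rule V.subspace_diff[OF Z_sub[OF jm(2)] r(1) conjunct1[OF p]])
      then show "y \<in> Z (j+2)" by (simp only: e[symmetric])
      have "n (j+2) (pi1 y - orth_proj ip N (pi1 y)) \<le> (1 + Creg) * n (j+2) (pi1 y)"
        using n_diff[OF jm(2) r(1) conjunct1[OF p]] p by (simp add: algebra_simps)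
      also have "\<dots> \<le> (1 + Creg) * (Creg * (2 / \<alpha> * (K ^ (2 * (m+1)) * nV x) + 2 * rho j * nV x))"
        using Creg by (intro mult_left_mono b) auto
      finally show "n (j+2) y \<le> (1 + Creg) * (Creg * (2 / \<alpha> * (K ^ (2 * (m+1)) * nV x) + 2 * rho j * nV x))"
        by (simp only: e[symmetric])
    qed
    then show ?case by (simp add: y_def[symmetric] algebra_simps)
  }
qed

lemma Phi_reg:
  assumes "j \<le> m + 1"
  shows "Phi v \<in> Z j \<and> n j (Phi v) \<le> cphi * nV (R v)"
proof -
  note b = Bn_reg[OF R_perp[of v] assms order_refl]
  have "Phi v \<in> Z j" unfolding Phi_def using b V.subspace_scale[OF Z_sub[OF assms]] by blast
  have "n j (Phi v) = lam * n j ((B ^^ (m+1)) (R v))"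
    unfolding Phi_def using n_scl[OF assms conjunct1[OF b], of "of_real lam"] lam_pos by simp
  also have "\<dots> \<le> lam * (rho j * nV (R v))" using b lam_pos by (intro mult_left_mono) auto
  also have "\<dots> \<le> lam * (rbar * nV (R v))"
    using lam_pos rho_le[OF assms] by (intro mult_left_mono mult_right_mono) auto
  finally show ?thesis using \<open>Phi v \<in> Z j\<close> by (simp add: cphi_def mult.assoc)
qed

text \<open>
  Rewritten as \<open>D u = F + E u\<close>, the equation makes the \<open>\<Pi>\<^sub>1\<close>-part of \<open>u\<close> two orders smoother than \<open>u\<close> and \<open>F\<close>.
  There is no such gain for the kernel part, whose regularity has to be assumed.
\<close>

lemma bootstrap:
  assumes u: "u \<in> H" and F: "\<And>v. v \<in> H \<Longrightarrow> P u v = ip F v" and b: "nH u \<le> b"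
    and ker: "\<And>j. 2 \<le> j \<Longrightarrow> j \<le> m + 1 \<Longrightarrow> pi0 u \<in> Z j \<and> n j (pi0 u) \<le> b"
    and Fj: "\<And>j. j + 2 \<le> m + 1 \<Longrightarrow> F \<in> Z j \<and> n j F \<le> b"
    and "j \<le> m + 1"
  shows "u \<in> Z j \<and> n j u \<le> sig j * b"
  using assms(6)
proof (induction j rule: sig.induct)
  have nVu: "nV u \<le> K * b"
  proof -
    have "nV u \<le> K * nH u" by (rule embed[OF u])
    also have "\<dots> \<le> K * b" using b K by (intro mult_left_mono) auto
    finally show ?thesis .
  qed
  {
    case 1
    then show ?case using nVu by (simp add: Z0)
  next
    case 2
    then show ?case using u b Z1 by simp
  next
    case (3 j)
    have jm: "j \<le> m + 1" "j + 2 \<le> m + 1" using 3 by auto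
    have IH: "u \<in> Z j \<and> n j u \<le> sig j * b" using 3 by auto
    obtain G where G: "\<And>v. E u v = ip G v" using ip_repr[of u] by blast
    have Gj: "G \<in> Z j" "n j G \<le> Creg * n j u" using E_repr_reg[OF jm(1) conjunct1[OF IH] G] by auto
    have FG: "F + G \<in> Z j" "n j (F + G) \<le> b + Creg * (sig j * b)"
    proof -
      show "F + G \<in> Z j" using Fj[OF jm(2)] Gj V.subspace_add[OF Z_sub[OF jm(1)]] by blast
      have "Creg * n j u \<le> Creg * (sig j * b)" using IH Creg by (intro mult_left_mono) auto
      then show "n j (F + G) \<le> b + Creg * (sig j * b)"
        using n_add[OF jm(1) conjunct1[OF Fj[OF jm(2)]] Gj(1)] Fj[OF jm(2)] Gj(2) by linarith
    qed
    have "D u v = ip (F + G) v" if "v \<in> H" for v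
      using F[OF that] by (simp add: P_def G ip_simps algebra_simps)
    from reg_D[OF jm(2) u FG(1) this pi0_N E_pi0]
    have r: "pi1 u \<in> Z (j+2)" "n (j+2) (pi1 u) \<le> Creg * (nV (pi1 u) + n j (F + G))"
      by (auto simp: pi1_def)
    have "nV (pi1 u) \<le> 2 / \<alpha> * (K * b)"
    proof -
      have "nV (pi1 u) \<le> 2 / \<alpha> * nV u" by (rule nV_pi1)
      also have "\<dots> \<le> 2 / \<alpha> * (K * b)" using \<alpha> by (intro mult_left_mono nVu) auto
      finally show ?thesis .
    qed
    then have "nV (pi1 u) + n j (F + G) \<le> 2 / \<alpha> * (K * b) + (b + Creg * (sig j * b))"
      using FG(2) by linarith
    then have "n (j+2) (pi1 u) \<le> Creg * (2 / \<alpha> * (K * b) + (b + Creg * (sig j * b)))"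
      using r(2) Creg by (meson mult_left_mono order_trans zero_le_one)
    moreover have k: "pi0 u \<in> Z (j+2) \<and> n (j+2) (pi0 u) \<le> b" by (rule ker) (use jm in auto)
    moreover have "u = pi0 u + pi1 u" by (simp add: pi1_def)
    moreover have "n (j+2) (pi0 u + pi1 u) \<le> n (j+2) (pi0 u) + n (j+2) (pi1 u)"
      by (rule n_add[OF jm(2) conjunct1[OF k] r(1)])
    moreover have "pi0 u + pi1 u \<in> Z (j+2)"
      by (rule V.subspace_add[OF Z_sub[OF jm(2)] conjunct1[OF k] r(1)])
    ultimately have "u \<in> Z (j+2)" "n (j+2) u \<le> b + Creg * (2 / \<alpha> * (K * b) + (b + Creg * (sig j * b)))"
      by simp_all
    then show ?case by (simp add: algebra_simps)
  }
qed

text \<open>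
  By discrete stability of \<open>Ps = P + S\<close> the error \<open>e\<close> is bounded by the approximation error plus \<open>S e\<close>, that
  is, by \<open>s = \<parallel>R e\<parallel>\<^sub>V\<close>. For \<open>s\<close> one solves the dual problem with the smooth datum \<open>Phi e\<close>, which has a solution
  in \<open>Z (m+1)\<close> whose norm is at most a multiple of \<open>(1 + M) s\<close>. This leads to
  \<open>lam s\<^sup>2 \<le> c1 \<eta> (1 + M) s \<parallel>u - xh\<parallel> + c2 \<eta>\<^sup>2 (1 + M) s\<^sup>2\<close>, where the second factor \<open>\<eta>\<close> in the last term stems
  from a duality argument for \<open>Ps\<close>; the smallness assumption absorbs this term.
\<close>

theorem galerkin_error:
  assumes adj: "regular K \<alpha> Cd Creg L m scl ip H N a (op_adj D) (op_adj E) Z n"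
    and X: "hilbert_space scl X a" and XH: "X \<subseteq> H"
    and div: "div_stable nV nH N E X" and div': "div_stable nV nH N (op_adj E) X"
    and \<eta>: "0 \<le> \<eta>" and M: "0 \<le> M"
    and approx: "\<And>x. x \<in> Z (m+1) \<Longrightarrow> \<exists>x'\<in>X. nH (x - x') \<le> \<eta> * n (m+1) x"
    and dual: "\<And>g. perp g \<Longrightarrow> \<exists>w\<in>H. (\<forall>v\<in>H. P v w = ip v g) \<and> nV w \<le> M * nV g"
    and small: "2 * c2 * (\<eta>\<^sup>2 * (1 + M)) \<le> lam"
    and u: "u \<in> H" and uh: "uh \<in> X" and gal: "\<And>v. v \<in> X \<Longrightarrow> P (u - uh) v = 0" and xh: "xh \<in> X"
  shows "nH (u - uh) \<le> Cerr * (1 + \<eta> * (1 + M)) * nH (u - xh)"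
proof -
  interpret adj: regular K \<alpha> Cd Creg L m scl ip H N a "op_adj D" "op_adj E" Z n by (rule adj)
  interpret X: hilbert_space scl X a by fact
  define e where "e = u - uh"
  define s where "s = nV (R e)"
  define g where "g = Phi e"
  define \<delta> where "\<delta> = nH (u - xh)"
  have inH: "uh \<in> H" "xh \<in> H" using uh xh XH by auto
  have eH: "e \<in> H" unfolding e_def by (rule H.X_diff[OF u inH(1)])
  have dH: "u - xh \<in> H" by (rule H.X_diff[OF u inH(2)])
  have s0: "0 \<le> s" by (simp add: s_def)
  have \<delta>0: "0 \<le> \<delta>" unfolding \<delta>_def by (rule H.nrm_ge_0[OF dH])
  have m1: "j \<le> m + 1 \<Longrightarrow> g \<in> Z j \<and> n j g \<le> cphi * s" for j
    unfolding g_def s_def by (rule Phi_reg)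
  have gV: "nV g \<le> cphi * s" using m1[of 0] by (simp add: Z0)
  have gperp: "perp g" unfolding g_def by (rule Phi_perp)
  have sq: "ip e g = of_real (lam * s\<^sup>2)"
  proof -
    have "ip e g = cnj (ip g e)" by (rule V.herm) auto
    also have "ip g e = S e e" by (simp add: S_Phi g_def)
    finally show ?thesis by (simp add: S_self s_def)
  qed
  \<comment> \<open>The data of the dual problem are smoothed, so its solution has full regularity, and pairing it
    with \<open>e\<close> gives the quantity \<open>s\<^sup>2\<close> to be estimated.\<close>
  obtain w where w: "w \<in> H" "\<And>v. v \<in> H \<Longrightarrow> P v w = ip v g" "nV w \<le> M * nV g" using dual[OF gperp] by blast
  have adjP: "adj.P w v = ip g v" if "v \<in> H" for v
  proof -
    have "adj.P w v = cnj (P v w)" unfolding adjoint_P by (simp only: op_adj_def)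
    also have "\<dots> = cnj (ip v g)" by (simp only: w(2)[OF that])
    also have "\<dots> = ip g v" by (rule V.herm[symmetric]) auto
    finally show ?thesis .
  qed
  have w0: "adj.pi0 w = 0"
  proof (rule adj.pi0_eq_0)
    fix z assume z: "z \<in> N"
    have "- E z w = P z w" by (rule P_N(1)[OF z w(1), symmetric])
    also have "\<dots> = ip z g" using z N_sub by (intro w(2)) auto
    also have "\<dots> = cnj (ip g z)" by (rule V.herm) auto
    also have "ip g z = 0" using gperp z unfolding perp_def by blast
    finally show "op_adj E w z = 0" by (simp add: op_adj_def)
  qed
  define bw where "bw = 2 * cphi * (1 + M) * s"
  have bw: "cphi * s \<le> bw" "nH w \<le> bw"
  proof -
    have cs: "0 \<le> cphi * s" using cphi_ge_0 s0 by simp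
    have "1 * (cphi * s) \<le> 2 * (1 + M) * (cphi * s)" using M cs by (intro mult_right_mono) auto
    then show "cphi * s \<le> bw" by (simp add: bw_def algebra_simps)
    have "Re (P w w) \<le> nV w * nV g"
      using V_cs[of w g] complex_Re_le_cmod[of "ip w g"] by (simp add: w(2)[OF w(1)])
    then have "(nH w)\<^sup>2 \<le> nV w * nV g + 2 * (nV w)\<^sup>2" using Re_P[OF w(1)] by linarith
    also have "nV w * nV g + 2 * (nV w)\<^sup>2 \<le> (nV g + 2 * nV w)\<^sup>2"
    proof -
      have "0 \<le> nV w * nV g" "0 \<le> (nV g)\<^sup>2" "0 \<le> (nV w)\<^sup>2" by simp_all
      then show ?thesis by (simp add: power2_sum power_mult_distrib algebra_simps)
    qed
    finally have "nH w \<le> nV g + 2 * nV w" by (rule power2_le_imp_le) simp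
    also have "\<dots> \<le> nV g + 2 * (M * nV g)" using w(3) by simp
    also have "\<dots> = (1 + 2 * M) * nV g" by (simp add: algebra_simps)
    also have "\<dots> \<le> (2 * (1 + M)) * (cphi * s)" using M gV by (intro mult_mono) auto
    finally show "nH w \<le> bw" by (simp add: bw_def algebra_simps)
  qed
  have wreg: "w \<in> Z (m+1) \<and> n (m+1) w \<le> sig (m+1) * bw"
  proof (rule adj.bootstrap[OF w(1) adjP bw(2)])
    show "adj.pi0 w \<in> Z j \<and> n j (adj.pi0 w) \<le> bw" if "j \<le> m + 1" for j
      unfolding w0 using that V.subspace_0[OF Z_sub[OF that]] n_zero[OF that] bw(2) H.nrm_ge_0[OF w(1)] by simp
    show "g \<in> Z j \<and> n j g \<le> bw" if "j + 2 \<le> m + 1" for j using m1[of j] that bw(1) by auto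
  qed simp_all
  \<comment> \<open>Approximate \<open>w\<close> by its Galerkin projection for the adjoint of the stable form \<open>Ps\<close>, not by the best
    approximation: the error is then orthogonal to \<open>X\<close> for \<open>Ps\<close>, which allows any \<open>xh\<close> in place
    of \<open>uh\<close> below and a second duality step.\<close>
  obtain wh where wh: "wh \<in> X" "\<And>v. v \<in> X \<Longrightarrow> Ps v wh = Ps v w"
  proof -
    have sPs: "sesquilinear_on scl H (op_adj Ps)" by (rule V.sesquilinear_op_adj[OF Ps_sesq])
    have "op_adj Ps w \<in> antidual scl X nH"
    proof (rule X.antidualI[where K = "CPs * nH w"])
      show "cmod (op_adj Ps w v) \<le> CPs * nH w * nH v" if "v \<in> X" for v
        using Ps_bound[of v w] that w(1) XH by (simp add: op_adj_def algebra_simps subset_iff)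
    qed (use XH w(1) in \<open>auto simp: subset_iff V.sesq_add[OF sPs] V.sesq_scl[OF sPs]\<close>)
    then have "\<exists>x\<in>X. \<forall>v\<in>X. adj.Ps x v = op_adj Ps w v"
      using div div' by (intro adj.Ps_solvable[OF X XH]) simp_all
    then obtain x where x: "x \<in> X" "\<forall>v\<in>X. op_adj Ps x v = op_adj Ps w v"
      unfolding adjoint_Ps by blast
    show ?thesis by (rule that[OF x(1)]) (use x(2) in \<open>simp add: op_adj_def\<close>)
  qed
  have whH: "wh \<in> H" using wh(1) XH by auto
  have wwH: "w - wh \<in> H" by (rule H.X_diff[OF w(1) whH])
  have orth: "Ps v (w - wh) = 0" if "v \<in> X" for v
    using wh(2)[OF that] that XH w(1) whH by (simp add: V.sesq_diff[OF Ps_sesq H.subspaceX] subset_iff)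
  define q where "q = \<eta> * (1 + M) * s"
  have quasi: "nH (w - wh) \<le> cw * q"
  proof -
    obtain x' where x': "x' \<in> X" "nH (w - x') \<le> \<eta> * n (m+1) w" using approx wreg by blast
    have x'H: "x' \<in> H" using x' XH by auto
    have d: "x' - wh \<in> X" by (rule X.X_diff[OF x'(1) wh(1)])
    have b: "nH (x' - wh) \<le> Cstab * (CPs * nH (w - x'))"
    proof (rule inf_supD[OF adjoint_Ps_inf_sup[OF X XH div'] d])
      show "0 \<le> CPs * nH (w - x')" using CPs_ge_0 H.nrm_ge_0[OF H.X_diff[OF w(1) x'H]] by simp
      fix v assume v: "v \<in> X"
      then have vH: "v \<in> H" using XH by auto
      have "Ps v (x' - wh) = Ps v (x' - w)"
        using wh(2)[OF v] vH x'H whH w(1) by (simp add: V.sesq_diff[OF Ps_sesq H.subspaceX])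
      then have "cmod (op_adj Ps (x' - wh) v) = cmod (Ps v (x' - w))" by (simp add: op_adj_def)
      also have "\<dots> \<le> CPs * nH v * nH (x' - w)" by (rule Ps_bound[OF vH H.X_diff[OF x'H w(1)]])
      finally show "cmod (op_adj Ps (x' - wh) v) \<le> CPs * nH (w - x') * nH v"
        using H.nrm_minus_commute[OF x'H w(1)] by (simp add: algebra_simps)
    qed
    have "nH (w - wh) \<le> nH (w - x') + nH (x' - wh)"
      using H.nrm_triangle[OF H.X_diff[OF w(1) x'H] H.X_diff[OF x'H whH]] by simp
    also have "\<dots> \<le> (1 + Cstab * CPs) * nH (w - x')" using b by (simp add: algebra_simps)
    also have "\<dots> \<le> (1 + Cstab * CPs) * (\<eta> * (sig (m+1) * bw))"
    proof (rule mult_left_mono)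
      show "nH (w - x') \<le> \<eta> * (sig (m+1) * bw)"
        using x'(2) mult_left_mono[OF conjunct2[OF wreg] \<eta>] by linarith
    qed (use Cstab_ge_0 CPs_ge_0 in simp)
    also have "\<dots> = cw * q" by (simp add: cw_def q_def bw_def algebra_simps)
    finally show ?thesis .
  qed
  \<comment> \<open>The second duality step: \<open>ip g\<close> is represented by the stable form applied to a regular \<open>y\<close>.\<close>
  obtain y where y: "y \<in> H" "\<And>v. v \<in> H \<Longrightarrow> Ps y v = ip g v"
    using Ps_solvable[OF H.hilbert_space_axioms order_refl div_stable_H adj.div_stable_H ip_antidual_H[of g]] by blast
  have y0: "pi0 y = 0"
  proof (rule pi0_eq_0)
    fix z assume z: "z \<in> N"
    have "- E y z = Ps y z" by (rule Ps_N(2)[OF z y(1), symmetric])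
    also have "\<dots> = ip g z" using z N_sub by (intro y(2)) auto
    also have "\<dots> = 0" using gperp z unfolding perp_def by blast
    finally show "E y z = 0" by simp
  qed
  have nHy: "nH y \<le> Cstab * (K * cphi) * s"
  proof -
    have "nH y \<le> Cstab * (K * nV g)"
    proof (rule inf_supD[OF Ps_inf_sup[OF H.hilbert_space_axioms order_refl div_stable_H] y(1)])
      fix v assume v: "v \<in> H"
      have "cmod (Ps y v) \<le> nV g * nV v" unfolding y(2)[OF v] by (rule V_cs)
      also have "\<dots> \<le> nV g * (K * nH v)" by (rule mult_left_mono[OF embed[OF v]]) simp
      finally show "cmod (Ps y v) \<le> K * nV g * nH v" by (simp add: algebra_simps)
    qed (use K in simp)
    also have "\<dots> \<le> Cstab * (K * (cphi * s))" using Cstab_ge_0 K gV by (intro mult_left_mono) auto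
    finally show ?thesis by (simp add: mult.assoc)
  qed
  define by0 where "by0 = cphi * K ^ (2 * (m+1)) * K"
  have by0: "0 \<le> by0" using cphi_ge_0 K by (simp add: by0_def)
  have cy: "cy = cphi + (by0 + 1) * (Cstab * (K * cphi))" by (simp add: cy_def by0_def)
  have ck: "0 \<le> Cstab * (K * cphi) * s" using Cstab_ge_0 K cphi_ge_0 s0 by simp
  have yreg: "y \<in> Z (m+1) \<and> n (m+1) y \<le> sig (m+1) * (cy * s)"
  proof (rule bootstrap[OF y(1)])
    show "P y v = ip (g - Phi y) v" if "v \<in> H" for v
      using y(2)[OF that] by (simp add: Ps_def S_Phi ip_simps algebra_simps)
    have "0 \<le> by0 * (Cstab * (K * cphi) * s)" "0 \<le> cphi * s" using by0 ck cphi_ge_0 s0 by simp_all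
    then show nb: "nH y \<le> cy * s" using nHy by (simp add: cy algebra_simps)
    show "pi0 y \<in> Z j \<and> n j (pi0 y) \<le> cy * s" if "j \<le> m + 1" for j
      unfolding y0 using that V.subspace_0[OF Z_sub[OF that]] n_zero[OF that] nb H.nrm_ge_0[OF y(1)] by simp
    show "g - Phi y \<in> Z j \<and> n j (g - Phi y) \<le> cy * s" if "j + 2 \<le> m + 1" for j
    proof -
      have j: "j \<le> m + 1" using that by simp
      note gj = m1[OF j] and pj = Phi_reg[OF j, of y]
      have "nV (R y) \<le> K ^ (2 * (m+1)) * (K * nH y)"
      proof -
        have "K ^ (2 * (m+1)) * nV y \<le> K ^ (2 * (m+1)) * (K * nH y)"
          using K by (intro mult_left_mono embed[OF y(1)]) simp
        then show ?thesis using nV_R[of y] by linarith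
      qed
      then have "cphi * nV (R y) \<le> cphi * (K ^ (2 * (m+1)) * (K * nH y))"
        using cphi_ge_0 by (intro mult_left_mono)
      also have "\<dots> = by0 * nH y" by (simp add: by0_def algebra_simps)
      also have "\<dots> \<le> by0 * (Cstab * (K * cphi) * s)" by (rule mult_left_mono[OF nHy by0])
      finally have "n j (g - Phi y) \<le> cphi * s + by0 * (Cstab * (K * cphi) * s)"
        using n_diff[OF j conjunct1[OF gj] conjunct1[OF pj]] gj pj by linarith
      also have "\<dots> \<le> cy * s" using ck by (simp add: cy algebra_simps)
      finally show ?thesis
        using V.subspace_diff[OF Z_sub[OF j] conjunct1[OF gj] conjunct1[OF pj]] by blast
    qed
  qed simp_all
  \<comment> \<open>Galerkin orthogonality for \<open>P\<close> removes \<open>wh\<close>, that of \<open>wh\<close> for \<open>Ps\<close> trades \<open>e\<close> for \<open>u - xh\<close>.\<close>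
  have "of_real (lam * s\<^sup>2) = P e (w - wh)"
  proof -
    have "P e wh = 0" using gal[OF wh(1)] by (simp add: e_def)
    moreover have "P e w = ip e g" by (rule w(2)[OF eH])
    ultimately show ?thesis
      using eH w(1) whH by (simp add: V.sesq_diff[OF P_sesq H.subspaceX] sq)
  qed
  also have "\<dots> = Ps e (w - wh) - ip g (w - wh)" by (simp add: Ps_def S_Phi g_def)
  also have "ip g (w - wh) = Ps y (w - wh)" by (rule y(2)[OF wwH, symmetric])
  also have "Ps e (w - wh) = Ps (u - xh) (w - wh)"
  proof -
    have "e = (u - xh) - (uh - xh)" by (simp add: e_def)
    then have "Ps e (w - wh) = Ps (u - xh) (w - wh) - Ps (uh - xh) (w - wh)"
      using V.sesq_diff(1)[OF Ps_sesq H.subspaceX dH H.X_diff[OF inH] wwH] by simp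
    then show ?thesis using orth[OF X.X_diff[OF uh xh]] by simp
  qed
  finally have id: "of_real (lam * s\<^sup>2) = Ps (u - xh) (w - wh) - Ps y (w - wh)" .
  have T1: "cmod (Ps (u - xh) (w - wh)) \<le> c1 * \<delta> * q"
  proof -
    have "cmod (Ps (u - xh) (w - wh)) \<le> CPs * \<delta> * nH (w - wh)" unfolding \<delta>_def by (rule Ps_bound[OF dH wwH])
    also have "\<dots> \<le> CPs * \<delta> * (cw * q)" using CPs_ge_0 \<delta>0 by (intro mult_left_mono quasi) auto
    finally show ?thesis by (simp add: c1_def algebra_simps)
  qed
  have T2: "cmod (Ps y (w - wh)) \<le> c2 * (\<eta>\<^sup>2 * (1 + M)) * s\<^sup>2"
  proof -
    obtain yh where yh: "yh \<in> X" "nH (y - yh) \<le> \<eta> * n (m+1) y" using approx yreg by blast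
    have yhH: "yh \<in> H" using yh XH by auto
    have "Ps y (w - wh) = Ps (y - yh) (w - wh)"
      using orth[OF yh(1)] y(1) yhH wwH by (simp add: V.sesq_diff[OF Ps_sesq H.subspaceX])
    then have "cmod (Ps y (w - wh)) \<le> CPs * nH (y - yh) * nH (w - wh)"
      using Ps_bound[OF H.X_diff[OF y(1) yhH] wwH] by simp
    also have "\<dots> \<le> CPs * (\<eta> * (sig (m+1) * (cy * s))) * (cw * q)"
    proof -
      have "nH (y - yh) \<le> \<eta> * (sig (m+1) * (cy * s))"
        using yh(2) mult_left_mono[OF conjunct2[OF yreg] \<eta>] by linarith
      then show ?thesis
        using CPs_ge_0 quasi H.nrm_ge_0[OF wwH] H.nrm_ge_0[OF H.X_diff[OF y(1) yhH]] \<eta> sig_ge_0 cy_ge_0 s0 by (intro mult_mono mult_nonneg_nonneg) auto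
    qed
    also have "\<dots> = c2 * (\<eta>\<^sup>2 * (1 + M)) * s\<^sup>2"
      by (simp add: c2_def q_def power2_eq_square algebra_simps)
    finally show ?thesis .
  qed
  have "lam * s\<^sup>2 = cmod (of_real (lam * s\<^sup>2))" using lam_pos by (simp add: norm_mult norm_power)
  also have "\<dots> \<le> c1 * \<delta> * q + c2 * (\<eta>\<^sup>2 * (1 + M)) * s\<^sup>2"
    unfolding id using norm_triangle_ineq4[of "Ps (u - xh) (w - wh)" "Ps y (w - wh)"] T1 T2 by linarith
  finally have "lam * s\<^sup>2 \<le> c1 * \<delta> * q + c2 * (\<eta>\<^sup>2 * (1 + M)) * s\<^sup>2" .
  moreover have "2 * (c2 * (\<eta>\<^sup>2 * (1 + M)) * s\<^sup>2) \<le> lam * s\<^sup>2"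
    using mult_right_mono[OF small, of "s\<^sup>2"] by (simp add: algebra_simps)
  ultimately have "lam * s\<^sup>2 \<le> 2 * (c1 * \<delta> * q)" by linarith
  then have "(lam * s) * s \<le> (2 * c1 * (\<eta> * (1 + M)) * \<delta>) * s"
    by (simp add: q_def power2_eq_square algebra_simps)
  moreover have r0: "0 \<le> 2 * c1 * (\<eta> * (1 + M)) * \<delta>" using c1_ge_0 \<eta> M \<delta>0 by simp
  ultimately have "lam * s \<le> 2 * c1 * (\<eta> * (1 + M)) * \<delta>"
    using s0 by (cases "s = 0") (auto simp: mult_le_cancel_right)
  then have s_le: "s \<le> 2 * c1 / lam * (\<eta> * (1 + M)) * \<delta>"
    using lam_pos by (simp add: le_divide_eq mult.commute)
  \<comment> \<open>On \<open>X\<close>, the stable form of \<open>xh - uh\<close> consists of the approximation error and of \<open>S e\<close>, which is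
    controlled by \<open>s\<close>.\<close>
  have "nH (xh - uh) \<le> Cstab * (CPs * \<delta> + K * nV g)"
  proof (rule inf_supD[OF Ps_inf_sup[OF X XH div] X.X_diff[OF xh uh]])
    show "0 \<le> CPs * \<delta> + K * nV g" using CPs_ge_0 \<delta>0 K by simp
    fix v assume v: "v \<in> X"
    then have vH: "v \<in> H" using XH by auto
    have split: "xh - uh = (xh - u) + e" by (simp add: e_def)
    have "Ps (xh - uh) v = Ps (xh - u) v + Ps e v"
      unfolding split by (rule V.sesq_add(1)[OF Ps_sesq H.X_diff[OF inH(2) u] eH vH])
    also have "Ps e v = ip g v" using gal[OF v] by (simp add: Ps_def S_Phi g_def e_def)
    finally have "cmod (Ps (xh - uh) v) \<le> cmod (Ps (xh - u) v) + cmod (ip g v)"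
      by (simp add: norm_triangle_ineq)
    also have "\<dots> \<le> CPs * nH (xh - u) * nH v + nV g * nV v"
      using Ps_bound[OF H.X_diff[OF inH(2) u] vH] V_cs[of g v] by linarith
    also have "\<dots> \<le> CPs * \<delta> * nH v + nV g * (K * nH v)"
      unfolding \<delta>_def H.nrm_minus_commute[OF inH(2) u]
      by (intro add_left_mono mult_left_mono embed[OF vH]) simp
    finally show "cmod (Ps (xh - uh) v) \<le> (CPs * \<delta> + K * nV g) * nH v" by (simp add: algebra_simps)
  qed
  also have "\<dots> \<le> Cstab * (CPs * \<delta> + K * (cphi * s))"
    using Cstab_ge_0 K gV by (intro mult_left_mono add_left_mono) auto
  also have "\<dots> = Cstab * CPs * \<delta> + Cstab * (K * cphi) * s" by (simp add: algebra_simps)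
  also have "\<dots> \<le> Cstab * CPs * \<delta> + Cstab * (K * cphi) * (2 * c1 / lam * (\<eta> * (1 + M)) * \<delta>)"
    using Cstab_ge_0 K cphi_ge_0 s_le by (intro mult_left_mono add_left_mono) auto
  finally have fin: "nH (xh - uh) \<le> Cstab * CPs * \<delta> + Cstab * (K * cphi) * (2 * c1 / lam) * ((\<eta> * (1 + M)) * \<delta>)"
    by (simp add: algebra_simps)
  define A where "A = 1 + Cstab * CPs"
  define A' where "A' = Cstab * (K * cphi) * (2 * c1 / lam)"
  have A: "0 \<le> A" "0 \<le> A'" using Cstab_ge_0 CPs_ge_0 K cphi_ge_0 c1_ge_0 lam_pos by (simp_all add: A_def A'_def)
  define t where "t = \<eta> * (1 + M)"
  have t: "0 \<le> t" using \<eta> M by (simp add: t_def)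
  have "nH e \<le> nH (u - xh) + nH (xh - uh)"
    using H.nrm_triangle[OF dH H.X_diff[OF inH(2,1)]] by (simp add: e_def)
  also have "\<dots> \<le> A * \<delta> + A' * (t * \<delta>)" using fin by (simp add: \<delta>_def A_def A'_def t_def algebra_simps)
  also have "\<dots> \<le> (A + A') * (1 + t) * \<delta>"
  proof -
    have "0 \<le> A * (t * \<delta>)" "0 \<le> A' * \<delta>" using A t \<delta>0 by simp_all
    then show ?thesis by (simp add: algebra_simps)
  qed
  also have "A + A' = Cerr" by (simp add: A_def A'_def Cerr_def)
  finally show ?thesis by (simp add: e_def t_def \<delta>_def)
qed

end

section \<open>Well-posedness and oscillating data\<close>

context constants
begin

text \<open>
  The threshold accommodates the primal and the dual problem, whose solution operator may have a norm larger by the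
  factor \<open>2 / \<alpha>\<close>; the minimum with \<open>1/4\<close> yields stability on divergence-free vectors.
\<close>

definition "csmall = min (1/4) (lam * \<alpha> / (4 * (c2 + 1)))"
definition "cdata = Creg * (Creg * L ^ (m+1) + K / \<alpha>) + L ^ (m+1)"

text \<open>
  Under either condition on oscillating data the norms of the datum are at most this multiple of \<open>\<parallel>u\<parallel>\<^sub>H\<close>.
\<close>

definition "cb Cosc CPi = 1 + Cosc * CP + L ^ (m+1) * (Cosc * CP) + CPi * (Cosc * CP)"

lemma csmall_pos: "0 < csmall"
  using lam_pos \<alpha> c2_ge_0 by (simp add: csmall_def)

lemma cdata_ge: "1 \<le> cdata" "L ^ (m+1) \<le> cdata" "Creg * (Creg * L ^ (m+1) + K / \<alpha>) \<le> cdata"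
proof -
  have p: "1 \<le> L ^ (m+1)" using L by (rule one_le_power)
  then have "0 \<le> Creg * (Creg * L ^ (m+1) + K / \<alpha>)" using Creg K \<alpha> by simp
  then show "1 \<le> cdata" "L ^ (m+1) \<le> cdata" "Creg * (Creg * L ^ (m+1) + K / \<alpha>) \<le> cdata"
    using p unfolding cdata_def by linarith+
qed

lemma small_imp:
  assumes "0 \<le> M" "\<eta>\<^sup>2 * (1 + M) \<le> csmall"
  shows "2 * c2 * (\<eta>\<^sup>2 * (1 + M)) \<le> lam" "2 * c2 * (\<eta>\<^sup>2 * (1 + 2 / \<alpha> * M)) \<le> lam"
proof -
  define x where "x = \<eta>\<^sup>2 * (1 + M)"
  have x0: "0 \<le> x" using assms(1) by (simp add: x_def)
  have "x \<le> lam * \<alpha> / (4 * (c2 + 1))" using assms(2) by (simp add: x_def csmall_def)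
  then have "x * (4 * (c2 + 1)) \<le> lam * \<alpha>" using c2_ge_0 by (simp add: le_divide_eq)
  moreover have "x * (4 * c2) \<le> x * (4 * (c2 + 1))" using x0 by (intro mult_left_mono) auto
  ultimately have "4 * c2 * x \<le> lam * \<alpha>" by (simp add: algebra_simps)
  then have key: "2 * c2 * (2 / \<alpha> * x) \<le> lam" using \<alpha> by (simp add: field_simps)
  have "1 + 2 / \<alpha> * M \<le> 2 / \<alpha> * (1 + M)" using \<alpha> by (simp add: field_simps)
  then have "\<eta>\<^sup>2 * (1 + 2 / \<alpha> * M) \<le> 2 / \<alpha> * x"
    using mult_left_mono[of "1 + 2 / \<alpha> * M" "2 / \<alpha> * (1 + M)" "\<eta>\<^sup>2"]
    by (simp only: x_def mult.left_commute zero_le_power2)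
  then have "2 * c2 * (\<eta>\<^sup>2 * (1 + 2 / \<alpha> * M)) \<le> 2 * c2 * (2 / \<alpha> * x)"
    using c2_ge_0 by (intro mult_left_mono) auto
  then show "2 * c2 * (\<eta>\<^sup>2 * (1 + 2 / \<alpha> * M)) \<le> lam" using key by linarith
  have "1 \<le> 2 / \<alpha>" using \<alpha> by (simp add: le_divide_eq)
  then have "x \<le> 2 / \<alpha> * x" using mult_right_mono[of 1 "2 / \<alpha>" x] x0 by simp
  then have "2 * c2 * x \<le> 2 * c2 * (2 / \<alpha> * x)" using c2_ge_0 by (intro mult_left_mono) auto
  then show "2 * c2 * (\<eta>\<^sup>2 * (1 + M)) \<le> lam" using key by (simp add: x_def)
qed

end

context regular
begin

text \<open>
  By duality \<open>M\<close> bounds the part of the primal solution \<open>w\<close> that is orthogonal to the kernel. As the datum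
  \<open>g\<close> is orthogonal to the kernel, \<open>w\<close> lies in the range of \<open>\<Pi>\<^sub>1\<close>, where this part controls the whole
  vector. Hence the error estimate applies to the adjoint problem too, at the cost of a constant.
\<close>

lemma adjoint_dual:
  assumes dual: "\<And>g. perp g \<Longrightarrow> \<exists>w\<in>H. (\<forall>v\<in>H. P v w = ip v g) \<and> nV w \<le> M * nV g"
    and surj: "\<And>f. f \<in> antidual scl H nH \<Longrightarrow> \<exists>u\<in>H. \<forall>v\<in>H. P u v = f v"
    and g: "perp g"
  shows "\<exists>w\<in>H. (\<forall>v\<in>H. op_adj P v w = ip v g) \<and> nV w \<le> (2 / \<alpha> * M) * nV g"
proof -
  obtain u where u: "u \<in> H" "\<And>v. v \<in> H \<Longrightarrow> P u v = ip g v" using surj[OF ip_antidual_H[of g]] by blast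
  have "pi0 u = 0"
  proof (rule pi0_eq_0)
    fix z assume z: "z \<in> N"
    have "- E u z = P u z" by (rule P_N(2)[OF z u(1), symmetric])
    also have "\<dots> = ip g z" using z N_sub by (intro u(2)) auto
    also have "\<dots> = 0" using g z unfolding perp_def by blast
    finally show "E u z = 0" by simp
  qed
  then have le: "nV u \<le> 2 / \<alpha> * nV (Q u)" using nV_pi1_Q[of u] by (simp add: pi1_def)
  obtain w where w: "w \<in> H" "\<And>v. v \<in> H \<Longrightarrow> P v w = ip v (Q u)" "nV w \<le> M * nV (Q u)"
    using dual[OF Q_perp[of u]] by blast
  have "(nV (Q u))\<^sup>2 = Re (ip (Q u) u)"
    using perp_ip_Q[OF Q_perp[of u], of u] by (simp add: V.nrm_sq)
  also have "\<dots> \<le> cmod (ip (Q u) u)" by (rule complex_Re_le_cmod)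
  also have "\<dots> = cmod (ip u (Q u))" using V.herm[of u "Q u"] by simp
  also have "\<dots> = cmod (ip g w)" using w(2)[OF u(1)] u(2)[OF w(1)] by simp
  also have "\<dots> \<le> nV g * nV w" by (rule V_cs)
  also have "\<dots> \<le> nV g * (M * nV (Q u))" by (rule mult_left_mono[OF w(3)]) simp
  finally have sq: "nV (Q u) * nV (Q u) \<le> (M * nV g) * nV (Q u)" by (simp add: power2_eq_square algebra_simps)
  have "0 \<le> M * nV g"
  proof -
    obtain w' where "nV w' \<le> M * nV g" using dual[OF g] by blast
    then show ?thesis using nV_ge_0[of w'] by linarith
  qed
  then have "nV (Q u) \<le> M * nV g"
    using sq nV_ge_0[of "Q u"] by (cases "nV (Q u) = 0") (auto simp: mult_le_cancel_right)
  then have "2 / \<alpha> * nV (Q u) \<le> 2 / \<alpha> * (M * nV g)" using \<alpha> by (intro mult_left_mono) auto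
  then have "nV u \<le> (2 / \<alpha> * M) * nV g" using le by simp
  moreover have "op_adj P v u = ip v g" if v: "v \<in> H" for v
  proof -
    have "op_adj P v u = cnj (ip g v)" by (simp only: op_adj_def u(2)[OF v])
    also have "\<dots> = ip v g" by (rule V.herm[symmetric]) auto
    finally show ?thesis .
  qed
  ultimately show ?thesis using u(1) by blast
qed

text \<open>
  Applied to data for which \<open>uh\<close> is a Galerkin approximation, the error estimate becomes an a priori
  bound, that is, an inf-sup condition for \<open>P\<close> on \<open>X\<close>. In an infinite-dimensional \<open>X\<close> this gives
  uniqueness but not yet existence, for which the same estimate for the adjoint is used.
\<close>

theorem galerkin_well_posed:
  assumes adj: "regular K \<alpha> Cd Creg L m scl ip H N a (op_adj D) (op_adj E) Z n"
    and X: "hilbert_space scl X a" and XH: "X \<subseteq> H"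
    and div: "div_stable nV nH N E X" and div': "div_stable nV nH N (op_adj E) X"
    and \<eta>: "0 \<le> \<eta>" and M: "0 \<le> M"
    and approx: "\<And>x. x \<in> Z (m+1) \<Longrightarrow> \<exists>x'\<in>X. nH (x - x') \<le> \<eta> * n (m+1) x"
    and dual: "\<And>g. perp g \<Longrightarrow> \<exists>w\<in>H. (\<forall>v\<in>H. P v w = ip v g) \<and> nV w \<le> M * nV g"
    and surj: "\<And>f. f \<in> antidual scl H nH \<Longrightarrow> \<exists>u\<in>H. \<forall>v\<in>H. P u v = f v"
    and stab: "inf_sup H nH P c" "0 \<le> c"
    and small: "\<eta>\<^sup>2 * (1 + M) \<le> csmall"
    and u: "u \<in> H"
  shows "\<exists>!uh. uh \<in> X \<and> (\<forall>v\<in>X. P (u - uh) v = 0)"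
    and "\<And>uh xh. uh \<in> X \<Longrightarrow> (\<And>v. v \<in> X \<Longrightarrow> P (u - uh) v = 0) \<Longrightarrow> xh \<in> X \<Longrightarrow>
      nH (u - uh) \<le> Cerr * (1 + \<eta> * (1 + M)) * nH (u - xh)"
proof -
  interpret adj: regular K \<alpha> Cd Creg L m scl ip H N a "op_adj D" "op_adj E" Z n by (rule adj)
  interpret X: hilbert_space scl X a by fact
  have err: "nH (u - uh) \<le> Cerr * (1 + \<eta> * (1 + M)) * nH (u - xh)"
    if "u \<in> H" "uh \<in> X" "\<And>v. v \<in> X \<Longrightarrow> P (u - uh) v = 0" "xh \<in> X" for u uh xh
    by (rule galerkin_error[OF adj X XH div div' \<eta> M approx dual small_imp(1)[OF M small] that])
  show "nH (u - uh) \<le> Cerr * (1 + \<eta> * (1 + M)) * nH (u - xh)"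
    if "uh \<in> X" "\<And>v. v \<in> X \<Longrightarrow> P (u - uh) v = 0" "xh \<in> X" for uh xh
    by (rule err[OF u that])
  have M': "0 \<le> 2 / \<alpha> * M" using M \<alpha> by simp
  have err': "nH (v - vh) \<le> Cerr * (1 + \<eta> * (1 + 2 / \<alpha> * M)) * nH (v - xh)"
    if "v \<in> H" "vh \<in> X" "\<And>w. w \<in> X \<Longrightarrow> op_adj P (v - vh) w = 0" "xh \<in> X" for v vh xh
  proof (rule adj.galerkin_error[OF _ X XH div' _ \<eta> M' approx])
    show "regular K \<alpha> Cd Creg L m scl ip H N a (op_adj (op_adj D)) (op_adj (op_adj E)) Z n"
      by (simp add: regular_axioms)
    show "div_stable nV nH N (op_adj (op_adj E)) X" by (simp add: div)
    show "2 * c2 * (\<eta>\<^sup>2 * (1 + 2 / \<alpha> * M)) \<le> lam" by (rule small_imp(2)[OF M small])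
    show "\<exists>w\<in>H. (\<forall>v\<in>H. adj.P v w = ip v g) \<and> nV w \<le> 2 / \<alpha> * M * nV g" if "perp g" for g
      unfolding adjoint_P by (rule adjoint_dual[OF dual surj that])
    show "adj.P (v - vh) w = 0" if "w \<in> X" for w
      unfolding adjoint_P by (rule \<open>\<And>w. w \<in> X \<Longrightarrow> op_adj P (v - vh) w = 0\<close>[OF that])
  qed (use that in auto)
  define C where "C = Cerr * (1 + \<eta> * (1 + M))"
  have C0: "0 \<le> C" using Cerr_ge_1 \<eta> M by (simp add: C_def)
  have X0: "0 \<in> X" by (rule X.X_0)
  have "\<exists>uh\<in>X. \<forall>v\<in>X. P uh v = P u v"
  proof (rule X.inf_sup_solvable[where K = CP and c = "(1 + C) * c"])
    show "sesquilinear_on scl X P" by (rule sesquilinear_on_subset[OF P_sesq XH])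
    show "cmod (P x y) \<le> CP * nH x * nH y" if "x \<in> X" "y \<in> X" for x y
      using that XH by (intro P_bound) auto
    show "P u \<in> antidual scl X nH"
      by (rule X.antidualI[where K = "CP * nH u"])
        (use u XH P_bound in \<open>auto simp: subset_iff V.sesq_add[OF P_sesq] V.sesq_scl[OF P_sesq]\<close>)
    show "inf_sup X nH P ((1 + C) * c)"
      unfolding inf_sup_def
    proof (intro ballI allI impI)
      fix x d assume x: "x \<in> X" and d: "0 \<le> (d::real)" "\<forall>v\<in>X. cmod (P x v) \<le> d * nH v"
      have xH: "x \<in> H" using x XH by auto
      have "P x \<in> antidual scl X nH"
        by (rule X.antidualI[where K = d])
          (use xH XH d in \<open>auto simp: subset_iff V.sesq_add[OF P_sesq] V.sesq_scl[OF P_sesq]\<close>)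
      from X.riesz_representation[OF this] obtain r where r: "r \<in> X" "\<And>v. v \<in> X \<Longrightarrow> a r v = P x v" by blast
      have rH: "r \<in> H" using r XH by auto
      have rd: "nH r \<le> d"
      proof -
        have "(nH r)\<^sup>2 = Re (P x r)" by (simp add: X.nrm_sq[OF r(1)] r(2)[OF r(1)])
        also have "\<dots> \<le> cmod (P x r)" by (rule complex_Re_le_cmod)
        also have "\<dots> \<le> d * nH r" using d(2) r(1) by blast
        finally have "nH r * nH r \<le> d * nH r" by (simp add: power2_eq_square)
        then show ?thesis using X.nrm_ge_0[OF r(1)] d(1)
          by (cases "nH r = 0") (auto simp: mult_le_cancel_right)
      qed
      have "a r \<in> antidual scl H nH"
        by (rule H.antidualI[where K = "nH r"])
          (use rH H.cauchy_schwarz in \<open>auto simp: H.ip_add H.ip_scl\<close>)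
      from surj[OF this] obtain y where y: "y \<in> H" "\<And>v. v \<in> H \<Longrightarrow> P y v = a r v" by blast
      have "nH y \<le> c * nH r"
        by (rule inf_supD[OF stab(1) y(1)]) (simp_all add: H.nrm_ge_0 rH y(2) H.cauchy_schwarz)
      also have "\<dots> \<le> c * d" by (rule mult_left_mono[OF rd stab(2)])
      finally have yd: "nH y \<le> c * d" .
      have "nH (y - x) \<le> C * nH (y - 0)"
        unfolding C_def
      proof (rule err[OF y(1) x _ X0])
        fix v assume v: "v \<in> X"
        then have vH: "v \<in> H" using XH by auto
        show "P (y - x) v = 0"
          by (simp add: V.sesq_diff[OF P_sesq H.subspaceX y(1) xH vH] y(2)[OF vH] r(2)[OF v])
      qed
      then have "nH x \<le> (1 + C) * nH y"
        using H.nrm_triangle_sub[OF xH y(1)] H.nrm_minus_commute[OF xH y(1)] by (simp add: algebra_simps)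
      also have "\<dots> \<le> (1 + C) * (c * d)" using C0 by (intro mult_left_mono yd) auto
      finally show "nH x \<le> (1 + C) * c * d" by (simp add: mult.assoc)
    qed
    fix v assume v: "v \<in> X" "\<And>x. x \<in> X \<Longrightarrow> P x v = 0"
    have vH: "v \<in> H" using v XH by auto
    have "nH (0 - v) \<le> Cerr * (1 + \<eta> * (1 + 2 / \<alpha> * M)) * nH (0 - 0)"
    proof (rule err'[OF H.X_0 v(1) _ X0])
      fix w assume w: "w \<in> X"
      then have "w \<in> H" using XH by auto
      then have "P w (0 - v) = P w 0 - P w v"
        by (rule V.sesq_diff(2)[OF P_sesq H.subspaceX H.X_0 vH])
      also have "\<dots> = 0" using v(2)[OF w] V.sesq_zero(2)[OF P_sesq H.subspaceX \<open>w \<in> H\<close>] by simp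
      finally show "op_adj P (0 - v) w = 0" by (simp only: op_adj_def) simp
    qed
    then have "nH v \<le> 0" using H.nrm_uminus[OF vH] H.nrm_zero by simp
    then have "nH v = 0" using H.nrm_ge_0[OF vH] by linarith
    then show "v = 0" using H.nrm_eq_0[OF vH] by simp
  qed
  then obtain uh where uh: "uh \<in> X" "\<forall>v\<in>X. P uh v = P u v" by blast
  have Pd: "P (x - y) v = P x v - P y v" if "x \<in> H" "y \<in> H" "v \<in> X" for x y v
    using that XH by (intro V.sesq_diff[OF P_sesq H.subspaceX]) auto
  show "\<exists>!uh. uh \<in> X \<and> (\<forall>v\<in>X. P (u - uh) v = 0)"
  proof (rule ex1I[of _ uh])
    have uhH: "uh \<in> H" using uh XH by auto
    show "uh \<in> X \<and> (\<forall>v\<in>X. P (u - uh) v = 0)" using uh Pd[OF u uhH] by simp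
    fix xh assume xh: "xh \<in> X \<and> (\<forall>v\<in>X. P (u - xh) v = 0)"
    then have xhH: "xh \<in> H" using XH by auto
    have "nH (uh - xh) \<le> Cerr * (1 + \<eta> * (1 + M)) * nH (uh - uh)"
    proof (rule err[OF uhH _ _ uh(1)])
      show "xh \<in> X" using xh by simp
      fix v assume v: "v \<in> X"
      show "P (uh - xh) v = 0"
        using xh v uh(2) Pd[OF u xhH v] Pd[OF uhH xhH v] by simp
    qed
    then have "nH (uh - xh) = 0"
      using H.nrm_ge_0[OF H.X_diff[OF uhH xhH]] H.nrm_zero by simp
    then show "xh = uh" using H.nrm_eq_0[OF H.X_diff[OF uhH xhH]] by simp
  qed
qed

lemma incl_iter:
  assumes "j \<le> k" "k \<le> m + 1" "x \<in> Z k"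
  shows "x \<in> Z j \<and> n j x \<le> L ^ (m+1) * n k x"
proof -
  have "x \<in> Z (k - i) \<and> n (k - i) x \<le> L ^ i * n k x" if "i \<le> k" for i
    using that
  proof (induction i)
    case 0
    then show ?case using assms by simp
  next
    case (Suc i)
    have eq: "k - i = (k - Suc i) + 1" using Suc by simp
    have "x \<in> Z (k - Suc i) \<and> n (k - Suc i) x \<le> L * n (k - i) x"
      using incl[of "k - Suc i" x] Suc assms(2) unfolding eq by simp
    moreover have "L * n (k - i) x \<le> L * (L ^ i * n k x)" using Suc L by (intro mult_left_mono) auto
    ultimately show ?case by (simp add: mult.assoc)
  qed
  from this[of "k - j"] have "x \<in> Z j" "n j x \<le> L ^ (k - j) * n k x" using assms(1) by auto
  moreover have "L ^ (k - j) * n k x \<le> L ^ (m+1) * n k x"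
    using L assms by (intro mult_right_mono power_increasing n_ge_0) auto
  ultimately show ?thesis by simp
qed

text \<open>
  The kernel part of \<open>u\<close> is as regular as the datum tested with kernel vectors, which is why only the representer
  \<open>F'\<close> of this restriction has to lie in \<open>Z (m+1)\<close>; for the rest of the datum \<open>Z (m-1)\<close> is enough.
\<close>

theorem solution_regularity:
  assumes u: "u \<in> H" and F: "\<And>v. v \<in> H \<Longrightarrow> P u v = ip F v"
    and Fm: "F \<in> Z (m-1)" "n (m-1) F \<le> b"
    and F': "F' \<in> Z (m+1)" "n (m+1) F' \<le> b" "\<And>z. z \<in> N \<Longrightarrow> ip F z = ip F' z"
    and b: "nH u \<le> b"
  shows "u \<in> Z (m+1) \<and> n (m+1) u \<le> sig (m+1) * (cdata * b)"
proof (rule bootstrap[OF u F])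
  have b0: "0 \<le> b" using b H.nrm_ge_0[OF u] by linarith
  have "1 * b \<le> cdata * b" by (rule mult_right_mono[OF cdata_ge(1) b0])
  then show "nH u \<le> cdata * b" using b by linarith
  show "F \<in> Z j \<and> n j F \<le> cdata * b" if "j + 2 \<le> m + 1" for j
  proof -
    have i: "F \<in> Z j \<and> n j F \<le> L ^ (m+1) * n (m-1) F"
      by (rule incl_iter) (use that Fm m in auto)
    have "L ^ (m+1) * n (m-1) F \<le> L ^ (m+1) * b" using L Fm by (intro mult_left_mono) auto
    also have "\<dots> \<le> cdata * b" by (rule mult_right_mono[OF cdata_ge(2) b0])
    finally show ?thesis using i by simp
  qed
  show "pi0 u \<in> Z j \<and> n j (pi0 u) \<le> cdata * b" if j: "2 \<le> j" "j \<le> m + 1" for j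
  proof -
    have i: "F' \<in> Z j" "n j F' \<le> L ^ (m+1) * b"
    proof -
      show "F' \<in> Z j" using incl_iter[OF j(2) order_refl F'(1)] by blast
      have "L ^ (m+1) * n (m+1) F' \<le> L ^ (m+1) * b" using L by (intro mult_left_mono[OF F'(2)]) simp
      then show "n j F' \<le> L ^ (m+1) * b" using incl_iter[OF j(2) order_refl F'(1)] by linarith
    qed
    have "- F' \<in> Z j" by (rule V.subspace_neg[OF Z_sub[OF j(2)] i(1)])
    moreover have "n j (- F') = n j F'" using n_scl[OF j(2) i(1), of "-1"] by (simp add: V.scl_minus_one)
    moreover have "E (pi0 u) z = ip (- F') z" if z: "z \<in> N" for z
    proof -
      have "E (pi0 u) z = - P u z" by (simp add: E_pi0[OF z] P_N(2)[OF z u])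
      also have "P u z = ip F z" using z N_sub by (intro F) auto
      also have "\<dots> = ip F' z" by (rule F'(3)[OF z])
      also have "- ip F' z = ip (- F') z" using V.sesq_uminus(1)[OF V.sesq, of F' z] by simp
      finally show ?thesis .
    qed
    ultimately have r: "pi0 u \<in> Z j" "n j (pi0 u) \<le> Creg * (Creg * n j F' + nV (pi0 u))"
      using reg_N[of j "pi0 u" "- F'"] pi0_N j by auto
    have "nV (pi0 u) \<le> K / \<alpha> * b"
    proof -
      have "nV (pi0 u) \<le> nV u / \<alpha>" by (rule nV_pi0)
      also have "\<dots> \<le> K * nH u / \<alpha>" using \<alpha> by (intro divide_right_mono embed[OF u]) auto
      also have "\<dots> \<le> K * b / \<alpha>" using \<alpha> K b by (intro divide_right_mono mult_left_mono) auto
      finally show ?thesis by simp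
    qed
    moreover have "Creg * n j F' \<le> Creg * (L ^ (m+1) * b)" using i(2) Creg by (intro mult_left_mono) auto
    ultimately have "Creg * n j F' + nV (pi0 u) \<le> (Creg * L ^ (m+1) + K / \<alpha>) * b"
      by (simp add: algebra_simps)
    then have "Creg * (Creg * n j F' + nV (pi0 u)) \<le> Creg * ((Creg * L ^ (m+1) + K / \<alpha>) * b)"
      using Creg by (intro mult_left_mono) auto
    also have "\<dots> = (Creg * (Creg * L ^ (m+1) + K / \<alpha>)) * b" by (simp only: mult.assoc)
    also have "\<dots> \<le> cdata * b" by (rule mult_right_mono[OF cdata_ge(3) b0])
    finally show ?thesis using r by linarith
  qed
qed simp_all

end

section \<open>The variational problem behind the first assumption\<close>

lemma metric_space_dist_on:
  assumes "inner_space scl X ip"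
  shows "Metric_space X (dist_on X (hnorm ip))"
proof -
  interpret inner_space scl X ip by fact
  show ?thesis
  proof
    show "0 \<le> dist_on X (hnorm ip) x y" for x y
      by (simp add: dist_on_def nrm_ge_0 X_diff)
    show "dist_on X (hnorm ip) x y = dist_on X (hnorm ip) y x" for x y
      by (simp add: dist_on_def nrm_minus_commute[of x y])
    show "(dist_on X (hnorm ip) x y = 0) = (x = y)" if "x \<in> X" "y \<in> X" for x y
      using that by (simp add: dist_on_def nrm_eq_0 X_diff)
    show "dist_on X (hnorm ip) x z \<le> dist_on X (hnorm ip) x y + dist_on X (hnorm ip) y z"
      if "x \<in> X" "y \<in> X" "z \<in> X" for x y z
      using that nrm_triangle[OF X_diff[of x y] X_diff[of y z]] by (simp add: dist_on_def)
  qed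
qed

lemma hilbert_space_complex_hilbert_on:
  assumes "complex_hilbert_on scl X ip"
  shows "hilbert_space scl X ip"
proof -
  interpret vector_space scl using assms by (simp add: complex_hilbert_on_def)
  interpret complex_space scl by unfold_locales
  interpret inner_space scl X ip
  proof
    show sub: "subspace X" using assms by (simp add: complex_hilbert_on_def)
    have add: "ip (u + v) w = ip u w + ip v w" if "u \<in> X" "v \<in> X" "w \<in> X" for u v w
      using assms that unfolding complex_hilbert_on_def by blast
    have sc: "ip (scl c u) w = c * ip u w" if "u \<in> X" "w \<in> X" for c u w
      using assms that unfolding complex_hilbert_on_def by blast
    show herm: "ip v u = cnj (ip u v)" if "u \<in> X" "v \<in> X" for u v
      using assms that unfolding complex_hilbert_on_def by blast
    show "0 < Re (ip u u)" if "u \<in> X" "u \<noteq> 0" for u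
      using assms that unfolding complex_hilbert_on_def by blast
    show "sesquilinear_on scl X ip"
    proof (rule sesquilinear_onI)
      fix u v w assume X: "u \<in> X" "v \<in> X" "w \<in> X"
      show "ip w (u + v) = ip w u + ip w v"
        using herm[OF subspace_add[OF sub X(1,2)] X(3)] herm[OF X(1,3)] herm[OF X(2,3)] add[OF X] by simp
    next
      fix c u w assume X: "u \<in> X" "w \<in> X"
      show "ip w (scl c u) = cnj c * ip w u"
        using herm[OF subspace_scale[OF sub X(1)] X(2)] herm[OF X] sc[OF X] by simp
    qed (fact add sc)+
  qed
  interpret M: Metric_space X "dist_on X (hnorm ip)" by (rule metric_space_dist_on) unfold_locales
  have mc: "M.mcomplete" using assms by (simp add: complex_hilbert_on_def)
  show ?thesis
  proof
    fix s assume s: "\<And>n::nat. s n \<in> X"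
      and cau: "\<And>\<epsilon>. \<epsilon> > 0 \<Longrightarrow> \<exists>N. \<forall>m\<ge>N. \<forall>n\<ge>N. hnorm ip (s m - s n) < \<epsilon>"
    have "M.MCauchy s"
      unfolding M.MCauchy_def
    proof (intro conjI allI impI)
      show "range s \<subseteq> X" using s by blast
      fix \<epsilon> :: real assume "\<epsilon> > 0"
      from cau[OF this] obtain N where "\<forall>m\<ge>N. \<forall>n\<ge>N. hnorm ip (s m - s n) < \<epsilon>" by blast
      then show "\<exists>N. \<forall>n n'. N \<le> n \<longrightarrow> N \<le> n' \<longrightarrow> dist_on X (hnorm ip) (s n) (s n') < \<epsilon>"
        by (intro exI[of _ N]) (simp add: dist_on_def s)
    qed
    then obtain l where "limitin M.mtopology s l sequentially"
      using mc unfolding M.mcomplete_def by blast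
    then have "l \<in> X" "(\<lambda>n. dist_on X (hnorm ip) (s n) l) \<longlonglongrightarrow> 0"
      by (simp_all add: M.limitin_metric_dist_null)
    then show "\<exists>l\<in>X. (\<lambda>n. hnorm ip (s n - l)) \<longlonglongrightarrow> 0"
      by (intro bexI[of _ l]) (simp_all add: dist_on_def s)
  qed
qed

lemma hilbert_space_equivalent_norm:
  assumes "hilbert_space scl X ip" "inner_space scl X ip'" "0 < c" "0 < c'"
    and le: "\<And>x. x \<in> X \<Longrightarrow> c * hnorm ip x \<le> hnorm ip' x" "\<And>x. x \<in> X \<Longrightarrow> hnorm ip' x \<le> c' * hnorm ip x"
  shows "hilbert_space scl X ip'"
proof -
  interpret A: hilbert_space scl X ip by fact
  interpret inner_space scl X ip' by fact
  show ?thesis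
  proof
    fix s assume s: "\<And>n::nat. s n \<in> X"
      and cau: "\<And>\<epsilon>. \<epsilon> > 0 \<Longrightarrow> \<exists>N. \<forall>m\<ge>N. \<forall>n\<ge>N. hnorm ip' (s m - s n) < \<epsilon>"
    have "\<exists>N. \<forall>m\<ge>N. \<forall>n\<ge>N. hnorm ip (s m - s n) < \<epsilon>" if "\<epsilon> > 0" for \<epsilon>
    proof -
      obtain N where N: "\<And>m n. m \<ge> N \<Longrightarrow> n \<ge> N \<Longrightarrow> hnorm ip' (s m - s n) < c * \<epsilon>"
        using cau[of "c * \<epsilon>"] \<open>\<epsilon> > 0\<close> \<open>0 < c\<close> by auto
      have "hnorm ip (s m - s n) < \<epsilon>" if "m \<ge> N" "n \<ge> N" for m n
      proof -
        have "c * hnorm ip (s m - s n) < c * \<epsilon>" using le(1)[OF X_diff[OF s s]] N[OF that] by (rule le_less_trans)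
        then show ?thesis using \<open>0 < c\<close> by simp
      qed
      then show ?thesis by blast
    qed
    from A.complete[OF s this] obtain l where l: "l \<in> X" "(\<lambda>n. hnorm ip (s n - l)) \<longlonglongrightarrow> 0" by blast
    have "(\<lambda>n. hnorm ip' (s n - l)) \<longlonglongrightarrow> 0"
    proof (rule Lim_null_comparison)
      show "\<forall>\<^sub>F n in sequentially. norm (hnorm ip' (s n - l)) \<le> c' * hnorm ip (s n - l)"
        using le(2)[OF X_diff[OF s l(1)]] nrm_ge_0[OF X_diff[OF s l(1)]] by simp
      show "(\<lambda>n. c' * hnorm ip (s n - l)) \<longlonglongrightarrow> 0" using tendsto_mult_left[OF l(2), of c'] by simp
    qed
    then show "\<exists>l\<in>X. (\<lambda>n. hnorm ip' (s n - l)) \<longlonglongrightarrow> 0" using l(1) by blast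
  qed
qed

lemma hilbert_space_closedin:
  assumes "hilbert_space scl X ip" "module.subspace scl Y"
    and cl: "closedin (Metric_space.mtopology X (dist_on X (hnorm ip))) Y"
  shows "Y \<subseteq> X" "hilbert_space scl Y ip"
proof -
  interpret hilbert_space scl X ip by fact
  interpret M: Metric_space X "dist_on X (hnorm ip)" by (rule metric_space_dist_on) unfold_locales
  show YX: "Y \<subseteq> X" using closedin_subset[OF cl] by simp
  show "hilbert_space scl Y ip"
  proof (rule closed_subspace_hilbert[OF assms(2) YX])
    fix s l assume s: "\<And>n. s n \<in> Y" and l: "l \<in> X" and lim: "(\<lambda>n. hnorm ip (s n - l)) \<longlonglongrightarrow> 0"
    have "limitin M.mtopology s l sequentially"
      unfolding M.limitin_metric_dist_null using l lim s YX by (auto simp: dist_on_def subset_iff)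
    then show "l \<in> Y" using cl s unfolding M.metric_closedin_iff_sequentially_closed by blast
  qed
qed

lemma opnorm_leD:
  assumes "opnorm X nX nY A \<le> ennreal C" "x \<in> X" "nX x = ennreal r" "0 < r"
  shows "nY (A x) \<le> ennreal (C * r)"
proof -
  have "nX x \<noteq> 0" using assms by simp
  then have "nY (A x) / nX x \<le> opnorm X nX nY A"
    unfolding opnorm_def using assms(2) by (intro SUP_upper) simp
  then have le: "nY (A x) / ennreal r \<le> ennreal C" using assms by (simp add: order_trans)
  show ?thesis
  proof (cases "nY (A x)")
    case (real t)
    then have "ennreal (t / r) \<le> ennreal C" using le assms(4) by (simp add: divide_ennreal)
    then have "t / r \<le> C \<or> t \<le> 0"
      using real(1) assms(4) by (cases "0 \<le> C") (auto simp: ennreal_neg ennreal_eq_0_iff divide_le_0_iff)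
    then have "ennreal t \<le> ennreal (C * r)"
      using assms(4) by (auto simp: divide_le_eq ennreal_neg ennreal_leI)
    then show ?thesis using real by simp
  next
    case top
    then show ?thesis using le assms(4) by (simp add: ennreal_top_divide top_unique)
  qed
qed

lemma dual_norm_leD:
  assumes "dual_norm X n f \<le> ennreal C" "0 \<le> C" "v \<in> X" "0 < n v"
  shows "cmod (f v) \<le> C * n v"
proof -
  have "ennreal (cmod (f v) / n v) \<le> dual_norm X n f"
    unfolding dual_norm_def using assms by (intro SUP_upper) simp
  also have "\<dots> \<le> ennreal C" by fact
  finally show ?thesis using assms by (simp add: divide_le_eq)
qed

lemma dual_norm_leI:
  assumes "\<And>v. v \<in> X \<Longrightarrow> cmod (f v) \<le> C * n v" "\<And>v. v \<in> X \<Longrightarrow> 0 \<le> n v"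
  shows "dual_norm X n f \<le> ennreal C"
  unfolding dual_norm_def
proof (rule SUP_least)
  fix v assume "v \<in> {v \<in> X. n v \<noteq> 0}"
  then have v: "v \<in> X" "0 < n v" using assms(2)[of v] by auto
  show "ennreal (cmod (f v) / n v) \<le> ennreal C"
    using assms(1)[OF v(1)] v(2) by (intro ennreal_leI) (simp add: divide_le_eq)
qed

lemma (in inner_space) opnorm_form_bound:
  assumes A: "sesquilinear_on scl X A"
    and le: "opnorm X (enorm_on X nrm) (dual_norm X nrm) A \<le> ennreal C" "0 \<le> C"
    and x: "x \<in> X" and v: "v \<in> X"
  shows "cmod (A x v) \<le> C * nrm x * nrm v"
proof (cases "x = 0 \<or> v = 0")
  case True
  then show ?thesis using sesq_zero[OF A subspaceX] x v by (auto simp: nrm_zero)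
next
  case False
  then have p: "0 < nrm x" "0 < nrm v" using nrm_ge_0 nrm_eq_0 x v by (metis less_eq_real_def)+
  have "dual_norm X nrm (A x) \<le> ennreal (C * nrm x)"
    by (rule opnorm_leD[OF le(1) x _ p(1)]) (simp add: enorm_on_def x)
  then show ?thesis using dual_norm_leD[of X nrm "A x" "C * nrm x" v] v le(2) p by simp
qed

lemma (in complex_space) sesquilinear_linear_to_antidual:
  assumes "linear_to_antidual scl X n A"
  shows "sesquilinear_on scl X A"
  using assms unfolding linear_to_antidual_def antidual_def
  by (intro sesquilinear_onI) auto

text \<open>
  The hypotheses on the parameters bound the constants of one operator by uniform ones. The embedding
  constant refers to the given norms; together with the bounds in \<open>assumption1\<close> it makes the norm of
  \<open>H\<close> that depends on \<open>D\<close> equivalent to the given one, uniformly in the operator.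
\<close>

locale coercive_setting = constants K \<alpha> Cd Creg' L m
  for K \<alpha> Cd Creg' L :: real and m :: nat +
  fixes scl :: "complex \<Rightarrow> 'v::ab_group_add \<Rightarrow> 'v" and ipV :: "'v \<Rightarrow> 'v \<Rightarrow> complex"
    and H :: "'v set" and ipH :: "'v \<Rightarrow> 'v \<Rightarrow> complex" and C1 C2 CE :: real
    and P D E :: "'v \<Rightarrow> 'v \<Rightarrow> complex"
  assumes A1: "assumption1 scl ipV H ipH C1 C2 CE P D E"
    and emb: "v \<in> H \<Longrightarrow> sqrt C2 * hnorm ipV v \<le> K * (sqrt C1 * hnorm ipH v)"
    and \<alpha>CE: "\<alpha> * C2 \<le> CE"
    and Cd_ge: "C2 / C1 + K\<^sup>2 \<le> Cd"
begin

lemma C_pos: "0 < C1" "0 < C2" "0 < CE" using A1 unfolding assumption1_def by blast+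

lemma pair: "hilbert_pair scl ipV H ipH" using A1 unfolding assumption1_def by blast

sublocale iV: hilbert_space scl UNIV ipV
  using pair unfolding hilbert_pair_def by (intro hilbert_space_complex_hilbert_on) blast

sublocale iH: hilbert_space scl H ipH
  using pair unfolding hilbert_pair_def by (intro hilbert_space_complex_hilbert_on) blast

abbreviation "ip \<equiv> innerV C2 ipV"
abbreviation "a \<equiv> innerH C2 ipV D"
abbreviation "N \<equiv> op_ker H D"

lemma hnorm_ip: "hnorm (innerV C2 ipV) = normV C2 ipV"
  by (rule ext) (simp add: hnorm_def innerV_def normV_def real_sqrt_mult)

lemma hnorm_a: "hnorm (innerH C2 ipV D) = normH C2 ipV D"
proof
  fix v
  show "hnorm a v = normH C2 ipV D v"
    using iV.nrm_sq[of v] by (simp add: hnorm_def[of a] innerH_def normH_def op_Re_def op_adj_def)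
qed

lemma D_sesq: "sesquilinear_on scl H D"
  using A1 unfolding assumption1_def by (intro iV.sesquilinear_linear_to_antidual) blast

lemma P_sesq: "sesquilinear_on scl H P"
  using A1 unfolding assumption1_def by (intro iV.sesquilinear_linear_to_antidual) blast

lemma E_sesq: "sesquilinear_on scl UNIV E"
  using A1 unfolding assumption1_def by (intro iV.sesquilinear_linear_to_antidual) blast

lemma P_eq: "u \<in> H \<Longrightarrow> v \<in> H \<Longrightarrow> P u v = D u v - E u v"
  using A1 unfolding assumption1_def by blast

lemma op_norms_le:
  "opnorm H (enorm_on H (hnorm ipH)) (dual_norm H (hnorm ipH)) P \<le> ennreal C2"
  "opnorm UNIV (enorm_on UNIV (hnorm ipV)) (dual_norm UNIV (hnorm ipV)) E \<le> ennreal C2"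
proof -
  have *: "opnorm H (enorm_on H (hnorm ipH)) (dual_norm H (hnorm ipH)) P +
       opnorm UNIV (enorm_on UNIV (hnorm ipV)) (dual_norm UNIV (hnorm ipV)) E \<le> ennreal C2"
    using A1 unfolding assumption1_def by blast
  show "opnorm H (enorm_on H (hnorm ipH)) (dual_norm H (hnorm ipH)) P \<le> ennreal C2"
    by (rule order_trans[OF _ *]) simp
  show "opnorm UNIV (enorm_on UNIV (hnorm ipV)) (dual_norm UNIV (hnorm ipV)) E \<le> ennreal C2"
    by (rule order_trans[OF _ *]) simp
qed

lemma P_le: "u \<in> H \<Longrightarrow> v \<in> H \<Longrightarrow> cmod (P u v) \<le> C2 * hnorm ipH u * hnorm ipH v"
  using C_pos by (intro iH.opnorm_form_bound[OF P_sesq op_norms_le(1)]) auto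

lemma normV_sq: "(normV C2 ipV v)\<^sup>2 = C2 * (hnorm ipV v)\<^sup>2"
  using C_pos by (simp add: normV_def power_mult_distrib)

lemma E_le: "cmod (E u v) \<le> normV C2 ipV u * normV C2 ipV v"
proof -
  have "cmod (E u v) \<le> C2 * hnorm ipV u * hnorm ipV v"
    using C_pos by (intro iV.opnorm_form_bound[OF E_sesq op_norms_le(2)]) auto
  also have "\<dots> = (sqrt C2 * sqrt C2) * (hnorm ipV u * hnorm ipV v)" using C_pos by simp
  also have "\<dots> = normV C2 ipV u * normV C2 ipV v" by (simp only: normV_def ac_simps)
  finally show ?thesis .
qed

lemma Re_D_ge: "v \<in> H \<Longrightarrow> C1 * (hnorm ipH v)\<^sup>2 \<le> Re (D v v) + C2 * (hnorm ipV v)\<^sup>2"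
  using A1 unfolding assumption1_def by force

lemma emb_sq: "v \<in> H \<Longrightarrow> C2 * (hnorm ipV v)\<^sup>2 \<le> K\<^sup>2 * C1 * (hnorm ipH v)\<^sup>2"
proof -
  assume v: "v \<in> H"
  have "(sqrt C2 * hnorm ipV v)\<^sup>2 \<le> (K * (sqrt C1 * hnorm ipH v))\<^sup>2"
    using C_pos iV.nrm_ge_0 by (intro power_mono emb v) auto
  then show ?thesis using C_pos by (simp add: power_mult_distrib)
qed

lemma normH_lower: "v \<in> H \<Longrightarrow> sqrt C1 * hnorm ipH v \<le> normH C2 ipV D v"
proof -
  assume v: "v \<in> H"
  have "(sqrt C1 * hnorm ipH v)\<^sup>2 \<le> Re (D v v) + C2 * (hnorm ipV v)\<^sup>2"
    using Re_D_ge[OF v] C_pos by (simp add: power_mult_distrib)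
  then show ?thesis unfolding normH_def by (rule real_le_rsqrt)
qed

lemma normH_upper: "v \<in> H \<Longrightarrow> normH C2 ipV D v \<le> sqrt (C2 + 2 * (K\<^sup>2 * C1)) * hnorm ipH v"
proof -
  assume v: "v \<in> H"
  have "Re (D v v) = Re (P v v) + Re (E v v)" using P_eq[OF v v] by simp
  also have "\<dots> \<le> C2 * (hnorm ipH v)\<^sup>2 + C2 * (hnorm ipV v)\<^sup>2"
    using P_le[OF v v] E_le[of v v] complex_Re_le_cmod[of "P v v"] complex_Re_le_cmod[of "E v v"] normV_sq[of v]
    by (simp add: power2_eq_square)
  finally have "Re (D v v) + C2 * (hnorm ipV v)\<^sup>2 \<le> (C2 + 2 * (K\<^sup>2 * C1)) * (hnorm ipH v)\<^sup>2"
    using emb_sq[OF v] by (simp add: algebra_simps)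
  then have "normH C2 ipV D v \<le> sqrt ((C2 + 2 * (K\<^sup>2 * C1)) * (hnorm ipH v)\<^sup>2)"
    unfolding normH_def by simp
  then show ?thesis using iH.nrm_ge_0[OF v] by (simp add: real_sqrt_mult)
qed

lemma hilbert_V: "hilbert_space scl UNIV (innerV C2 ipV)"
proof (rule hilbert_space_equivalent_norm[OF iV.hilbert_space_axioms])
  show "inner_space scl UNIV ip"
  proof
    show "iV.subspace UNIV" by simp
    show "sesquilinear_on scl UNIV ip"
      by (rule iV.sesquilinear_onI)
        (simp_all add: innerV_def iV.ip_add[OF UNIV_I UNIV_I UNIV_I] iV.ip_scl[OF UNIV_I UNIV_I] algebra_simps)
    show "ip v u = cnj (ip u v)" for u v using iV.herm[of u v] by (simp add: innerV_def)
    show "0 < Re (ip u u)" if "u \<noteq> 0" for u using iV.pos[of u] that C_pos by (simp add: innerV_def)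
  qed
  show "0 < sqrt C2" "0 < sqrt C2" using C_pos by simp_all
qed (simp_all add: hnorm_ip normV_def)

lemma hilbert_H: "hilbert_space scl H (innerH C2 ipV D)"
proof (rule hilbert_space_equivalent_norm[OF iH.hilbert_space_axioms])
  show "inner_space scl H a"
  proof
    show "iV.subspace H" by (rule iH.subspaceX)
    show "sesquilinear_on scl H a"
      by (rule iV.sesquilinear_onI)
        (simp_all add: innerH_def op_Re_def op_adj_def iV.sesq_add[OF D_sesq] iV.sesq_scl[OF D_sesq]
          iV.ip_add[OF UNIV_I UNIV_I UNIV_I] iV.ip_scl[OF UNIV_I UNIV_I] algebra_simps add_divide_distrib)
    show "a v u = cnj (a u v)" for u v
      using iV.herm[of u v] by (simp add: innerH_def op_Re_def op_adj_def algebra_simps)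
    show "0 < Re (a u u)" if u: "u \<in> H" "u \<noteq> 0" for u
    proof -
      have "0 < C1 * (hnorm ipH u)\<^sup>2" using iH.nrm_eq_0[OF u(1)] u(2) C_pos by simp
      then show ?thesis using Re_D_ge[OF u(1)] iV.nrm_sq[of u]
        by (simp add: innerH_def op_Re_def op_adj_def)
    qed
  qed
  show "0 < sqrt C1" "0 < sqrt (C2 + 2 * (K\<^sup>2 * C1))" using C_pos K by (simp_all add: add_pos_nonneg)
  show "sqrt C1 * hnorm ipH x \<le> hnorm a x" if "x \<in> H" for x
    unfolding hnorm_a by (rule normH_lower[OF that])
  show "hnorm a x \<le> sqrt (C2 + 2 * (K\<^sup>2 * C1)) * hnorm ipH x" if "x \<in> H" for x
    unfolding hnorm_a by (rule normH_upper[OF that])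
qed

sublocale V: hilbert_space scl UNIV "innerV C2 ipV" by (rule hilbert_V)
sublocale HS: hilbert_space scl H "innerH C2 ipV D" by (rule hilbert_H)

lemma embed': "v \<in> H \<Longrightarrow> hnorm ip v \<le> K * hnorm a v"
proof -
  assume v: "v \<in> H"
  have "hnorm ip v \<le> K * (sqrt C1 * hnorm ipH v)" unfolding hnorm_ip normV_def by (rule emb[OF v])
  also have "\<dots> \<le> K * hnorm a v"
    unfolding hnorm_a using K by (intro mult_left_mono normH_lower v) auto
  finally show ?thesis .
qed

lemma D_N: "z \<in> N \<Longrightarrow> v \<in> H \<Longrightarrow> D z v = 0" "z \<in> N \<Longrightarrow> v \<in> H \<Longrightarrow> D v z = 0"
proof -
  show "z \<in> N \<Longrightarrow> v \<in> H \<Longrightarrow> D z v = 0" by (simp add: op_ker_def)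
  have "op_ker H (op_adj D) = N" using A1 unfolding assumption1_def by blast
  then show "z \<in> N \<Longrightarrow> v \<in> H \<Longrightarrow> D v z = 0" by (auto simp: op_ker_def op_adj_def)
qed

lemma N_H: "N \<subseteq> H" by (auto simp: op_ker_def)

lemma D_le: "u \<in> H \<Longrightarrow> v \<in> H \<Longrightarrow> cmod (D u v) \<le> Cd * hnorm a u * hnorm a v"
proof -
  assume u: "u \<in> H" and v: "v \<in> H"
  have nn: "0 \<le> hnorm a u" "0 \<le> hnorm a v" by (simp_all add: HS.nrm_ge_0 u v)
  have "cmod (D u v) = cmod (P u v + E u v)" by (simp add: P_eq[OF u v])
  also have "\<dots> \<le> cmod (P u v) + cmod (E u v)" by (rule norm_triangle_ineq)
  also have "cmod (P u v) \<le> C2 / C1 * (hnorm a u * hnorm a v)"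
  proof -
    have "cmod (P u v) \<le> C2 * hnorm ipH u * hnorm ipH v" by (rule P_le[OF u v])
    also have "\<dots> = C2 / C1 * ((sqrt C1 * hnorm ipH u) * (sqrt C1 * hnorm ipH v))"
    proof -
      have "(sqrt C1 * hnorm ipH u) * (sqrt C1 * hnorm ipH v) = (sqrt C1 * sqrt C1) * (hnorm ipH u * hnorm ipH v)"
        by (simp only: ac_simps)
      also have "sqrt C1 * sqrt C1 = C1" using C_pos by simp
      finally have eq: "(sqrt C1 * hnorm ipH u) * (sqrt C1 * hnorm ipH v) = C1 * (hnorm ipH u * hnorm ipH v)" .
      show ?thesis unfolding eq using C_pos by simp
    qed
    also have "\<dots> \<le> C2 / C1 * (hnorm a u * hnorm a v)"
      unfolding hnorm_a using C_pos u v nn iH.nrm_ge_0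
      by (intro mult_left_mono mult_mono normH_lower) (auto simp: hnorm_a)
    finally show ?thesis .
  qed
  also have "cmod (E u v) \<le> K\<^sup>2 * (hnorm a u * hnorm a v)"
  proof -
    have "cmod (E u v) \<le> hnorm ip u * hnorm ip v" unfolding hnorm_ip by (rule E_le)
    also have "\<dots> \<le> (K * hnorm a u) * (K * hnorm a v)"
      using K nn u v by (intro mult_mono embed') (auto simp: V.nrm_ge_0)
    finally show ?thesis by (simp add: power2_eq_square algebra_simps)
  qed
  finally have "cmod (D u v) \<le> (C2 / C1 + K\<^sup>2) * (hnorm a u * hnorm a v)" by (simp add: distrib_right)
  also have "\<dots> \<le> Cd * (hnorm a u * hnorm a v)" using Cd_ge nn by (intro mult_right_mono) auto
  finally show ?thesis by (simp add: mult.assoc)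
qed

lemma a_N: "z \<in> N \<Longrightarrow> v \<in> H \<Longrightarrow> a z v = ip z v"
  by (simp add: innerH_def innerV_def op_Re_def op_adj_def D_N)

lemma subspace_N: "iV.subspace N"
proof (rule iV.subspaceI)
  show "0 \<in> N" by (simp add: op_ker_def iH.X_0 iV.sesq_zero[OF D_sesq iH.subspaceX])
  show "x + y \<in> N" if "x \<in> N" "y \<in> N" for x y
    using that by (simp add: op_ker_def iH.X_add iV.sesq_add[OF D_sesq])
  show "scl c x \<in> N" if "x \<in> N" for c x
    using that by (simp add: op_ker_def iH.X_scl iV.sesq_scl[OF D_sesq])
qed

text \<open>
  On the kernel the two norms agree, so completeness in \<open>V\<close> follows from that of \<open>H\<close> and the
  continuity of \<open>D\<close> there.
\<close>

lemma hilbert_N: "hilbert_space scl N (innerV C2 ipV)"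
proof
  show "iV.subspace N" by (rule subspace_N)
  show "sesquilinear_on scl N ip" by (rule sesquilinear_on_subset[OF V.sesq]) simp
  show "ip v u = cnj (ip u v)" for u v by (rule V.herm) auto
  show "0 < Re (ip u u)" if "u \<noteq> 0" for u using that by (intro V.pos) auto
  fix s assume s: "\<And>n::nat. s n \<in> N"
    and cau: "\<And>\<epsilon>. \<epsilon> > 0 \<Longrightarrow> \<exists>M. \<forall>m\<ge>M. \<forall>n\<ge>M. hnorm ip (s m - s n) < \<epsilon>"
  have sH: "s n \<in> H" for n using s N_H by blast
  have eq: "hnorm a z = hnorm ip z" if "z \<in> N" for z
    using a_N[OF that] that N_H by (auto simp: hnorm_def)
  have dN: "s i - s j \<in> N" for i j using iV.subspace_diff[OF subspace_N s s] .
  have "\<exists>M. \<forall>m\<ge>M. \<forall>n\<ge>M. hnorm a (s m - s n) < \<epsilon>" if "\<epsilon> > 0" for \<epsilon>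
    using cau[OF that] by (simp only: eq[OF dN])
  from HS.complete[OF sH this] obtain l where l: "l \<in> H" "(\<lambda>n. hnorm a (s n - l)) \<longlonglongrightarrow> 0" by blast
  have "l \<in> N"
    unfolding op_ker_def
  proof (intro CollectI conjI ballI l(1))
    fix v assume v: "v \<in> H"
    have "(\<lambda>n. D (s n) v) \<longlonglongrightarrow> D l v"
    proof (rule HS.form_tendsto[of s l "\<lambda>u. D u v" "Cd * hnorm a v", OF sH l])
      show "D (s n - l) v = D (s n) v - D l v" for n
        by (rule iV.sesq_diff(1)[OF D_sesq iH.subspaceX sH l(1) v])
      show "cmod (D u v) \<le> Cd * hnorm a v * hnorm a u" if "u \<in> H" for u
        using D_le[OF that v] by (simp add: algebra_simps)
    qed
    moreover have "D (s n) v = 0" for n by (rule D_N(1)[OF s v])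
    ultimately show "D l v = 0" by (simp add: LIMSEQ_const_iff)
  qed
  moreover have "(\<lambda>n. hnorm ip (s n - l)) \<longlonglongrightarrow> 0"
    using l(2) eq[OF iV.subspace_diff[OF subspace_N s \<open>l \<in> N\<close>]] by simp
  ultimately show "\<exists>l\<in>N. (\<lambda>n. hnorm ip (s n - l)) \<longlonglongrightarrow> 0" by blast
qed

lemma problem_P: "problem K \<alpha> Cd Creg' L m scl (innerV C2 ipV) H (op_ker H D) (innerH C2 ipV D) D E"
proof -
  interpret NS: hilbert_space scl N ip by (rule hilbert_N)
  show ?thesis
  proof unfold_locales
    show "N \<subseteq> H" by (rule N_H)
    show "\<alpha> * (hnorm ip v)\<^sup>2 \<le> Re (E v v)" for v
    proof -
      have "\<alpha> * (hnorm ip v)\<^sup>2 = \<alpha> * C2 * (hnorm ipV v)\<^sup>2" by (simp add: hnorm_ip normV_sq)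
      also have "\<dots> \<le> CE * (hnorm ipV v)\<^sup>2" by (rule mult_right_mono[OF \<alpha>CE]) simp
      also have "\<dots> \<le> Re (E v v)" using A1 unfolding assumption1_def by blast
      finally show ?thesis .
    qed
    show "cmod (E u v) \<le> hnorm ip u * hnorm ip v" for u v unfolding hnorm_ip by (rule E_le)
    show "a u v = (D u v + cnj (D v u)) / 2 + ip u v" for u v
      by (simp add: innerH_def op_Re_def op_adj_def innerV_def)
  qed (simp_all add: embed' a_N D_N D_le D_sesq E_sesq)
qed

end

section \<open>The regularity scale behind the second assumption\<close>

locale regular_setting = coercive_setting K \<alpha> Cd Creg' L m scl ipV H ipH C1 C2 CE P D E
  for K \<alpha> Cd Creg' L :: real and m :: nat
    and scl :: "complex \<Rightarrow> 'v::ab_group_add \<Rightarrow> 'v" and ipV :: "'v \<Rightarrow> 'v \<Rightarrow> complex"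
    and H :: "'v set" and ipH :: "'v \<Rightarrow> 'v \<Rightarrow> complex" and C1 C2 CE :: real
    and P D E :: "'v \<Rightarrow> 'v \<Rightarrow> complex" +
  fixes Creg :: real and Z :: "nat \<Rightarrow> 'v set" and nZ :: "nat \<Rightarrow> 'v \<Rightarrow> real"
  assumes A2: "assumption2 scl ipV H ipH Creg C1 C2 CE m Z nZ P D E"
    and Creg_le: "0 < Creg" "Creg \<le> Creg'"
    and incl': "1 \<le> j \<Longrightarrow> j \<le> m + 1 \<Longrightarrow> x \<in> Z j \<Longrightarrow> normZ C2 ipV D nZ (j-1) x \<le> L * normZ C2 ipV D nZ j x"
begin

sublocale pr: problem K \<alpha> Cd Creg' L m scl "innerV C2 ipV" H "op_ker H D" "innerH C2 ipV D" D E
  by (rule problem_P)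

abbreviation "nn \<equiv> normZ C2 ipV D nZ"

lemma Z01: "Z 0 = UNIV" "Z 1 = H" "nn 0 = hnorm ip" "nn 1 = hnorm a"
  using A2 unfolding assumption2_def by (simp_all add: normZ_def hnorm_ip hnorm_a)

lemma normed: "1 \<le> j \<Longrightarrow> j \<le> m + 1 \<Longrightarrow> normed_on scl (Z j) (nn j)"
  using A2 unfolding assumption2_def by simp

lemma normed_all:
  assumes j: "j \<le> m + 1"
  shows "iV.subspace (Z j)" "\<And>x. x \<in> Z j \<Longrightarrow> 0 \<le> nn j x" "\<And>x. x \<in> Z j \<Longrightarrow> nn j x = 0 \<longleftrightarrow> x = 0"
    "\<And>c x. x \<in> Z j \<Longrightarrow> nn j (scl c x) = cmod c * nn j x"
    "\<And>x y. x \<in> Z j \<Longrightarrow> y \<in> Z j \<Longrightarrow> nn j (x + y) \<le> nn j x + nn j y"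
proof -
  have "normed_on scl (Z j) (nn j)"
  proof (cases "j = 0")
    case True
    show ?thesis
      unfolding normed_on_def True Z01
      by (simp add: V.nrm_ge_0 V.nrm_eq_0 V.nrm_scl V.nrm_triangle)
  next
    case False
    then show ?thesis using normed j by simp
  qed
  then show "iV.subspace (Z j)" "\<And>x. x \<in> Z j \<Longrightarrow> 0 \<le> nn j x" "\<And>x. x \<in> Z j \<Longrightarrow> nn j x = 0 \<longleftrightarrow> x = 0"
    "\<And>c x. x \<in> Z j \<Longrightarrow> nn j (scl c x) = cmod c * nn j x"
    "\<And>x y. x \<in> Z j \<Longrightarrow> y \<in> Z j \<Longrightarrow> nn j (x + y) \<le> nn j x + nn j y"
    unfolding normed_on_def by blast+
qed

lemma Z0_mem: "j \<le> m + 1 \<Longrightarrow> 0 \<in> Z j" "j \<le> m + 1 \<Longrightarrow> nn j 0 = 0"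
  using normed_all(1)[of j] iV.subspace_0 normed_all(3)[of j 0] by auto

lemma enormZ_leD:
  assumes "enormZ C2 ipV D Z nZ j x \<le> ennreal r" "0 \<le> r"
  shows "x \<in> Z j" "nn j x \<le> r"
proof -
  show x: "x \<in> Z j" using assms(1) by (auto simp: enormZ_def enorm_on_def top_unique split: if_splits)
  then show "nn j x \<le> r" using assms by (simp add: enormZ_def enorm_on_def)
qed

lemma opnormZ_leD:
  assumes "opnormZ C2 ipV D Z nZ i j A \<le> ennreal C" "0 \<le> C" "i \<le> m + 1" "j \<le> m + 1" "x \<in> Z i" "A 0 = 0"
  shows "A x \<in> Z j \<and> nn j (A x) \<le> C * nn i x"
proof (cases "nn i x = 0")
  case True
  then show ?thesis using normed_all(3)[OF assms(3,5)] assms(6) Z0_mem[OF assms(4)] by simp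
next
  case False
  then have p: "0 < nn i x" using normed_all(2)[OF assms(3,5)] by simp
  have "enormZ C2 ipV D Z nZ j (A x) \<le> ennreal (C * nn i x)"
    using assms(1) unfolding opnormZ_def
    by (rule opnorm_leD) (use assms(5) p in \<open>simp_all add: enormZ_def enorm_on_def\<close>)
  then show ?thesis using enormZ_leD[of j "A x" "C * nn i x"] assms(2) p by simp
qed

lemma riesz_inj: "inj (riesz C2 ipV)"
proof (rule injI)
  fix x y assume "riesz C2 ipV x = riesz C2 ipV y"
  then have "ip x v = ip y v" for v by (simp add: riesz_def fun_eq_iff)
  then show "x = y" by (intro V.eq_if_ip_eq) auto
qed

lemma riesz_inv_eqI: "(\<And>v. f v = ip G v) \<Longrightarrow> riesz_inv C2 ipV f = G"
proof -
  assume "\<And>v. f v = ip G v"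
  then have "f = riesz C2 ipV G" by (simp add: riesz_def fun_eq_iff)
  then show ?thesis using riesz_inj by simp
qed

lemma Pi0V_eq: "Pi0V C2 ipV H D = pr.proj0"
  by (rule ext) (simp add: Pi0V_def pr.proj0_def)

lemma riesz_E: "\<exists>G. riesz_inv C2 ipV (E u) = G \<and> (\<forall>v. E u v = ip G v)"
proof -
  have "E u \<in> antidual scl UNIV (hnorm ip)"
    by (rule V.antidualI[where K = "hnorm ip u"]) (simp_all add: pr.E_simps pr.E_bound)
  from V.riesz_representation[OF this] obtain G where "\<forall>v\<in>UNIV. ip G v = E u v" by blast
  then have "\<forall>v. E u v = ip G v" by simp
  then show ?thesis using riesz_inv_eqI[of "E u" G] by blast
qed

lemma ip_proj0: "z \<in> N \<Longrightarrow> ip (pr.proj0 G) z = ip G z"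
  using pr.Q_perp[of G] unfolding pr.perp_def pr.Q_def by (simp add: pr.ip_simps)

lemma E00_ip: "v \<in> N \<Longrightarrow> E00 C2 ipV H D E v \<in> N"
  "v \<in> N \<Longrightarrow> z \<in> N \<Longrightarrow> ip (E00 C2 ipV H D E v) z = E v z"
proof -
  obtain G where G: "riesz_inv C2 ipV (E v) = G" "\<forall>w. E v w = ip G w" using riesz_E by blast
  assume v: "v \<in> N"
  have eq: "E00 C2 ipV H D E v = pr.proj0 G"
    unfolding E00_def Pi0V_eq pr.proj0_N_id[OF v] G(1) ..
  show "E00 C2 ipV H D E v \<in> N" unfolding eq by (rule pr.proj0_N)
  show "z \<in> N \<Longrightarrow> ip (E00 C2 ipV H D E v) z = E v z" unfolding eq by (simp add: ip_proj0 G(2))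
qed

text \<open>
  \<open>E00\<close> represents \<open>E\<close> on the kernel, so inverting it amounts to the defining equation of the oblique
  projection.
\<close>

lemma Pi0_eq: "Pi0 C2 ipV H D E = pr.pi0"
proof
  fix v
  obtain G where G: "riesz_inv C2 ipV (E v) = G" "\<forall>w. E v w = ip G w" using riesz_E by blast
  have inj: "inj_on (E00 C2 ipV H D E) N"
  proof (rule inj_onI)
    fix x y assume x: "x \<in> N" and y: "y \<in> N" and eq: "E00 C2 ipV H D E x = E00 C2 ipV H D E y"
    show "x = y"
    proof (rule pr.E_N_eqI[OF x y])
      fix z assume "z \<in> N"
      then show "E x z = E y z" using E00_ip(2)[OF x, of z] E00_ip(2)[OF y, of z] eq by simp
    qed
  qed
  have "E00 C2 ipV H D E (pr.pi0 v) = pr.proj0 G"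
  proof (rule pr.N.eq_if_ip_eq)
    show "E00 C2 ipV H D E (pr.pi0 v) \<in> N" by (rule E00_ip(1)[OF pr.pi0_N])
    show "pr.proj0 G \<in> N" by (rule pr.proj0_N)
    show "ip (E00 C2 ipV H D E (pr.pi0 v)) z = ip (pr.proj0 G) z" if "z \<in> N" for z
      using that by (simp add: E00_ip(2)[OF pr.pi0_N] ip_proj0 pr.E_pi0 G(2))
  qed
  then show "Pi0 C2 ipV H D E v = pr.pi0 v"
    unfolding Pi0_def Pi0V_eq G(1) using the_inv_into_f_f[OF inj pr.pi0_N, of v] by simp
qed

lemma Pi1_eq: "Pi1 C2 ipV H D E = pr.pi1"
  by (rule ext) (simp add: Pi1_def pr.pi1_def Pi0_eq)

text \<open>
  The three versions of \<open>D\<close> vanish when one argument lies in the kernel, so both projections \<open>\<Pi>\<^sub>1\<close> can be dropped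
  and the supremum is at most the norm of the representer.
\<close>

lemma elliptic_regularity:
  assumes D': "D' \<in> {D, op_adj D, op_Re D}" and j: "j + 2 \<le> m + 1" and u: "u \<in> H"
    and F: "F \<in> Z j" "\<And>v. v \<in> H \<Longrightarrow> D' u v = ip F v"
    and p: "p \<in> N" "\<And>z. z \<in> N \<Longrightarrow> E p z = E u z"
  shows "u - p \<in> Z (j + 2) \<and> nn (j + 2) (u - p) \<le> Creg' * (hnorm ip (u - p) + nn j F)"
proof -
  have jm: "j \<le> m + 1" using j by simp
  have up: "u - p = pr.pi1 u" using pr.pi0_eqI[OF p] by (simp add: pr.pi1_def)
  have sesq': "sesquilinear_on scl H D'"
    using D' D_sesq iV.sesquilinear_op_adj[OF D_sesq]
    by (auto intro!: iV.sesquilinear_onI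
        simp: op_Re_def op_adj_def iV.sesq_add[OF D_sesq] iV.sesq_scl[OF D_sesq] algebra_simps add_divide_distrib)
  have ker': "D' z v = 0" "D' v z = 0" if "z \<in> N" "v \<in> H" for z v
    using D' D_N[OF that] by (auto simp: op_Re_def op_adj_def)
  have DD: "D' (pr.pi1 u) (pr.pi1 v) = ip F v" if v: "v \<in> H" for v
  proof -
    have "D' (pr.pi1 u) (pr.pi1 v) = D' u (pr.pi1 v) - D' (pr.pi0 u) (pr.pi1 v)"
      unfolding pr.pi1_def[of u]
      by (rule iV.sesq_diff(1)[OF sesq' iH.subspaceX u pr.pi0_H pr.pi1_H[OF v]])
    also have "\<dots> = D' u (pr.pi1 v)" by (simp add: ker' pr.pi0_N pr.pi1_H[OF v])
    also have "\<dots> = D' u v - D' u (pr.pi0 v)"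
      unfolding pr.pi1_def by (rule iV.sesq_diff(2)[OF sesq' iH.subspaceX v pr.pi0_H u])
    finally show ?thesis by (simp add: ker' pr.pi0_N u F(2)[OF v])
  qed
  have F0: "0 \<le> nn j F" by (rule normed_all(2)[OF jm F(1)])
  have sup: "(SUP v \<in> {v \<in> H. dual_norm (Z j) (nn j) (riesz C2 ipV v) = 1}.
      ennreal (cmod (D' (pr.pi1 u) (pr.pi1 v)))) \<le> ennreal (nn j F)"
  proof (rule SUP_least)
    fix v assume v: "v \<in> {v \<in> H. dual_norm (Z j) (nn j) (riesz C2 ipV v) = 1}"
    have "cmod (ip F v) \<le> nn j F"
    proof (cases "nn j F = 0")
      case True
      then have "F = 0" using normed_all(3)[OF jm F(1)] by simp
      then show ?thesis using F0 by (simp add: pr.ip_simps)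
    next
      case False
      then have "cmod (riesz C2 ipV v F) \<le> 1 * nn j F"
        using v F(1) F0 by (intro dual_norm_leD[of "Z j" "nn j"]) auto
      then show ?thesis using V.herm[of v F] by (simp add: riesz_def)
    qed
    then show "ennreal (cmod (D' (pr.pi1 u) (pr.pi1 v))) \<le> ennreal (nn j F)"
      using v DD by (intro ennreal_leI) simp
  qed
  have "\<forall>D'\<in>{D, op_adj D, op_Re D}. \<forall>j\<in>{2..m+1}. \<forall>u\<in>H.
        enormZ C2 ipV D Z nZ j (Pi1 C2 ipV H D E u) \<le>
          ennreal Creg * (ennreal (normV C2 ipV (Pi1 C2 ipV H D E u)) +
            (SUP v \<in> {v \<in> H. dual_norm (Z (j-2)) (normZ C2 ipV D nZ (j-2)) (riesz C2 ipV v) = 1}.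
               ennreal (cmod (D' (Pi1 C2 ipV H D E u) (Pi1 C2 ipV H D E v)))))"
    using A2 unfolding assumption2_def by blast
  from this[rule_format, OF D', of "j + 2", OF _ u] j
  have "enormZ C2 ipV D Z nZ (j+2) (pr.pi1 u) \<le>
          ennreal Creg * (ennreal (normV C2 ipV (pr.pi1 u)) +
            (SUP v \<in> {v \<in> H. dual_norm (Z j) (nn j) (riesz C2 ipV v) = 1}.
               ennreal (cmod (D' (pr.pi1 u) (pr.pi1 v)))))"
    by (simp add: Pi1_eq)
  also have "\<dots> \<le> ennreal Creg * (ennreal (normV C2 ipV (pr.pi1 u)) + ennreal (nn j F))"
    by (intro mult_left_mono add_left_mono sup) simp
  also have "\<dots> = ennreal (Creg * (hnorm ip (pr.pi1 u) + nn j F))"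
    using F0 Creg_le by (simp add: hnorm_ip[symmetric] ennreal_mult ennreal_plus[symmetric] del: ennreal_plus)
  finally have le: "enormZ C2 ipV D Z nZ (j+2) (pr.pi1 u) \<le> ennreal (Creg * (hnorm ip (pr.pi1 u) + nn j F))" .
  have nonneg: "0 \<le> hnorm ip (pr.pi1 u) + nn j F" using F0 by simp
  have "Creg * (hnorm ip (pr.pi1 u) + nn j F) \<le> Creg' * (hnorm ip (pr.pi1 u) + nn j F)"
    using Creg_le(2) nonneg by (rule mult_right_mono)
  then show ?thesis
    using enormZ_leD[OF le] nonneg Creg_le(1) unfolding up by fastforce
qed

lemma regular_P: "regular K \<alpha> Cd Creg' L m scl (innerV C2 ipV) H (op_ker H D) (innerH C2 ipV D) D E Z (normZ C2 ipV D nZ)"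
proof unfold_locales
  show "Z 0 = UNIV" "nn 0 = hnorm ip" "Z 1 = H" "nn 1 = hnorm a" by (rule Z01)+
  show "iV.subspace (Z j)" if "j \<le> m + 1" for j by (rule normed_all(1)[OF that])
  show "0 \<le> nn j x" if "j \<le> m + 1" "x \<in> Z j" for j x by (rule normed_all(2)[OF that])
  show "nn j (x + y) \<le> nn j x + nn j y" if "j \<le> m + 1" "x \<in> Z j" "y \<in> Z j" for j x y
    by (rule normed_all(5)[OF that])
  show "nn j (scl c x) = cmod c * nn j x" if "j \<le> m + 1" "x \<in> Z j" for j x c
    by (rule normed_all(4)[OF that])
  have Cx: "Creg * nn j x \<le> Creg' * nn j x" if "j \<le> m + 1" "x \<in> Z j" for j x
    using Creg_le(2) normed_all(2)[OF that] by (rule mult_right_mono)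
  have proj: "pr.proj0 x \<in> Z j \<and> nn j (pr.proj0 x) \<le> Creg' * nn j x"
    if j: "1 \<le> j" "j \<le> m + 1" and x: "x \<in> Z j" for j x
  proof -
    have "\<forall>j\<in>{1..m+1}. opnormZ C2 ipV D Z nZ j j (Pi0V C2 ipV H D) \<le> ennreal Creg"
      using A2 unfolding assumption2_def by blast
    then have "opnormZ C2 ipV D Z nZ j j pr.proj0 \<le> ennreal Creg" using j by (simp add: Pi0V_eq)
    from opnormZ_leD[OF this _ j(2) j(2) x] Creg_le(1) pr.proj0_N_id[OF pr.N.X_0]
    show ?thesis using Cx[OF j(2) x] by force
  qed
  then show "orth_proj ip N x \<in> Z j \<and> nn j (orth_proj ip N x) \<le> Creg' * nn j x"
    if "1 \<le> j" "j \<le> m + 1" "x \<in> Z j" for j x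
    using that by (simp add: pr.proj0_def)
  show "u - p \<in> Z (j + 2) \<and> nn (j + 2) (u - p) \<le> Creg' * (hnorm ip (u - p) + nn j F)"
    if "j + 2 \<le> m + 1" "u \<in> H" "F \<in> Z j" "\<And>v. v \<in> H \<Longrightarrow> D u v = ip F v"
      "p \<in> N" "\<And>z. z \<in> N \<Longrightarrow> E p z = E u z" for j u F p
    by (rule elliptic_regularity[of D, OF _ that]) simp
  show "u - p \<in> Z (j + 2) \<and> nn (j + 2) (u - p) \<le> Creg' * (hnorm ip (u - p) + nn j F)"
    if "j + 2 \<le> m + 1" "u \<in> H" "F \<in> Z j" "\<And>v. v \<in> H \<Longrightarrow> (D u v + cnj (D v u)) / 2 = ip F v"
      "p \<in> N" "\<And>z. z \<in> N \<Longrightarrow> E p z = E u z" for j u F p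
    by (rule elliptic_regularity[of "op_Re D"]) (use that in \<open>simp_all add: op_Re_def op_adj_def\<close>)
  show "G \<in> Z j \<and> nn j G \<le> Creg' * nn j u"
    if j: "1 \<le> j" "j \<le> m + 1" and u: "u \<in> Z j" and G: "\<And>v. E u v = ip G v" for j u G
  proof -
    have "\<forall>E'\<in>{E, op_adj E, op_Re E}. \<forall>j\<in>{1..m+1}.
        opnormZ C2 ipV D Z nZ j j (\<lambda>u. riesz_inv C2 ipV (E' u)) \<le> ennreal Creg"
      using A2 unfolding assumption2_def by blast
    then have op: "opnormZ C2 ipV D Z nZ j j (\<lambda>u. riesz_inv C2 ipV (E u)) \<le> ennreal Creg" using j by simp
    have "riesz_inv C2 ipV (E 0) = 0" by (rule riesz_inv_eqI) (simp add: pr.E_simps pr.ip_simps)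
    from opnormZ_leD[OF op _ j(2) j(2) u this] Creg_le(1)
    show ?thesis using Cx[OF j(2) u] unfolding riesz_inv_eqI[of "E u", OF G] by force
  qed
  show "z \<in> Z j \<and> nn j z \<le> Creg' * (Creg' * nn j F + hnorm ip z)"
    if j: "1 \<le> j" "j \<le> m + 1" and z: "z \<in> N" and F: "F \<in> Z j"
      and EF: "\<And>z'. z' \<in> N \<Longrightarrow> E z z' = ip F z'" for j z F
  proof -
    obtain G where G: "riesz_inv C2 ipV (E z) = G" "\<forall>w. E z w = ip G w" using riesz_E by blast
    have "pr.proj0 G = pr.proj0 F"
      by (rule pr.N.eq_if_ip_eq[OF pr.proj0_N pr.proj0_N]) (simp add: ip_proj0 EF flip: G(2))
    note pF = proj[OF j F]
    have "\<forall>E'\<in>{E, op_adj E}. \<forall>j\<in>{1..m+1}. \<forall>u.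
        enormZ C2 ipV D Z nZ j (Pi0V C2 ipV H D u) \<le>
          ennreal Creg *
            (enormZ C2 ipV D Z nZ j
               (Pi0V C2 ipV H D (riesz_inv C2 ipV (E' (Pi0V C2 ipV H D u)))) +
             ennreal (normV C2 ipV (Pi0V C2 ipV H D u)))"
      using A2 unfolding assumption2_def by blast
    from this[rule_format, of E j z] j
    have "enormZ C2 ipV D Z nZ j z \<le> ennreal Creg * (enormZ C2 ipV D Z nZ j (pr.proj0 G) + ennreal (normV C2 ipV z))"
      by (simp add: Pi0V_eq pr.proj0_N_id[OF z] G(1))
    also have "enormZ C2 ipV D Z nZ j (pr.proj0 G) = ennreal (nn j (pr.proj0 F))"
      using pF by (simp add: \<open>pr.proj0 G = pr.proj0 F\<close> enormZ_def enorm_on_def)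
    also have "ennreal Creg * (ennreal (nn j (pr.proj0 F)) + ennreal (normV C2 ipV z)) =
        ennreal (Creg * (nn j (pr.proj0 F) + hnorm ip z))"
      using Creg_le normed_all(2)[OF j(2)] pF
      by (simp add: hnorm_ip[symmetric] ennreal_mult ennreal_plus[symmetric] del: ennreal_plus)
    finally have le: "enormZ C2 ipV D Z nZ j z \<le> ennreal (Creg * (nn j (pr.proj0 F) + hnorm ip z))" .
    have nonneg: "0 \<le> nn j (pr.proj0 F) + hnorm ip z" using normed_all(2)[OF j(2)] pF by simp
    have "Creg * (nn j (pr.proj0 F) + hnorm ip z) \<le> Creg' * (nn j (pr.proj0 F) + hnorm ip z)"
      using Creg_le(2) nonneg by (rule mult_right_mono)
    also have "\<dots> \<le> Creg' * (Creg' * nn j F + hnorm ip z)"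
      using pF Creg by (intro mult_left_mono add_right_mono) auto
    finally show ?thesis using enormZ_leD[OF le] nonneg Creg_le(1) by fastforce
  qed
  show "x \<in> Z j \<and> nn j x \<le> L * nn (j + 1) x" if j: "j \<le> m" and x: "x \<in> Z (j + 1)" for j x
  proof
    have "\<forall>j\<in>{1..m+1}. continuously_included (Z j) (nn j) (Z (j-1)) (nn (j-1))"
      using A2 unfolding assumption2_def by blast
    then have "Z (j + 1) \<subseteq> Z (j + 1 - 1)" using j unfolding continuously_included_def by force
    then show "x \<in> Z j" using x by auto
    show "nn j x \<le> L * nn (j + 1) x" using incl'[of "j + 1" x] j x by simp
  qed
qed

end

section \<open>Solvable operators and extended real norms\<close>

lemma innerH_op_adj: "innerH C2 ipV (op_adj D) = innerH C2 ipV D"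
  by (intro ext) (simp add: innerH_def op_Re_def op_adj_def add.commute)

lemma normH_op_adj: "normH C2 ipV (op_adj D) = normH C2 ipV D"
  by (rule ext) (simp add: normH_def op_adj_def)

lemma normZ_op_adj: "normZ C2 ipV (op_adj D) nZ = normZ C2 ipV D nZ"
  by (rule ext) (simp add: normZ_def normH_op_adj)

lemma antidual_mono:
  assumes "\<And>x. x \<in> X \<Longrightarrow> n x \<le> c * n' x" "\<And>x. x \<in> X \<Longrightarrow> 0 \<le> n x"
  shows "antidual scl X n \<subseteq> antidual scl X n'"
proof
  fix f assume f: "f \<in> antidual scl X n"
  then obtain B where B: "\<forall>u\<in>X. cmod (f u) \<le> B * n u" unfolding antidual_def by blast
  have "cmod (f u) \<le> \<bar>B\<bar> * c * n' u" if u: "u \<in> X" for u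
  proof -
    have "cmod (f u) \<le> B * n u" using B u by blast
    also have "\<dots> \<le> \<bar>B\<bar> * n u" using assms(2)[OF u] by (intro mult_right_mono) auto
    also have "\<dots> \<le> \<bar>B\<bar> * (c * n' u)" by (intro mult_left_mono assms(1)[OF u]) auto
    finally show ?thesis by (simp add: mult.assoc)
  qed
  then show "f \<in> antidual scl X n'" using f unfolding antidual_def by blast
qed

context problem
begin

lemma pi0_add: "pi0 (u + v) = pi0 u + pi0 v"
  by (rule pi0_eqI) (simp_all add: N.X_add pi0_N E_simps E_pi0)

lemma pi0_scl: "pi0 (scl c u) = scl c (pi0 u)"
  by (rule pi0_eqI) (simp_all add: N.X_scl pi0_N E_simps E_pi0)

lemma pi0_N_id: "z \<in> N \<Longrightarrow> pi0 z = z"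
  by (rule pi0_eqI) simp_all

lemma antidual_pi0:
  assumes f: "f \<in> antidual scl UNIV nV"
  shows "(\<lambda>v. f (pi0 v)) \<in> antidual scl UNIV nV"
proof -
  from V.antidualD[OF f] obtain B where B: "B \<ge> 0" "\<And>u. cmod (f u) \<le> B * nV u"
    "\<And>u v. f (u + v) = f u + f v" "\<And>c v. f (scl c v) = cnj c * f v" by (metis UNIV_I)
  show ?thesis
  proof (rule V.antidualI[where K = "B / \<alpha>"])
    fix u
    have "cmod (f (pi0 u)) \<le> B * nV (pi0 u)" by (rule B(2))
    also have "\<dots> \<le> B * (nV u / \<alpha>)" by (rule mult_left_mono[OF nV_pi0 B(1)])
    finally show "cmod (f (pi0 u)) \<le> B / \<alpha> * nV u" by simp
  qed (simp_all add: pi0_add pi0_scl B)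
qed

lemma antidual_pi1:
  assumes f: "f \<in> antidual scl UNIV nV" and b: "0 \<le> b" "\<And>v. cmod (f v) \<le> b * nV v"
  shows "(f \<circ> pi1) \<in> antidual scl H nH" "v \<in> H \<Longrightarrow> cmod ((f \<circ> pi1) v) \<le> b * (2 / \<alpha> * K) * nH v"
proof -
  from V.antidualD[OF f] obtain B where B: "B \<ge> 0" "\<And>u. cmod (f u) \<le> B * nV u"
    "\<And>u v. f (u + v) = f u + f v" "\<And>u v. f (u - v) = f u - f v" "\<And>c v. f (scl c v) = cnj c * f v"
    by (metis UNIV_I)
  show le: "cmod ((f \<circ> pi1) v) \<le> b * (2 / \<alpha> * K) * nH v" if v: "v \<in> H" for v
  proof -
    have "cmod (f (pi1 v)) \<le> b * nV (pi1 v)" by (rule b)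
    also have "\<dots> \<le> b * (2 / \<alpha> * (K * nH v))"
    proof (rule mult_left_mono[OF _ b(1)])
      have "nV (pi1 v) \<le> 2 / \<alpha> * nV v" by (rule nV_pi1)
      also have "\<dots> \<le> 2 / \<alpha> * (K * nH v)" using \<alpha> by (intro mult_left_mono embed v) auto
      finally show "nV (pi1 v) \<le> 2 / \<alpha> * (K * nH v)" .
    qed
    finally show ?thesis by (simp add: algebra_simps)
  qed
  show "(f \<circ> pi1) \<in> antidual scl H nH"
    by (rule H.antidualI[OF _ _ le]) (simp_all add: pi1_def pi0_add pi0_scl B algebra_simps)
qed

end

locale solvable_setting = regular_setting K \<alpha> Cd Creg' L m scl ipV H ipH C1 C2 CE P D E Creg Z nZ
  for K \<alpha> Cd Creg' L :: real and m :: nat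
    and scl :: "complex \<Rightarrow> 'v::ab_group_add \<Rightarrow> 'v" and ipV :: "'v \<Rightarrow> 'v \<Rightarrow> complex"
    and H :: "'v set" and ipH :: "'v \<Rightarrow> 'v \<Rightarrow> complex" and C1 C2 CE :: real
    and P D E :: "'v \<Rightarrow> 'v \<Rightarrow> complex"
    and Creg :: real and Z :: "nat \<Rightarrow> 'v set" and nZ :: "nat \<Rightarrow> 'v \<Rightarrow> real" +
  assumes A2': "assumption2 scl ipV H ipH Creg C1 C2 CE m Z nZ (op_adj P) (op_adj D) (op_adj E)"
    and uniq: "f \<in> antidual scl H (hnorm ipH) \<Longrightarrow> \<exists>!u. u \<in> H \<and> (\<forall>v\<in>H. P u v = f v)"
begin

lemma ker_adj: "op_ker H (op_adj D) = op_ker H D"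
  using A1 unfolding assumption1_def by blast

lemma adj_setting: "regular_setting K \<alpha> Cd Creg' L m scl ipV H ipH C1 C2 CE (op_adj P) (op_adj D) (op_adj E) Creg Z nZ"
proof unfold_locales
  show "assumption1 scl ipV H ipH C1 C2 CE (op_adj P) (op_adj D) (op_adj E)"
    using A2' unfolding assumption2_def by blast
  show "normZ C2 ipV (op_adj D) nZ (j-1) x \<le> L * normZ C2 ipV (op_adj D) nZ j x"
    if "1 \<le> j" "j \<le> m + 1" "x \<in> Z j" for j x
    unfolding normZ_op_adj by (rule incl'[OF that])
qed (use emb \<alpha>CE Cd_ge A2' Creg_le in auto)

sublocale adj: regular_setting K \<alpha> Cd Creg' L m scl ipV H ipH C1 C2 CE "op_adj P" "op_adj D" "op_adj E" Creg Z nZ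
  by (rule adj_setting)

sublocale rg: regular K \<alpha> Cd Creg' L m scl "innerV C2 ipV" H "op_ker H D" "innerH C2 ipV D" D E Z "normZ C2 ipV D nZ"
  by (rule regular_P)

lemma regular_adj:
  "regular K \<alpha> Cd Creg' L m scl (innerV C2 ipV) H (op_ker H D) (innerH C2 ipV D) (op_adj D) (op_adj E) Z (normZ C2 ipV D nZ)"
  using adj.regular_P by (simp only: ker_adj innerH_op_adj normZ_op_adj)

lemma P_P: "u \<in> H \<Longrightarrow> v \<in> H \<Longrightarrow> pr.P u v = P u v"
  by (simp add: pr.P_def P_eq)

lemma antidual_H: "antidual scl H (hnorm a) = antidual scl H (hnorm ipH)"
proof
  show "antidual scl H (hnorm a) \<subseteq> antidual scl H (hnorm ipH)"
    unfolding hnorm_a by (rule antidual_mono[OF normH_upper]) (simp_all add: HS.nrm_ge_0 flip: hnorm_a)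
  show "antidual scl H (hnorm ipH) \<subseteq> antidual scl H (hnorm a)"
  proof (rule antidual_mono[where c = "1 / sqrt C1"])
    show "hnorm ipH x \<le> 1 / sqrt C1 * hnorm a x" if "x \<in> H" for x
      unfolding hnorm_a using normH_lower[OF that] C_pos by (simp add: le_divide_eq mult.commute)
  qed (rule iH.nrm_ge_0)
qed

lemma antidual_V: "antidual scl UNIV (hnorm ipV) = antidual scl UNIV (hnorm ip)"
proof
  show "antidual scl UNIV (hnorm ip) \<subseteq> antidual scl UNIV (hnorm ipV)"
    unfolding hnorm_ip by (rule antidual_mono[where c = "sqrt C2"])
      (simp_all add: normV_def iV.nrm_ge_0 C_pos less_imp_le)
  show "antidual scl UNIV (hnorm ipV) \<subseteq> antidual scl UNIV (hnorm ip)"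
    unfolding hnorm_ip by (rule antidual_mono[where c = "1 / sqrt C2"])
      (use C_pos in \<open>simp_all add: normV_def iV.nrm_ge_0\<close>)
qed

lemma P_solvable: "f \<in> antidual scl H (hnorm a) \<Longrightarrow> \<exists>u\<in>H. \<forall>v\<in>H. pr.P u v = f v"
proof -
  assume "f \<in> antidual scl H (hnorm a)"
  then have "f \<in> antidual scl H (hnorm ipH)" by (simp only: antidual_H)
  from ex1_implies_ex[OF uniq[OF this]] obtain u where u: "u \<in> H" "\<forall>v\<in>H. P u v = f v" by blast
  then show ?thesis by (intro bexI[of _ u]) (simp_all add: P_P)
qed

lemma P_inj: "u \<in> H \<Longrightarrow> (\<And>v. v \<in> H \<Longrightarrow> pr.P u v = 0) \<Longrightarrow> u = 0"
proof -
  assume u: "u \<in> H" and 0: "\<And>v. v \<in> H \<Longrightarrow> pr.P u v = 0"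
  have "(\<lambda>_. 0) \<in> antidual scl H (hnorm ipH)" by (rule iH.antidualI[where K = 0]) simp_all
  from uniq[OF this] have ex1: "\<exists>!u. u \<in> H \<and> (\<forall>v\<in>H. P u v = 0)" .
  have "u \<in> H \<and> (\<forall>v\<in>H. P u v = 0)" using u 0 P_P[OF u] by simp
  moreover have "0 \<in> H \<and> (\<forall>v\<in>H. P 0 v = 0)"
    by (simp add: iH.X_0 iV.sesq_zero[OF P_sesq iH.subspaceX])
  ultimately show "u = 0" using ex1 by (rule_tac ex1E[OF ex1]) metis
qed

lemma adjoint_solvable:
  obtains c where "0 \<le> c" "inf_sup H (hnorm a) (op_adj pr.P) c" "inf_sup H (hnorm a) pr.P c"
    "\<And>f. f \<in> antidual scl H (hnorm a) \<Longrightarrow> \<exists>w\<in>H. \<forall>v\<in>H. op_adj pr.P w v = f v"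
proof -
  from HS.surjective_imp_adjoint_inf_sup[OF pr.P_sesq P_solvable]
  obtain c where c: "0 \<le> c" "inf_sup H (hnorm a) (op_adj pr.P) c" by blast
  have ex: "\<exists>w\<in>H. \<forall>v\<in>H. op_adj pr.P w v = f v" if f: "f \<in> antidual scl H (hnorm a)" for f
  proof (rule HS.inf_sup_solvable[OF _ _ c(2) _ f, where K = CP])
    show "sesquilinear_on scl H (op_adj pr.P)" by (rule iV.sesquilinear_op_adj[OF pr.P_sesq])
    show "cmod (op_adj pr.P u v) \<le> CP * hnorm a u * hnorm a v" if "u \<in> H" "v \<in> H" for u v
      using pr.P_bound[OF that(2,1)] by (simp add: op_adj_def algebra_simps)
    show "v = 0" if "v \<in> H" "\<And>u. u \<in> H \<Longrightarrow> op_adj pr.P u v = 0" for v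
      using P_inj[OF that(1)] that(2) by (simp add: op_adj_def)
  qed
  have "inf_sup H (hnorm a) pr.P c"
  proof (rule HS.inf_sup_adjoint[OF c(2,1)])
    fix r assume r: "r \<in> H"
    have "a r \<in> antidual scl H (hnorm a)"
      by (rule HS.antidualI[where K = "hnorm a r"])
        (use r HS.cauchy_schwarz in \<open>simp_all add: HS.ip_add HS.ip_scl\<close>)
    then show "\<exists>w\<in>H. \<forall>u\<in>H. op_adj pr.P w u = a r u" by (rule ex)
  qed
  then show ?thesis using that c ex by blast
qed

text \<open>
  The definition of \<open>op_inv\<close> by unique existence is meaningful here because solvability of \<open>P\<close> entails that of its
  adjoint.
\<close>

lemma op_inv_adjoint:
  assumes f: "f \<in> antidual scl H (hnorm a)"
  shows "op_inv H (op_adj P) f \<in> H" "\<And>v. v \<in> H \<Longrightarrow> op_adj pr.P (op_inv H (op_adj P) f) v = f v"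
proof -
  obtain c where c: "0 \<le> c" "inf_sup H (hnorm a) (op_adj pr.P) c"
    "\<And>f. f \<in> antidual scl H (hnorm a) \<Longrightarrow> \<exists>w\<in>H. \<forall>v\<in>H. op_adj pr.P w v = f v"
    using adjoint_solvable by metis
  have sq: "sesquilinear_on scl H (op_adj pr.P)" by (rule iV.sesquilinear_op_adj[OF pr.P_sesq])
  have PP: "op_adj P u v = op_adj pr.P u v" if "u \<in> H" "v \<in> H" for u v
    using P_P[OF that(2,1)] by (simp add: op_adj_def)
  obtain w where w: "w \<in> H" "\<And>v. v \<in> H \<Longrightarrow> op_adj pr.P w v = f v" using c(3)[OF f] by blast
  have "\<exists>!w. w \<in> H \<and> (\<forall>v\<in>H. op_adj P w v = f v)"
  proof (rule ex1I[of _ w])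
    show "w \<in> H \<and> (\<forall>v\<in>H. op_adj P w v = f v)" using w by (simp add: PP)
    fix w' assume w': "w' \<in> H \<and> (\<forall>v\<in>H. op_adj P w' v = f v)"
    have d: "w' - w \<in> H" using w' w(1) HS.X_diff by blast
    have "hnorm a (w' - w) \<le> c * 0"
    proof (rule inf_supD[OF c(2) d])
      fix v assume v: "v \<in> H"
      have "op_adj pr.P (w' - w) v = op_adj pr.P w' v - op_adj pr.P w v"
        using w' w(1) v by (intro iV.sesq_diff(1)[OF sq iH.subspaceX]) auto
      also have "\<dots> = 0" using w' w(2)[OF v] v by (simp flip: PP)
      finally show "cmod (op_adj pr.P (w' - w) v) \<le> 0 * hnorm a v" by simp
    qed simp
    then have "hnorm a (w' - w) = 0" using HS.nrm_ge_0[OF d] by linarith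
    then show "w' = w" using HS.nrm_eq_0[OF d] by simp
  qed
  from theI'[OF this] have t: "op_inv H (op_adj P) f \<in> H"
    "\<forall>v\<in>H. op_adj P (op_inv H (op_adj P) f) v = f v" unfolding op_inv_def by blast+
  then show "op_inv H (op_adj P) f \<in> H" "\<And>v. v \<in> H \<Longrightarrow> op_adj pr.P (op_inv H (op_adj P) f) v = f v"
    by (simp_all flip: PP)
qed

lemma dual_norm_riesz: "dual_norm UNIV (normV C2 ipV) (riesz C2 ipV g) = ennreal (hnorm ip g)"
proof (rule antisym)
  show "dual_norm UNIV (normV C2 ipV) (riesz C2 ipV g) \<le> ennreal (hnorm ip g)"
    by (rule dual_norm_leI) (simp_all add: riesz_def pr.V_cs flip: hnorm_ip)
  show "ennreal (hnorm ip g) \<le> dual_norm UNIV (normV C2 ipV) (riesz C2 ipV g)"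
  proof (cases "hnorm ip g = 0")
    case False
    have "ennreal (hnorm ip g) = ennreal (cmod (riesz C2 ipV g g) / normV C2 ipV g)"
    proof -
      have "cmod (ip g g) = hnorm ip g * hnorm ip g"
        by (simp only: V.ip_self[OF UNIV_I] norm_of_real power2_eq_square) simp
      then show ?thesis using False by (simp add: riesz_def flip: hnorm_ip)
    qed
    also have "\<dots> \<le> dual_norm UNIV (normV C2 ipV) (riesz C2 ipV g)"
      unfolding dual_norm_def using False by (intro SUP_upper) (simp flip: hnorm_ip)
    finally show ?thesis .
  qed simp
qed

lemma riesz_antidual: "riesz C2 ipV g \<in> antidual scl UNIV (hnorm ip)"
  by (rule V.antidualI[where K = "hnorm ip g"]) (simp_all add: riesz_def pr.ip_simps pr.V_cs)

abbreviation "Madj \<equiv> adj_solution_norm scl C2 ipV H P D E"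

lemma Madj_finite: "Madj < \<infinity>"
proof -
  obtain c where c: "0 \<le> c" "inf_sup H (hnorm a) (op_adj pr.P) c" using adjoint_solvable by metis
  have "Madj \<le> ennreal (K * (c * (2 / \<alpha> * K)))"
    unfolding adj_solution_norm_def opnorm_def
  proof (rule SUP_least)
    fix g assume "g \<in> {x \<in> antidual scl UNIV (normV C2 ipV). dual_norm UNIV (normV C2 ipV) x \<noteq> 0}"
    then have g: "g \<in> antidual scl UNIV (hnorm ip)" and n0: "dual_norm UNIV (normV C2 ipV) g \<noteq> 0"
      by (simp_all add: hnorm_ip)
    obtain G where "\<forall>v\<in>UNIV. ip G v = g v" using V.riesz_representation[OF g] by blast
    then have gG: "g = riesz C2 ipV G" by (simp add: riesz_def fun_eq_iff)
    define b where "b = hnorm ip G"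
    have dn: "dual_norm UNIV (normV C2 ipV) g = ennreal b" unfolding gG b_def by (rule dual_norm_riesz)
    have b0: "0 < b" using n0 dn unfolding b_def by (simp add: ennreal_eq_0_iff not_le)
    have gb: "cmod (g v) \<le> b * hnorm ip v" for v
      unfolding gG b_def riesz_def by (rule pr.V_cs)
    note ad = pr.antidual_pi1[OF g less_imp_le[OF b0] gb]
    define w where "w = op_inv H (op_adj P) (g \<circ> pr.pi1)"
    note w = op_inv_adjoint[OF ad(1), folded w_def]
    have "hnorm ip w \<le> K * hnorm a w" by (rule embed'[OF w(1)])
    also have "\<dots> \<le> K * (c * (b * (2 / \<alpha> * K)))"
    proof (rule mult_left_mono)
      show "hnorm a w \<le> c * (b * (2 / \<alpha> * K))"
        by (rule inf_supD[OF c(2) w(1)]) (use b0 \<alpha> K w(2) ad(2) in auto)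
    qed (use K in simp)
    finally have "hnorm ip w / b \<le> K * (c * (2 / \<alpha> * K))" using b0 by (simp add: divide_le_eq algebra_simps)
    then have "ennreal (hnorm ip w / b) \<le> ennreal (K * (c * (2 / \<alpha> * K)))" by (rule ennreal_leI)
    then show "enorm_on UNIV (normV C2 ipV) (op_inv H (op_adj P) (g \<circ> Pi1 C2 ipV H D E)) /
        dual_norm UNIV (normV C2 ipV) g \<le> ennreal (K * (c * (2 / \<alpha> * K)))"
      unfolding dn Pi1_eq w_def[symmetric] using b0 by (simp add: enorm_on_def divide_ennreal flip: hnorm_ip)
  qed
  also have "\<dots> < \<infinity>" by simp
  finally show ?thesis .
qed

text \<open>
  If \<open>g\<close> is orthogonal to the kernel, composing its functional with \<open>\<Pi>\<^sub>1\<close> changes nothing, so the norm of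
  \<open>(P\<^sup>*)\<^sup>-\<^sup>1 \<Pi>\<^sub>1\<^sup>*\<close> governs the plain adjoint problem.
\<close>

lemma dual_problem:
  assumes M: "Madj = ennreal Mr" "0 \<le> Mr" and g: "pr.perp g"
  shows "\<exists>w\<in>H. (\<forall>v\<in>H. pr.P v w = ip v g) \<and> hnorm ip w \<le> Mr * hnorm ip g"
proof -
  have ad: "riesz C2 ipV g \<circ> pr.pi1 \<in> antidual scl H (hnorm a)"
    by (rule pr.antidual_pi1(1)[OF riesz_antidual, of "hnorm ip g"]) (simp_all add: riesz_def pr.V_cs)
  define w where "w = op_inv H (op_adj P) (riesz C2 ipV g \<circ> pr.pi1)"
  note w = op_inv_adjoint[OF ad, folded w_def]
  have wv: "pr.P v w = ip v g" if v: "v \<in> H" for v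
  proof -
    have "cnj (pr.P v w) = ip g (pr.pi1 v)" using w(2)[OF v] by (simp add: op_adj_def riesz_def)
    also have "\<dots> = ip g v" using g pr.pi0_N[of v] unfolding pr.perp_def pr.pi1_def by (simp add: pr.ip_simps)
    finally have "pr.P v w = cnj (ip g v)" by (metis complex_cnj_cnj)
    also have "\<dots> = ip v g" by (rule V.herm[symmetric]) auto
    finally show ?thesis .
  qed
  moreover have "hnorm ip w \<le> Mr * hnorm ip g"
  proof (cases "hnorm ip g = 0")
    case True
    then have "g = 0" using V.nrm_eq_0[of g] by simp
    obtain c where c: "inf_sup H (hnorm a) (op_adj pr.P) c" using adjoint_solvable by metis
    have "hnorm a w \<le> c * 0"
      by (rule inf_supD[OF c w(1)]) (simp_all add: op_adj_def wv \<open>g = 0\<close> pr.ip_simps)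
    then show ?thesis using embed'[OF w(1)] True K HS.nrm_ge_0[OF w(1)] by simp
  next
    case False
    then have p: "0 < hnorm ip g" using pr.nV_ge_0[of g] by linarith
    have "enorm_on UNIV (normV C2 ipV) (op_inv H (op_adj P) (riesz C2 ipV g \<circ> Pi1 C2 ipV H D E))
        \<le> ennreal (Mr * hnorm ip g)"
    proof (rule opnorm_leD[OF eq_refl[OF M(1)[unfolded adj_solution_norm_def]] _ _ p])
      show "riesz C2 ipV g \<in> antidual scl UNIV (normV C2 ipV)" by (rule riesz_antidual[unfolded hnorm_ip])
    qed (rule dual_norm_riesz)
    then have le: "ennreal (hnorm ip w) \<le> ennreal (Mr * hnorm ip g)"
      unfolding Pi1_eq w_def[symmetric] by (simp add: enorm_on_def hnorm_ip)
    then show ?thesis using M(2) p by simp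
  qed
  ultimately show ?thesis using w(1) by blast
qed

end

context regular_setting
begin

lemma gamma_dv_div_stable:
  assumes X: "X \<subseteq> H" and g: "gamma_dv C2 ipV H D E X \<le> ennreal (1/4)"
  shows "div_stable (hnorm (innerV C2 ipV)) (hnorm (innerH C2 ipV D)) (op_ker H D) E X"
  unfolding div_stable_def
proof (intro ballI impI)
  fix w p assume w: "w \<in> X" "\<forall>k\<in>X \<inter> N. E w k = 0" and p: "p \<in> N" "\<forall>z\<in>N. E p z = E w z"
  have wH: "w \<in> H" using w(1) X by blast
  have pw: "pr.pi0 w = p" using p by (intro pr.pi0_eqI) auto
  show "hnorm ip p \<le> 1/4 * hnorm a w"
  proof (cases "w = 0")
    case True
    then have "p = 0" unfolding pw[symmetric] by (intro pr.pi0_eq_0) (simp add: pr.E_simps)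
    then show ?thesis using HS.nrm_ge_0[OF wH] V.nrm_zero by simp
  next
    case False
    then have "0 < hnorm a w" using HS.nrm_eq_0[OF wH] HS.nrm_ge_0[OF wH] by linarith
    have "ennreal (normV C2 ipV (Pi0 C2 ipV H D E w) / normH C2 ipV D w) \<le> gamma_dv C2 ipV H D E X"
      unfolding gamma_dv_def using w False by (intro SUP_upper) simp
    also have "\<dots> \<le> ennreal (1/4)" by (rule g)
    finally have "hnorm ip p / hnorm a w \<le> 1/4"
      by (simp add: Pi0_eq pw flip: hnorm_ip hnorm_a)
    then show ?thesis using \<open>0 < hnorm a w\<close> by (simp add: divide_le_eq)
  qed
qed

end

context solvable_setting
begin

text \<open>
  The smallness condition makes the approximation constant finite, and solvability of the adjoint does so for \<open>Madj\<close>, so the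
  estimates can be proved for real numbers and transferred back.
\<close>

theorem galerkin_estimates:
  assumes sub: "module.subspace scl X"
    and cl: "closedin (Metric_space.mtopology H (dist_on H (hnorm ipH))) X"
    and small: "gamma_dv C2 ipV H D E X + gamma_dv C2 ipV H (op_adj D) (op_adj E) X +
        (approx_norm C2 ipV D m Z nZ X)\<^sup>2 * (1 + Madj) \<le> ennreal csmall"
  obtains \<eta> Mr where "0 \<le> \<eta>" "0 \<le> Mr" "approx_norm C2 ipV D m Z nZ X = ennreal \<eta>" "Madj = ennreal Mr"
    "\<And>u. u \<in> H \<Longrightarrow> \<exists>!uh. galerkin P X u uh"
    "\<And>u uh. u \<in> H \<Longrightarrow> galerkin P X u uh \<Longrightarrow> u - uh \<in> H \<and>
       normH C2 ipV D (u - uh) \<le> Cerr * (1 + \<eta> * (1 + Mr)) * normH C2 ipV D (u - Pi_h C2 ipV D X u)"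
    "\<And>u. u \<in> H \<Longrightarrow> u - Pi_h C2 ipV D X u \<in> H"
    "\<And>u. u \<in> Z (m+1) \<Longrightarrow> normH C2 ipV D (u - Pi_h C2 ipV D X u) \<le> \<eta> * nn (m+1) u"
proof -
  note clX = hilbert_space_closedin[OF iH.hilbert_space_axioms sub cl]
  have XH: "X \<subseteq> H" by (rule clX(1))
  interpret X: hilbert_space scl X a
  proof (rule hilbert_space_equivalent_norm[OF clX(2)])
    show "inner_space scl X a"
    proof
      show "iV.subspace X" by (rule sub)
      show "sesquilinear_on scl X a" by (rule sesquilinear_on_subset[OF HS.sesq XH])
      show "a v u = cnj (a u v)" if "u \<in> X" "v \<in> X" for u v using that XH by (intro HS.herm) auto
      show "0 < Re (a u u)" if "u \<in> X" "u \<noteq> 0" for u using that XH by (intro HS.pos) auto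
    qed
    show "0 < sqrt C1" "0 < sqrt (C2 + 2 * (K\<^sup>2 * C1))" using C_pos K by (simp_all add: add_pos_nonneg)
    show "sqrt C1 * hnorm ipH x \<le> hnorm a x" if "x \<in> X" for x
      unfolding hnorm_a using that XH by (intro normH_lower) auto
    show "hnorm a x \<le> sqrt (C2 + 2 * (K\<^sup>2 * C1)) * hnorm ipH x" if "x \<in> X" for x
      unfolding hnorm_a using that XH by (intro normH_upper) auto
  qed
  define eta where "eta = approx_norm C2 ipV D m Z nZ X"
  define Mr where "Mr = enn2real Madj"
  have Mr: "0 \<le> Mr" "Madj = ennreal Mr" using Madj_finite by (simp_all add: Mr_def)
  have g1: "gamma_dv C2 ipV H D E X \<le> ennreal csmall"
    by (rule order_trans[OF _ small]) (simp add: add_increasing2)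
  have g2: "gamma_dv C2 ipV H (op_adj D) (op_adj E) X \<le> ennreal csmall"
    by (rule order_trans[OF _ small]) (simp add: add_increasing2 add_increasing)
  have g3: "eta\<^sup>2 * (1 + Madj) \<le> ennreal csmall"
    unfolding eta_def by (rule order_trans[OF _ small]) simp
  have c4: "ennreal csmall \<le> ennreal (1/4)" unfolding csmall_def by (rule ennreal_leI) (rule min.cobounded1)
  have div: "div_stable (hnorm ip) (hnorm a) N E X"
    by (rule gamma_dv_div_stable[OF XH order_trans[OF g1 c4]])
  have div': "div_stable (hnorm ip) (hnorm a) N (op_adj E) X"
    using adj.gamma_dv_div_stable[OF XH order_trans[OF g2 c4]] by (simp only: ker_adj innerH_op_adj)
  have "eta \<noteq> \<infinity>"
  proof
    assume "eta = \<infinity>"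
    then have "eta\<^sup>2 * (1 + Madj) = \<infinity>" by (simp add: power2_eq_square ennreal_top_mult)
    then show False using g3 by (simp add: top_unique)
  qed
  define \<eta> where "\<eta> = enn2real eta"
  have \<eta>: "0 \<le> \<eta>" "eta = ennreal \<eta>" using \<open>eta \<noteq> \<infinity>\<close> by (simp_all add: \<eta>_def less_top)
  have small_real: "\<eta>\<^sup>2 * (1 + Mr) \<le> csmall"
  proof -
    have "eta\<^sup>2 * (1 + Madj) = ennreal (\<eta>\<^sup>2 * (1 + Mr))"
      using \<eta> Mr by (simp add: ennreal_power ennreal_mult ennreal_plus)
    then show ?thesis using g3 csmall_pos by simp
  qed
  have proj: "Pi_h C2 ipV D X u \<in> X" if "u \<in> H" for u
    unfolding Pi_h_def by (rule HS.orth_proj(1)[OF X.hilbert_space_axioms XH that])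
  have projH: "u - Pi_h C2 ipV D X u \<in> H" if "u \<in> H" for u
    using proj[OF that] XH that HS.X_diff by blast
  have proj0: "Pi_h C2 ipV D X 0 = 0"
    unfolding Pi_h_def
    by (rule HS.orth_proj_eqI[OF X.hilbert_space_axioms XH HS.X_0 X.X_0]) (use XH HS.ip_zero in auto)
  have appr: "normH C2 ipV D (u - Pi_h C2 ipV D X u) \<le> \<eta> * nn (m+1) u" if u: "u \<in> Z (m+1)" for u
  proof -
    have "opnormZ C2 ipV D Z nZ (m+1) 1 (\<lambda>v. v - Pi_h C2 ipV D X v) \<le> ennreal \<eta>"
      using \<eta>(2) unfolding eta_def approx_norm_def by simp
    then have "u - Pi_h C2 ipV D X u \<in> Z 1 \<and> nn 1 (u - Pi_h C2 ipV D X u) \<le> \<eta> * nn (m+1) u"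
      by (rule opnormZ_leD[OF _ \<eta>(1) order_refl _ u]) (simp_all add: proj0)
    then show ?thesis unfolding Z01 hnorm_a by blast
  qed
  have ZH: "Z (m+1) \<subseteq> H" using rg.incl_iter[of 1 "m+1"] Z01 by auto
  obtain c where c: "0 \<le> c" "inf_sup H (hnorm a) pr.P c" using adjoint_solvable by metis
  have approx: "\<exists>x'\<in>X. hnorm a (x - x') \<le> \<eta> * nn (m+1) x" if x: "x \<in> Z (m+1)" for x
    using appr[OF x] proj[of x] x ZH by (intro bexI[of _ "Pi_h C2 ipV D X x"]) (auto simp: hnorm_a)
  note wp = rg.galerkin_well_posed[OF regular_adj X.hilbert_space_axioms XH div div' \<eta>(1) Mr(1) approx
      dual_problem[OF Mr(2,1)] P_solvable c(2,1) small_real]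
  have gal: "galerkin P X u uh \<longleftrightarrow> uh \<in> X \<and> (\<forall>v\<in>X. pr.P (u - uh) v = 0)" if u: "u \<in> H" for u uh
  proof -
    have "pr.P (u - uh) v = P (u - uh) v" if "uh \<in> X" "v \<in> X" for v
      using that XH u HS.X_diff by (intro P_P) auto
    then show ?thesis unfolding galerkin_def by auto
  qed
  show ?thesis
  proof (rule that[OF \<eta>(1) Mr(1) \<eta>(2)[unfolded eta_def] Mr(2) _ _ projH appr])
    show "\<exists>!uh. galerkin P X u uh" if u: "u \<in> H" for u
      unfolding gal[OF u] by (rule wp(1)[OF _ _ _ u])
    show "u - uh \<in> H \<and> normH C2 ipV D (u - uh) \<le>
        Cerr * (1 + \<eta> * (1 + Mr)) * normH C2 ipV D (u - Pi_h C2 ipV D X u)"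
      if u: "u \<in> H" and g: "galerkin P X u uh" for u uh
    proof
      have uh: "uh \<in> X" "\<And>v. v \<in> X \<Longrightarrow> pr.P (u - uh) v = 0" using g unfolding gal[OF u] by blast+
      show "u - uh \<in> H" using uh(1) XH u HS.X_diff by blast
      show "normH C2 ipV D (u - uh) \<le>
        Cerr * (1 + \<eta> * (1 + Mr)) * normH C2 ipV D (u - Pi_h C2 ipV D X u)"
        using wp(2)[OF _ _ _ u uh proj[OF u]] by (simp only: hnorm_a)
    qed
  qed
qed

text \<open>
  In the first case \<open>F' = F\<close>. In the second, \<open>F'\<close> represents \<open>f \<circ> \<Pi>\<^sub>0\<close>, which agrees with \<open>f\<close> on the
  kernel and equals the image of \<open>F\<close> under the given smoothing map.
\<close>

theorem oscillating_data_regularity: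
  assumes Cosc: "0 < Cosc" "0 < CPi" and f: "f \<in> antidual scl UNIV (hnorm ipV)"
    and u: "u \<in> H" and Pu: "\<forall>v\<in>H. P u v = f v"
    and data: "enormZ C2 ipV D Z nZ (m+1) (riesz_inv C2 ipV f)
                \<le> ennreal Cosc * dual_norm H (normH C2 ipV D) f \<or>
              (\<exists>Pi0t. (\<forall>v. f (Pi0 C2 ipV H D E v) = f (Pi0t v)) \<and>
                 opnormZ C2 ipV D Z nZ (m-1) (m+1)
                   (\<lambda>w. riesz_inv C2 ipV (riesz C2 ipV w \<circ> Pi0t)) \<le> ennreal CPi \<and>
                 enormZ C2 ipV D Z nZ (m-1) (riesz_inv C2 ipV f)
                   \<le> ennreal Cosc * dual_norm H (normH C2 ipV D) f)"
  shows "u \<in> Z (m+1) \<and> nn (m+1) u \<le> sig (m+1) * (cdata * (cb Cosc CPi * normH C2 ipV D u))"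
proof -
  have f': "f \<in> antidual scl UNIV (hnorm ip)" using f by (simp only: antidual_V)
  obtain F where "\<forall>v\<in>UNIV. ip F v = f v" using V.riesz_representation[OF f'] by blast
  then have F: "\<And>v. ip F v = f v" by simp
  have fF: "riesz_inv C2 ipV f = F" by (rule riesz_inv_eqI) (simp add: F)
  have PF: "pr.P u v = ip F v" if "v \<in> H" for v using Pu that by (simp add: P_P[OF u that] F)
  define U where "U = normH C2 ipV D u"
  have U0: "0 \<le> U" unfolding U_def hnorm_a[symmetric] by (rule HS.nrm_ge_0[OF u])
  have UC: "0 \<le> Cosc * CP * U" using U0 CP_ge_0 Cosc by simp
  have dn: "ennreal Cosc * dual_norm H (normH C2 ipV D) f \<le> ennreal (Cosc * CP * U)"
  proof -
    have "dual_norm H (normH C2 ipV D) f \<le> ennreal (CP * U)"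
    proof (rule dual_norm_leI)
      fix v assume v: "v \<in> H"
      show "cmod (f v) \<le> CP * U * normH C2 ipV D v"
        using pr.P_bound[OF u v] PF[OF v] by (simp add: F U_def hnorm_a)
      show "0 \<le> normH C2 ipV D v" unfolding hnorm_a[symmetric] by (rule HS.nrm_ge_0[OF v])
    qed
    then have "ennreal Cosc * dual_norm H (normH C2 ipV D) f \<le> ennreal Cosc * ennreal (CP * U)"
      by (rule mult_left_mono) simp
    also have "\<dots> = ennreal (Cosc * CP * U)"
      using Cosc U0 CP_ge_0 by (simp add: ennreal_mult mult.assoc)
    finally show ?thesis .
  qed
  have parts: "U \<le> cb Cosc CPi * U" "Cosc * CP * U \<le> cb Cosc CPi * U"
    "L ^ (m+1) * (Cosc * CP * U) \<le> cb Cosc CPi * U" "CPi * (Cosc * CP * U) \<le> cb Cosc CPi * U"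
  proof -
    have "0 \<le> L ^ (m+1) * (Cosc * CP * U)" using UC L by simp
    moreover have "0 \<le> CPi * (Cosc * CP * U)" using UC Cosc by simp
    moreover have "cb Cosc CPi * U =
        U + Cosc * CP * U + L ^ (m+1) * (Cosc * CP * U) + CPi * (Cosc * CP * U)"
      unfolding cb_def by (simp only: distrib_right mult.assoc mult_1_left)
    ultimately show "U \<le> cb Cosc CPi * U" "Cosc * CP * U \<le> cb Cosc CPi * U"
      "L ^ (m+1) * (Cosc * CP * U) \<le> cb Cosc CPi * U" "CPi * (Cosc * CP * U) \<le> cb Cosc CPi * U"
      using UC U0 by linarith+
  qed
  obtain F' where F': "F' \<in> Z (m+1)" "nn (m+1) F' \<le> cb Cosc CPi * U" "\<And>z. z \<in> N \<Longrightarrow> ip F z = ip F' z"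
    and Fm: "F \<in> Z (m-1)" "nn (m-1) F \<le> cb Cosc CPi * U"
    using data
  proof (elim disjE exE conjE)
    assume "enormZ C2 ipV D Z nZ (m+1) (riesz_inv C2 ipV f) \<le> ennreal Cosc * dual_norm H (normH C2 ipV D) f"
    then have le: "enormZ C2 ipV D Z nZ (m+1) F \<le> ennreal (Cosc * CP * U)" using dn fF by (simp add: order_trans)
    note FZ = enormZ_leD[OF le UC]
    have i: "F \<in> Z (m-1) \<and> nn (m-1) F \<le> L ^ (m+1) * nn (m+1) F"
      by (rule rg.incl_iter[OF _ order_refl FZ(1)]) simp
    have "L ^ (m+1) * nn (m+1) F \<le> L ^ (m+1) * (Cosc * CP * U)" using L by (intro mult_left_mono FZ) simp
    then show ?thesis using that[OF FZ(1)] FZ parts i by (smt (verit))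
  next
    fix Pi0t
    assume eq: "\<forall>v. f (Pi0 C2 ipV H D E v) = f (Pi0t v)"
      and op: "opnormZ C2 ipV D Z nZ (m-1) (m+1) (\<lambda>w. riesz_inv C2 ipV (riesz C2 ipV w \<circ> Pi0t)) \<le> ennreal CPi"
      and le: "enormZ C2 ipV D Z nZ (m-1) (riesz_inv C2 ipV f) \<le> ennreal Cosc * dual_norm H (normH C2 ipV D) f"
    from le have "enormZ C2 ipV D Z nZ (m-1) F \<le> ennreal (Cosc * CP * U)" using dn fF by (simp add: order_trans)
    note FZ = enormZ_leD[OF this UC]
    obtain F' where "\<forall>v\<in>UNIV. ip F' v = f (pr.pi0 v)"
      using V.riesz_representation[OF pr.antidual_pi0[OF f']] by blast
    then have F': "\<And>v. ip F' v = f (pr.pi0 v)" by simp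
    have TF: "riesz_inv C2 ipV (riesz C2 ipV F \<circ> Pi0t) = F'"
      by (rule riesz_inv_eqI) (use eq in \<open>simp add: riesz_def F F' Pi0_eq\<close>)
    have T0: "riesz_inv C2 ipV (riesz C2 ipV 0 \<circ> Pi0t) = 0"
      by (rule riesz_inv_eqI) (simp add: riesz_def pr.ip_simps)
    have "F' \<in> Z (m+1) \<and> nn (m+1) F' \<le> CPi * nn (m-1) F"
      using opnormZ_leD[OF op less_imp_le[OF Cosc(2)] _ order_refl FZ(1) T0] unfolding TF by simp
    moreover have "CPi * nn (m-1) F \<le> CPi * (Cosc * CP * U)" using Cosc by (intro mult_left_mono FZ) simp
    moreover have "ip F z = ip F' z" if "z \<in> N" for z by (simp add: F F' pr.pi0_N_id[OF that])
    ultimately show ?thesis using that[of F'] FZ parts by (smt (verit))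
  qed
  have "hnorm a u \<le> cb Cosc CPi * U" using parts(1) by (simp add: U_def hnorm_a)
  from rg.solution_regularity[OF u PF Fm F' this] show ?thesis by (simp only: U_def)
qed

end

section \<open>Uniform constants\<close>

text \<open>
  The inclusions are assumed for each operator separately, with a norm of \<open>Z 1\<close> that depends on it. One
  operator is used as a reference: from \<open>Z 2\<close> upwards the norms are the same for all of them, and the
  norms of \<open>Z 1\<close> are uniformly equivalent.
\<close>

lemma uniform_inclusions:
  assumes cs: "\<And>P D E. assumption2 scl ipV H ipH Creg C1 C2 CE m Z nZ P D E \<Longrightarrow>
      coercive_setting K \<alpha> Cd Creg' 1 m scl ipV H ipH C1 C2 CE P D E"
  shows "\<exists>L\<ge>1. \<forall>P D E. assumption2 scl ipV H ipH Creg C1 C2 CE m Z nZ P D E \<longrightarrow>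
      (\<forall>j\<in>{1..m+1}. \<forall>x\<in>Z j. normZ C2 ipV D nZ (j-1) x \<le> L * normZ C2 ipV D nZ j x)"
proof (cases "\<exists>P D E. assumption2 scl ipV H ipH Creg C1 C2 CE m Z nZ P D E")
  case False
  then show ?thesis by (intro exI[of _ 1]) auto
next
  case True
  then obtain P0 D0 E0 where A0: "assumption2 scl ipV H ipH Creg C1 C2 CE m Z nZ P0 D0 E0" by blast
  interpret R: coercive_setting K \<alpha> Cd Creg' 1 m scl ipV H ipH C1 C2 CE P0 D0 E0 by (rule cs[OF A0])
  have inc0: "\<forall>j\<in>{1..m+1}. continuously_included (Z j) (normZ C2 ipV D0 nZ j) (Z (j-1)) (normZ C2 ipV D0 nZ (j-1))"
    using A0 unfolding assumption2_def by blast
  then have "\<forall>j. \<exists>k. j \<in> {1..m+1} \<longrightarrow> (\<forall>x\<in>Z j. normZ C2 ipV D0 nZ (j-1) x \<le> k * normZ C2 ipV D0 nZ j x)"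
    unfolding continuously_included_def by blast
  then obtain k where k: "\<And>j x. j \<in> {1..m+1} \<Longrightarrow> x \<in> Z j \<Longrightarrow>
      normZ C2 ipV D0 nZ (j-1) x \<le> k j * normZ C2 ipV D0 nZ j x" by metis
  have nonneg: "0 \<le> nZ j x" if "j \<in> {2..m+1}" "x \<in> Z j" for j x
  proof -
    have "normed_on scl (Z j) (normZ C2 ipV D0 nZ j)"
      using A0 that(1) unfolding assumption2_def by auto
    then show ?thesis using that by (auto simp: normed_on_def normZ_def split: if_splits)
  qed
  define c where "c = sqrt (C2 + 2 * (K\<^sup>2 * C1))"
  define q where "q = 1 + c / sqrt C1"
  have c0: "0 \<le> c / sqrt C1" using R.C_pos by (simp add: c_def)
  define L where "L = 1 + K + q * (\<Sum>j\<le>m+1. \<bar>k j\<bar>)"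
  have q1: "1 \<le> q" using c0 by (simp add: q_def)
  have sum0: "0 \<le> (\<Sum>j\<le>m+1. \<bar>k j\<bar>)" by (rule sum_nonneg) simp
  have L1: "1 \<le> L" "K \<le> L" using R.K q1 sum0 by (simp_all add: L_def)
  have kL: "q * \<bar>k j\<bar> \<le> L" if "j \<le> m + 1" for j
  proof -
    have "\<bar>k j\<bar> \<le> (\<Sum>j\<le>m+1. \<bar>k j\<bar>)"
      by (rule member_le_sum[of j "{..m+1}" "\<lambda>j. \<bar>k j\<bar>"]) (use that in auto)
    then have "q * \<bar>k j\<bar> \<le> q * (\<Sum>j\<le>m+1. \<bar>k j\<bar>)" using q1 by (intro mult_left_mono) auto
    then show ?thesis using R.K by (simp add: L_def)
  qed
  have "normZ C2 ipV D nZ (j-1) x \<le> L * normZ C2 ipV D nZ j x"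
    if A: "assumption2 scl ipV H ipH Creg C1 C2 CE m Z nZ P D E" and j: "j \<in> {1..m+1}" and x: "x \<in> Z j"
    for P D E j x
  proof -
    interpret S: coercive_setting K \<alpha> Cd Creg' 1 m scl ipV H ipH C1 C2 CE P D E by (rule cs[OF A])
    have Z1: "Z 1 = H" using A unfolding assumption2_def by blast
    consider "j = 1" | "j = 2" | "3 \<le> j" using j by fastforce
    then show ?thesis
    proof cases
      case 1
      then have xH: "x \<in> H" using x Z1 by simp
      have "normV C2 ipV x \<le> K * normH C2 ipV D x"
        using S.embed'[OF xH] by (simp only: S.hnorm_ip S.hnorm_a)
      also have "\<dots> \<le> L * normH C2 ipV D x"
        using S.HS.nrm_ge_0[OF xH] L1(2) by (intro mult_right_mono) (simp_all add: S.hnorm_a)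
      finally show ?thesis using 1 by (simp add: normZ_def)
    next
      case 2
      have xH: "x \<in> H" using inc0 j 2 x Z1 unfolding continuously_included_def by force
      have n2: "0 \<le> nZ 2 x" using nonneg[of 2 x] j 2 x by simp
      have "normH C2 ipV D x \<le> c * hnorm ipH x" unfolding c_def by (rule S.normH_upper[OF xH])
      also have "\<dots> = c / sqrt C1 * (sqrt C1 * hnorm ipH x)" using R.C_pos by simp
      also have "\<dots> \<le> c / sqrt C1 * normH C2 ipV D0 x" by (rule mult_left_mono[OF R.normH_lower[OF xH] c0])
      also have "\<dots> \<le> c / sqrt C1 * (\<bar>k 2\<bar> * nZ 2 x)"
      proof (rule mult_left_mono[OF _ c0])
        have "normH C2 ipV D0 x \<le> k 2 * nZ 2 x" using k[of 2 x] j 2 x by (simp add: normZ_def)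
        also have "\<dots> \<le> \<bar>k 2\<bar> * nZ 2 x" using n2 by (intro mult_right_mono) auto
        finally show "normH C2 ipV D0 x \<le> \<bar>k 2\<bar> * nZ 2 x" .
      qed
      also have "\<dots> \<le> q * (\<bar>k 2\<bar> * nZ 2 x)" using n2 by (intro mult_right_mono) (simp_all add: q_def)
      also have "\<dots> \<le> L * nZ 2 x" using mult_right_mono[OF kL n2] j 2 by (simp add: mult.assoc)
      finally show ?thesis using 2 by (simp add: normZ_def)
    next
      case 3
      have n: "0 \<le> nZ j x" using nonneg[of j x] j 3 x by simp
      have j1: "j - 1 \<noteq> 0" "j - 1 \<noteq> 1" "j \<noteq> 0" "j \<noteq> 1" using 3 by auto
      have "nZ (j-1) x \<le> k j * nZ j x" using k[OF j x] by (simp only: normZ_def j1 if_False)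
      also have "\<dots> \<le> (q * \<bar>k j\<bar>) * nZ j x"
      proof (rule mult_right_mono[OF _ n])
        have "1 * \<bar>k j\<bar> \<le> q * \<bar>k j\<bar>" using q1 by (intro mult_right_mono) auto
        then show "k j \<le> q * \<bar>k j\<bar>" by linarith
      qed
      also have "\<dots> \<le> L * nZ j x" using kL[of j] j n by (intro mult_right_mono) auto
      finally show ?thesis by (simp only: normZ_def j1 if_False)
    qed
  qed
  then show ?thesis using L1(1) by blast
qed

text \<open>
  What remains is to choose the constants before the operator and to pass to extended real numbers. In the quotient
  estimate the case \<open>\<parallel>u\<parallel>\<^sub>H = 0\<close> is covered by the convention that division by zero gives zero.
\<close>

theorem theorem2p9:
  fixes scl :: "complex \<Rightarrow> 'v::ab_group_add \<Rightarrow> 'v"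
    and ipV ipH :: "'v \<Rightarrow> 'v \<Rightarrow> complex"
    and H :: "'v set"
    and Z :: "nat \<Rightarrow> 'v set" and nZ :: "nat \<Rightarrow> 'v \<Rightarrow> real"
    and m :: nat
    and CE C1 C2 Creg Cosc CPi :: real
  assumes "hilbert_pair scl ipV H ipH"
    and "CE > 0" "C1 > 0" "C2 > 0" "Creg > 0" "Cosc > 0" "CPi > 0"
    and "m \<ge> 1"
    and "Z 0 = UNIV" "Z 1 = H"
  shows "\<exists>c>0. \<exists>C>0. \<forall>P D E Hh.
    assumption2 scl ipV H ipH Creg C1 C2 CE m Z nZ P D E \<longrightarrow>
    assumption2 scl ipV H ipH Creg C1 C2 CE m Z nZ (op_adj P) (op_adj D) (op_adj E) \<longrightarrow>
    (\<forall>f \<in> antidual scl H (hnorm ipH). \<exists>!u. u \<in> H \<and> (\<forall>v\<in>H. P u v = f v)) \<longrightarrow>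
    module.subspace scl Hh \<longrightarrow>
    closedin (Metric_space.mtopology H (dist_on H (hnorm ipH))) Hh \<longrightarrow>
    (let \<eta> = approx_norm C2 ipV D m Z nZ Hh;
         M = adj_solution_norm scl C2 ipV H P D E
     in
      gamma_dv C2 ipV H D E Hh + gamma_dv C2 ipV H (op_adj D) (op_adj E) Hh + \<eta>\<^sup>2 * (1 + M)
        \<le> ennreal c \<longrightarrow>
      (\<forall>f \<in> antidual scl H (hnorm ipH). \<forall>u\<in>H. (\<forall>v\<in>H. P u v = f v) \<longrightarrow>
        (\<exists>!uh. galerkin P Hh u uh) \<and>
        (\<forall>uh. galerkin P Hh u uh \<longrightarrow>
          ennreal (normH C2 ipV D (u - uh))
            \<le> ennreal C * (1 + \<eta> * (1 + M)) *
              ennreal (normH C2 ipV D (u - Pi_h C2 ipV D Hh u)) \<and>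
          (f \<in> antidual scl UNIV (hnorm ipV) \<and> (\<exists>v. f v \<noteq> 0) \<and>
             (enormZ C2 ipV D Z nZ (m+1) (riesz_inv C2 ipV f)
                \<le> ennreal Cosc * dual_norm H (normH C2 ipV D) f \<or>
              (\<exists>Pi0t. Vector_Spaces.linear scl scl Pi0t \<and>
                 opnorm UNIV (enorm_on UNIV (normV C2 ipV)) (enorm_on UNIV (normV C2 ipV)) Pi0t < \<infinity> \<and>
                 (\<forall>v. f (Pi0 C2 ipV H D E v) = f (Pi0t v)) \<and>
                 (\<forall>v. Pi0 C2 ipV H D E (Pi0t v) = Pi0t v) \<and>
                 opnormZ C2 ipV D Z nZ (m-1) (m+1)
                   (\<lambda>w. riesz_inv C2 ipV (riesz C2 ipV w \<circ> Pi0t)) \<le> ennreal CPi \<and>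
                 enormZ C2 ipV D Z nZ (m-1) (riesz_inv C2 ipV f)
                   \<le> ennreal Cosc * dual_norm H (normH C2 ipV D) f)) \<longrightarrow>
           ennreal (normH C2 ipV D (u - uh) / normH C2 ipV D u)
             \<le> ennreal C * (1 + \<eta> * (1 + M)) * \<eta>))))"
proof -
  interpret iH: hilbert_space scl H ipH
    using assms(1) unfolding hilbert_pair_def by (intro hilbert_space_complex_hilbert_on) blast
  obtain K0 where K0: "\<And>v. v \<in> H \<Longrightarrow> hnorm ipV v \<le> K0 * hnorm ipH v"
    using assms(1) unfolding hilbert_pair_def continuously_included_def by blast
  define K where "K = max 1 (sqrt C2 * K0 / sqrt C1)"
  define \<alpha> where "\<alpha> = min 1 (CE / C2)"
  define Cd where "Cd = C2 / C1 + K\<^sup>2"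
  define Creg' where "Creg' = max 1 Creg"
  have emb: "sqrt C2 * hnorm ipV v \<le> K * (sqrt C1 * hnorm ipH v)" if v: "v \<in> H" for v
  proof -
    have "sqrt C2 * hnorm ipV v \<le> sqrt C2 * (K0 * hnorm ipH v)" using assms(4) by (intro mult_left_mono K0 v) simp
    also have "\<dots> = sqrt C2 * K0 / sqrt C1 * (sqrt C1 * hnorm ipH v)" using assms(3) by simp
    also have "\<dots> \<le> K * (sqrt C1 * hnorm ipH v)"
      using assms(3) iH.nrm_ge_0[OF v] by (intro mult_right_mono) (simp_all add: K_def)
    finally show ?thesis .
  qed
  have con: "constants K \<alpha> Cd Creg' L m" if "1 \<le> L" for L
    using assms that by unfold_locales (simp_all add: K_def \<alpha>_def Cd_def Creg'_def)
  have \<alpha>CE: "\<alpha> * C2 \<le> CE"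
  proof -
    have "\<alpha> * C2 \<le> CE / C2 * C2" using assms(4) by (intro mult_right_mono) (simp_all add: \<alpha>_def)
    then show ?thesis using assms(4) by simp
  qed
  have cs: "coercive_setting K \<alpha> Cd Creg' L m scl ipV H ipH C1 C2 CE P D E"
    if "1 \<le> L" "assumption2 scl ipV H ipH Creg C1 C2 CE m Z nZ P D E" for L P D E
  proof -
    interpret constants K \<alpha> Cd Creg' L m by (rule con[OF that(1)])
    show ?thesis
      using that(2) emb \<alpha>CE by unfold_locales (simp_all add: Cd_def assumption2_def)
  qed
  obtain L where L: "1 \<le> L"
    "\<And>P D E j x. assumption2 scl ipV H ipH Creg C1 C2 CE m Z nZ P D E \<Longrightarrow> j \<in> {1..m+1} \<Longrightarrow> x \<in> Z j \<Longrightarrow>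
      normZ C2 ipV D nZ (j-1) x \<le> L * normZ C2 ipV D nZ j x"
    using uniform_inclusions[of scl ipV H ipH Creg C1 C2 CE m Z nZ K \<alpha> Cd Creg', OF cs[OF order_refl]] by metis
  interpret c: constants K \<alpha> Cd Creg' L m by (rule con[OF L(1)])
  define T where "T = c.sig (m+1) * (c.cdata * c.cb Cosc CPi)"
  define C where "C = c.Cerr * (1 + T)"
  have T0: "0 \<le> T"
    using c.sig_ge_0 c.cdata_ge(1) c.CP_ge_0 L(1) assms(6,7) by (simp add: T_def c.cb_def)
  have C: "0 < C" "c.Cerr \<le> C" "c.Cerr * T \<le> C"
  proof -
    have "C = c.Cerr + c.Cerr * T" by (simp add: C_def distrib_left)
    moreover have "0 \<le> c.Cerr * T" using c.Cerr_ge_1 T0 by simp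
    ultimately show "0 < C" "c.Cerr \<le> C" "c.Cerr * T \<le> C" using c.Cerr_ge_1 by linarith+
  qed
  show ?thesis
    unfolding Let_def
  proof (rule exI[of _ c.csmall], rule conjI[OF c.csmall_pos], rule exI[of _ C], rule conjI[OF C(1)],
      intro allI impI ballI)
    fix P D E :: "'v \<Rightarrow> 'v \<Rightarrow> complex" and Hh f u
    assume A: "assumption2 scl ipV H ipH Creg C1 C2 CE m Z nZ P D E"
      and A': "assumption2 scl ipV H ipH Creg C1 C2 CE m Z nZ (op_adj P) (op_adj D) (op_adj E)"
      and uniq: "\<forall>f\<in>antidual scl H (hnorm ipH). \<exists>!u. u \<in> H \<and> (\<forall>v\<in>H. P u v = f v)"
      and sub: "module.subspace scl Hh"
      and cl: "closedin (Metric_space.mtopology H (dist_on H (hnorm ipH))) Hh"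
      and small: "gamma_dv C2 ipV H D E Hh + gamma_dv C2 ipV H (op_adj D) (op_adj E) Hh +
         (approx_norm C2 ipV D m Z nZ Hh)\<^sup>2 * (1 + adj_solution_norm scl C2 ipV H P D E) \<le> ennreal c.csmall"
      and f: "f \<in> antidual scl H (hnorm ipH)" and u: "u \<in> H" and Pu: "\<forall>v\<in>H. P u v = f v"
    interpret s: solvable_setting K \<alpha> Cd Creg' L m scl ipV H ipH C1 C2 CE P D E Creg Z nZ
    proof -
      interpret coercive_setting K \<alpha> Cd Creg' L m scl ipV H ipH C1 C2 CE P D E by (rule cs[OF L(1) A])
      show "solvable_setting K \<alpha> Cd Creg' L m scl ipV H ipH C1 C2 CE P D E Creg Z nZ"
        by unfold_locales (use A A' assms(5) uniq L(2)[OF A] in \<open>auto simp: Creg'_def\<close>)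
    qed
    obtain \<eta> M where \<eta>M: "0 \<le> \<eta>" "0 \<le> M" "approx_norm C2 ipV D m Z nZ Hh = ennreal \<eta>"
        "adj_solution_norm scl C2 ipV H P D E = ennreal M"
      and ex1: "\<And>u. u \<in> H \<Longrightarrow> \<exists>!uh. galerkin P Hh u uh"
      and err: "\<And>u uh. u \<in> H \<Longrightarrow> galerkin P Hh u uh \<Longrightarrow> u - uh \<in> H \<and>
        normH C2 ipV D (u - uh) \<le> c.Cerr * (1 + \<eta> * (1 + M)) * normH C2 ipV D (u - Pi_h C2 ipV D Hh u)"
      and projH: "\<And>u. u \<in> H \<Longrightarrow> u - Pi_h C2 ipV D Hh u \<in> H"
      and appr: "\<And>u. u \<in> Z (m+1) \<Longrightarrow>
        normH C2 ipV D (u - Pi_h C2 ipV D Hh u) \<le> \<eta> * normZ C2 ipV D nZ (m+1) u"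
      by (rule s.galerkin_estimates[OF sub cl small]) blast
    have nH0: "0 \<le> normH C2 ipV D v" if "v \<in> H" for v
      using s.HS.nrm_ge_0[OF that] by (simp only: s.hnorm_a)
    define t where "t = 1 + \<eta> * (1 + M)"
    have t0: "0 \<le> t" using \<eta>M by (simp add: t_def)
    have et: "1 + ennreal \<eta> * (1 + ennreal M) = ennreal t"
      using \<eta>M by (simp add: t_def ennreal_mult ennreal_plus)
    have est1: "ennreal (normH C2 ipV D (u - uh)) \<le> ennreal C * ennreal t *
        ennreal (normH C2 ipV D (u - Pi_h C2 ipV D Hh u))" if g: "galerkin P Hh u uh" for uh
    proof -
      have "normH C2 ipV D (u - uh) \<le> c.Cerr * t * normH C2 ipV D (u - Pi_h C2 ipV D Hh u)"
        using err[OF u g] by (simp only: t_def)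
      also have "\<dots> \<le> C * t * normH C2 ipV D (u - Pi_h C2 ipV D Hh u)"
        using C t0 nH0[OF projH[OF u]] by (intro mult_right_mono) auto
      finally have "ennreal (normH C2 ipV D (u - uh)) \<le> ennreal (C * t * normH C2 ipV D (u - Pi_h C2 ipV D Hh u))"
        by (rule ennreal_leI)
      then show ?thesis using C t0 nH0[OF projH[OF u]] by (simp add: ennreal_mult)
    qed
    have est2: "ennreal (normH C2 ipV D (u - uh) / normH C2 ipV D u) \<le> ennreal C * ennreal t * ennreal \<eta>"
      if g: "galerkin P Hh u uh" and fV: "f \<in> antidual scl UNIV (hnorm ipV)"
        and data: "enormZ C2 ipV D Z nZ (m+1) (riesz_inv C2 ipV f)
                \<le> ennreal Cosc * dual_norm H (normH C2 ipV D) f \<or>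
              (\<exists>Pi0t. Vector_Spaces.linear scl scl Pi0t \<and>
                 opnorm UNIV (enorm_on UNIV (normV C2 ipV)) (enorm_on UNIV (normV C2 ipV)) Pi0t < \<infinity> \<and>
                 (\<forall>v. f (Pi0 C2 ipV H D E v) = f (Pi0t v)) \<and>
                 (\<forall>v. Pi0 C2 ipV H D E (Pi0t v) = Pi0t v) \<and>
                 opnormZ C2 ipV D Z nZ (m-1) (m+1)
                   (\<lambda>w. riesz_inv C2 ipV (riesz C2 ipV w \<circ> Pi0t)) \<le> ennreal CPi \<and>
                 enormZ C2 ipV D Z nZ (m-1) (riesz_inv C2 ipV f)
                   \<le> ennreal Cosc * dual_norm H (normH C2 ipV D) f)" for uh
    proof -
      have reg: "u \<in> Z (m+1) \<and> normZ C2 ipV D nZ (m+1) u \<le>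
          c.sig (m+1) * (c.cdata * (c.cb Cosc CPi * normH C2 ipV D u))"
        by (rule s.oscillating_data_regularity[OF assms(6,7) fV u Pu]) (use data in blast)
      define U where "U = normH C2 ipV D u"
      have U0: "0 \<le> U" unfolding U_def by (rule nH0[OF u])
      have nu: "normZ C2 ipV D nZ (m+1) u \<le> T * U"
        using reg by (simp add: T_def U_def mult.assoc)
      have "normH C2 ipV D (u - uh) \<le> c.Cerr * t * normH C2 ipV D (u - Pi_h C2 ipV D Hh u)"
        using err[OF u g] by (simp only: t_def)
      also have "\<dots> \<le> c.Cerr * t * (\<eta> * (T * U))"
      proof (rule mult_left_mono)
        show "normH C2 ipV D (u - Pi_h C2 ipV D Hh u) \<le> \<eta> * (T * U)"
          using appr[OF conjunct1[OF reg]] mult_left_mono[OF nu \<eta>M(1)] by linarith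
      qed (use c.Cerr_ge_1 t0 in simp)
      also have "\<dots> = (c.Cerr * T) * (t * \<eta> * U)" by (simp add: algebra_simps)
      also have "\<dots> \<le> C * (t * \<eta> * U)" using C(3) t0 \<eta>M(1) U0 by (intro mult_right_mono) auto
      finally have le: "normH C2 ipV D (u - uh) \<le> C * t * \<eta> * U" by (simp add: mult.assoc)
      have "normH C2 ipV D (u - uh) / U \<le> C * t * \<eta>"
      proof (cases "U = 0")
        case True
        then show ?thesis using C t0 \<eta>M(1) by simp
      next
        case False
        then show ?thesis using le U0 by (simp add: divide_le_eq)
      qed
      then have "ennreal (normH C2 ipV D (u - uh) / U) \<le> ennreal (C * t * \<eta>)" by (rule ennreal_leI)
      then show ?thesis using C t0 \<eta>M(1) by (simp add: ennreal_mult U_def)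
    qed
    show "(\<exists>!uh. galerkin P Hh u uh) \<and>
        (\<forall>uh. galerkin P Hh u uh \<longrightarrow>
          ennreal (normH C2 ipV D (u - uh))
            \<le> ennreal C * (1 + approx_norm C2 ipV D m Z nZ Hh * (1 + adj_solution_norm scl C2 ipV H P D E)) *
              ennreal (normH C2 ipV D (u - Pi_h C2 ipV D Hh u)) \<and>
          (f \<in> antidual scl UNIV (hnorm ipV) \<and> (\<exists>v. f v \<noteq> 0) \<and>
             (enormZ C2 ipV D Z nZ (m+1) (riesz_inv C2 ipV f)
                \<le> ennreal Cosc * dual_norm H (normH C2 ipV D) f \<or>
              (\<exists>Pi0t. Vector_Spaces.linear scl scl Pi0t \<and>
                 opnorm UNIV (enorm_on UNIV (normV C2 ipV)) (enorm_on UNIV (normV C2 ipV)) Pi0t < \<infinity> \<and>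
                 (\<forall>v. f (Pi0 C2 ipV H D E v) = f (Pi0t v)) \<and>
                 (\<forall>v. Pi0 C2 ipV H D E (Pi0t v) = Pi0t v) \<and>
                 opnormZ C2 ipV D Z nZ (m-1) (m+1)
                   (\<lambda>w. riesz_inv C2 ipV (riesz C2 ipV w \<circ> Pi0t)) \<le> ennreal CPi \<and>
                 enormZ C2 ipV D Z nZ (m-1) (riesz_inv C2 ipV f)
                   \<le> ennreal Cosc * dual_norm H (normH C2 ipV D) f)) \<longrightarrow>
           ennreal (normH C2 ipV D (u - uh) / normH C2 ipV D u)
             \<le> ennreal C * (1 + approx_norm C2 ipV D m Z nZ Hh * (1 + adj_solution_norm scl C2 ipV H P D E)) *
               approx_norm C2 ipV D m Z nZ Hh))"
      unfolding \<eta>M(3,4) et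
      by (intro conjI allI impI ex1[OF u] est1) (use est2 in blast)+
  qed
qed

end
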